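(* Let $X$ be a complex affine algebraic variety of dimension $k$. Then there is a bi-Lipschitz and regular embedding $f:X\to\mathbb{C}^{2k+1}$ such that the set $f(X)$ is an affine algebraic variety. Moreover, this embedding is unique up to a bi-Lipschitz semialgebraic homeomorphism of $\mathbb{C}^{2k+1}$: for any two such embeddings $f,g:X\to\mathbb{C}^{2k+1}$ there is a bi-Lipschitz semialgebraic homeomorphism $\Phi$ of $\mathbb{C}^{2k+1}$ with $g=\Phi\circ f$.
   Context: Here $X$ is a closed algebraic subset of some $\mathbb{C}^N$, $k$ is its complex dimension, and $X$ carries the outer metric, i.e. the restriction of the Euclidean distance of $\mathbb{C}^N\cong\mathbb{R}^{2N}$. A bi-Lipschitz embedding $f:X\to\mathbb{C}^n$ is a map whose image $f(X)$ is closed and such that $f:X\to f(X)$ is a bijection with $f$ and $f^{-1}$ Lipschitz with respect to the outer metrics. Regular means given by (restrictions of) polynomials. Semialgebraicity of maps of $\mathbb{C}^n$ is understood via $\mathbb{C}^n\cong\mathbb{R}^{2n}$. *)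

theory Defs
  imports "HOL-Analysis.Analysis"
begin

section \<open>Polynomial functions and algebraic subsets of complex affine space\<close>

text \<open>
  Since the complex numbers are infinite, polynomials in the coordinates can be identified
  with polynomial functions. This mirrors \<^const>\<open>real_polynomial_function\<close>, with complex
  coordinates as generators (so no complex conjugation is available).
\<close>

inductive complex_polynomial_function :: "(complex ^ 'n \<Rightarrow> complex) \<Rightarrow> bool" where
  coord: "complex_polynomial_function (\<lambda>x. x $ i)"
| const: "complex_polynomial_function (\<lambda>x. c)"
| add: "\<lbrakk>complex_polynomial_function p; complex_polynomial_function q\<rbrakk>
    \<Longrightarrow> complex_polynomial_function (\<lambda>x. p x + q x)"
| mult: "\<lbrakk>complex_polynomial_function p; complex_polynomial_function q\<rbrakk>
    \<Longrightarrow> complex_polynomial_function (\<lambda>x. p x * q x)"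

definition algebraic_set :: "(complex ^ 'n) set \<Rightarrow> bool" where
  "algebraic_set X \<longleftrightarrow>
    (\<exists>P. (\<forall>p\<in>P. complex_polynomial_function p) \<and> X = {x. \<forall>p\<in>P. p x = 0})"

definition irreducible_algebraic_set :: "(complex ^ 'n) set \<Rightarrow> bool" where
  "irreducible_algebraic_set Z \<longleftrightarrow>
    algebraic_set Z \<and> Z \<noteq> {} \<and>
    (\<forall>A B. algebraic_set A \<and> algebraic_set B \<and> Z = A \<union> B \<longrightarrow> Z = A \<or> Z = B)"

definition irreducible_chain :: "(complex ^ 'n) set \<Rightarrow> nat \<Rightarrow> (nat \<Rightarrow> (complex ^ 'n) set) \<Rightarrow> bool" where
  "irreducible_chain X d Z \<longleftrightarrow>
    (\<forall>i\<le>d. irreducible_algebraic_set (Z i) \<and> Z i \<subseteq> X) \<and> (\<forall>i<d. Z i \<subset> Z (Suc i))"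

text \<open>
  The complex dimension of an algebraic set is its Krull dimension: the maximal length \<open>k\<close> of a
  strictly increasing chain \<open>Z 0 \<subset> \<dots> \<subset> Z k\<close> of irreducible algebraic subsets. Phrased as a
  relation, so that the empty set has no dimension rather than dimension 0.
\<close>

definition has_algebraic_dim :: "(complex ^ 'n) set \<Rightarrow> nat \<Rightarrow> bool" where
  "has_algebraic_dim X k \<longleftrightarrow>
    (\<exists>Z. irreducible_chain X k Z) \<and> (\<forall>d. (\<exists>Z. irreducible_chain X d Z) \<longrightarrow> d \<le> k)"

section \<open>Regular and bi-Lipschitz maps\<close>

text \<open>Maps on \<open>X\<close> are total functions in HOL, of which only the values on \<open>X\<close> matter.\<close>

definition regular_on :: "(complex ^ 'n) set \<Rightarrow> (complex ^ 'n \<Rightarrow> complex ^ 'm) \<Rightarrow> bool" where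
  "regular_on X f \<longleftrightarrow>
    (\<exists>p. (\<forall>i. complex_polynomial_function (\<lambda>x. p x $ i)) \<and> (\<forall>x\<in>X. f x = p x))"

definition bi_lipschitz_embedding ::
    "'a::metric_space set \<Rightarrow> ('a \<Rightarrow> 'b::metric_space) \<Rightarrow> bool" where
  "bi_lipschitz_embedding X f \<longleftrightarrow>
    closed (f ` X) \<and> inj_on f X \<and>
    (\<exists>L. L-lipschitz_on X f) \<and> (\<exists>L. L-lipschitz_on (f ` X) (inv_into X f))"

definition regular_bi_lipschitz_embedding ::
    "(complex ^ 'n) set \<Rightarrow> (complex ^ 'n \<Rightarrow> complex ^ 'm) \<Rightarrow> bool" where
  "regular_bi_lipschitz_embedding X f \<longleftrightarrow>
    regular_on X f \<and> bi_lipschitz_embedding X f \<and> algebraic_set (f ` X)"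

section \<open>Semialgebraic sets and maps\<close>

text \<open>
  In a Euclidean space, \<^const>\<open>real_polynomial_function\<close> describes the polynomials in the real
  coordinates. For \<^typ>\<open>complex ^ 'n\<close> these are the real and imaginary parts of the components.
\<close>

inductive semialgebraic_set :: "'a::euclidean_space set \<Rightarrow> bool" where
  eq: "real_polynomial_function p \<Longrightarrow> semialgebraic_set {x. p x = 0}"
| gt: "real_polynomial_function p \<Longrightarrow> semialgebraic_set {x. p x > 0}"
| Un: "\<lbrakk>semialgebraic_set A; semialgebraic_set B\<rbrakk> \<Longrightarrow> semialgebraic_set (A \<union> B)"
| Int: "\<lbrakk>semialgebraic_set A; semialgebraic_set B\<rbrakk> \<Longrightarrow> semialgebraic_set (A \<inter> B)"
| Compl: "semialgebraic_set A \<Longrightarrow> semialgebraic_set (- A)"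

definition semialgebraic_map :: "('a::euclidean_space \<Rightarrow> 'b::euclidean_space) \<Rightarrow> bool" where
  "semialgebraic_map f \<longleftrightarrow> semialgebraic_set {(x, y). y = f x}"

definition bi_lipschitz_semialgebraic_homeomorphism ::
    "('a::euclidean_space \<Rightarrow> 'a) \<Rightarrow> bool" where
  "bi_lipschitz_semialgebraic_homeomorphism \<Phi> \<longleftrightarrow>
    (\<exists>\<Psi>. homeomorphism UNIV UNIV \<Phi> \<Psi> \<and>
      (\<exists>L. L-lipschitz_on UNIV \<Phi>) \<and> (\<exists>L. L-lipschitz_on UNIV \<Psi>)) \<and>
    semialgebraic_map \<Phi>"

end

theory Submission
  imports Defs "HOL-Computational_Algebra.Fundamental_Theorem_Algebra" "HOL-Library.Multiset"
begin

text \<open>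
  Dimension is measured by the growth of the Hilbert function: if \<open>X\<close> has Krull dimension \<open>k\<close>, then
  the polynomials of degree at most \<open>s\<close> span a space of dimension \<open>O(s^k)\<close> on \<open>X\<close>. This follows from
  Noether normalization by successive linear projections, since the coordinate subspaces of the
  target of a finite surjection lift to a chain of irreducible subsets of \<open>X\<close>. The bound passes to
  images of polynomial maps and to their Zariski closures. In particular all limits of secants of
  \<open>X\<close> lie in a cone of dimension at most \<open>2k + 1\<close>, so that as long as the ambient dimension exceeds
  \<open>2k + 1\<close> there is a direction outside this cone along which \<open>X\<close> is moreover integral; projecting
  along it is bi-Lipschitz, and the image is algebraic by elimination.

  For uniqueness, let \<open>f\<close> and \<open>g\<close> be two embeddings. For a generic matrix \<open>A\<close> the maps
  \<open>(1 - t) f - t A g\<close> are embeddings for all but finitely many complex \<open>t\<close>. These \<open>t\<close> form a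
  connected set, and embeddings with nearby parameters differ by a small Lipschitz displacement.
  By McShane's formula the displacement extends to a contraction of the ambient space, which is
  semialgebraic by the Tarski-Seidenberg theorem, and the identity plus a contraction is a
  bi-Lipschitz homeomorphism. So \<open>f\<close> is equivalent to \<open>- A g\<close>, hence to \<open>g\<close>.
\<close>

section \<open>Sign-preserving bijections of the line\<close>

text \<open>Dimension enters only as a count: if the source of a polynomial map has fewer
  independent functions than the target has monomials, some polynomial \<open>Q\<close> vanishes on
  the whole image. \<open>X\<close> is unbounded and has tangents as well as chords, so an injective
  projection need not have a Lipschitz inverse. A single \<open>Q\<close> that vanishes on all
  multiples of all secants settles this uniformly: \<open>Q v \<noteq> 0\<close> persists on a ball
  around \<open>v\<close> and keeps every secant at a definite angle from \<open>v\<close>. The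
  matrix \<open>A\<close> makes the pencil generic: matrices that carry some secant of
  \<open>g\<close> to the corresponding secant of \<open>f\<close> fill only a hypersurface as soon
  as \<open>2 * k\<close> is less than the number of rows. The parameter \<open>t\<close> is complex
  because finitely many exceptional values can cut a real interval but not the plane. Quantifiers
  are eliminated by transporting sign tables: if finitely many signs agree at two parameters, an
  increasing bijection of the line matches all signs above them. Algebraic sets may be given by
  infinitely many equations and semialgebraic sets are finite combinations, so the Hilbert basis
  theorem has to mediate.\<close>

lemma strict_mono_on_extend_bijection:
  fixes g :: "real \<Rightarrow> real"
  assumes "finite A" "strict_mono_on A g"
  shows "\<exists>\<theta>. strict_mono \<theta> \<and> surj \<theta> \<and> (\<forall>x\<in>A. \<theta> x = g x)"
  using assms
proof (induction A rule: finite_linorder_max_induct)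
  case empty
  have "strict_mono (\<lambda>x::real. x)" by (simp add: strict_mono_def)
  moreover have "surj (\<lambda>x::real. x)" by simp
  ultimately show ?case by blast
next
  case (insert b A)
  have "strict_mono_on A g"
    using insert.prems by (auto simp: monotone_on_def)
  then obtain \<theta> where \<theta>: "strict_mono \<theta>" "surj \<theta>" "\<forall>x\<in>A. \<theta> x = g x"
    using insert.IH by blast
  show ?case
  proof (cases "A = {}")
    case True
    have "strict_mono (\<lambda>x. x - b + g b)" by (simp add: strict_mono_def)
    moreover have "surj (\<lambda>x. x - b + g b)"
      unfolding surj_def by (intro allI exI[of _ "_ + b - g b"]) simp
    ultimately show ?thesis
      using True by (intro exI[of _ "\<lambda>x. x - b + g b"]) auto
  next
    case False
    define m where "m = Max A"
    have m: "m \<in> A" "\<forall>x\<in>A. x \<le> m"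
      using False insert.hyps(1) by (auto simp: m_def)
    have mb: "m < b" using m insert.hyps(2) by blast
    have gmb: "g m < g b" using insert.prems m mb by (auto simp: monotone_on_def)
    \<comment> \<open>Beyond the old maximum \<open>m\<close> the map continues with the constant
      slope that reaches the prescribed value at \<open>b\<close>.\<close>
    define k where "k = (g b - g m) / (b - m)"
    have k: "k > 0" using mb gmb by (simp add: k_def)
    define \<eta> where "\<eta> x = (if x \<le> m then \<theta> x else g m + (x - m) * k)" for x
    have \<theta>m: "\<theta> m = g m" using \<theta> m by blast
    have "strict_mono \<eta>"
    proof (rule strict_monoI)
      fix x y :: real assume xy: "x < y"
      show "\<eta> x < \<eta> y"
      proof (cases "y \<le> m")
        case True then show ?thesis using xy \<theta>(1) by (auto simp: \<eta>_def strict_mono_def)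
      next
        case y: False
        show ?thesis
        proof (cases "x \<le> m")
          case True
          have "\<theta> x \<le> g m" using True \<theta>(1) \<theta>m by (metis strict_mono_less_eq)
          moreover have "(y - m) * k > 0" using y k by simp
          ultimately show ?thesis using True y by (simp add: \<eta>_def)
        next
          case False then show ?thesis using xy k y by (simp add: \<eta>_def)
        qed
      qed
    qed
    moreover have "surj \<eta>"
      unfolding surj_def
    proof
      fix y
      show "\<exists>x. y = \<eta> x"
      proof (cases "y \<le> g m")
        case True
        obtain x where x: "y = \<theta> x" using \<theta>(2) by (metis surjD)
        then have "x \<le> m" using True \<theta>m \<theta>(1) by (metis strict_mono_less_eq)
        then show ?thesis using x by (auto simp: \<eta>_def)
      next
        case False
        then have "(y - g m) / k > 0" using k by simp
        then have "y = \<eta> (m + (y - g m) / k)" using k by (simp add: \<eta>_def)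
        then show ?thesis by blast
      qed
    qed
    moreover have "\<eta> b = g b" using mb by (simp add: \<eta>_def k_def)
    moreover have "\<forall>x\<in>A. \<eta> x = g x" using \<theta> m by (auto simp: \<eta>_def)
    ultimately show ?thesis by (intro exI[of _ \<eta>]) auto
  qed
qed

lemma poly_sgn_const:
  fixes r :: "real poly"
  assumes "\<forall>u. x \<le> u \<and> u \<le> y \<longrightarrow> poly r u \<noteq> 0" "x \<le> y"
  shows "sgn (poly r x) = sgn (poly r y)"
proof (rule ccontr)
  assume ne: "sgn (poly r x) \<noteq> sgn (poly r y)"
  have "poly r x \<noteq> 0" "poly r y \<noteq> 0" using assms by auto
  then have "poly r x * poly r y < 0" using ne
    by (auto simp: mult_less_0_iff sgn_real_def split: if_splits)
  moreover have "x < y" using ne assms(2) by (cases "x = y") auto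
  ultimately show False using poly_IVT[of x y r] assms by force
qed

text \<open>An increasing polynomial is bounded above on the left by its value at \<open>c\<close>.
  A nonconstant polynomial is unbounded in absolute value there, so it must tend to minus
  infinity.\<close>

lemma poly_neg_left:
  fixes q :: "real poly"
  assumes pq: "\<forall>y\<le>c. poly (pderiv q) y > 0"
  shows "\<exists>y<c. poly q y < 0"
proof (rule ccontr)
  assume "\<not> ?thesis"
  then have nn: "y < c \<Longrightarrow> poly q y \<ge> 0" for y by force
  obtain a0 q0 where q: "q = pCons a0 q0" by (metis pCons_cases)
  have "pderiv q \<noteq> 0" using pq by (metis less_irrefl order_refl poly_0)
  then have q0: "q0 \<noteq> 0" using q by (auto simp: pderiv_pCons)
  have le: "poly q y \<le> poly q c" if yw: "y < c" for y
  proof -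
    obtain x where "y < x" "x < c" "poly q c - poly q y = (c - y) * poly (pderiv q) x"
      using poly_MVT[OF yw] by blast
    then show ?thesis using pq yw
      by (metis diff_ge_0_iff_ge less_eq_real_def mult_nonneg_nonneg)
  qed
  obtain r where r: "\<forall>z. r \<le> \<bar>z\<bar> \<longrightarrow> \<bar>poly q c\<bar> + 1 \<le> \<bar>poly q z\<bar>"
    using poly_infinity[OF q0, of "\<bar>poly q c\<bar> + 1" a0] q by auto
  define y where "y = min (c - 1) (- \<bar>r\<bar>)"
  have y: "y < c" "r \<le> \<bar>y\<bar>" by (auto simp: y_def)
  show False using r[rule_format, OF y(2)] nn[OF y(1)] le[OF y(1)] by linarith
qed

lemma poly_pos_right:
  fixes q :: "real poly"
  assumes "\<forall>y\<ge>c. poly (pderiv q) y > 0"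
  shows "\<exists>y>c. poly q y > 0"
proof -
  define r where "r = - pcompose q [:0, -1:]"
  have r: "poly r x = - poly q (- x)" "poly (pderiv r) x = poly (pderiv q) (- x)" for x
    by (simp_all add: r_def poly_pcompose pderiv_minus pderiv_pcompose pderiv_pCons)
  obtain y where "y < - c" "poly r y < 0"
    using poly_neg_left[of "- c" r] assms r by auto
  then show ?thesis using r by (intro exI[of _ "- y"]) auto
qed

text \<open>Inside a gap of \<open>Z\<close> the polynomial \<open>p\<close> is monotone, so a root
  there forces opposite signs at the two ends. The signs of \<open>q\<close> at the images of the
  ends agree with them, or follow from the sign of its derivative if the gap is unbounded, and the
  intermediate value theorem gives a root of \<open>q\<close> in the image gap.\<close>

lemma matching_root_pos:
  fixes p q :: "real poly"
  assumes \<theta>: "strict_mono \<theta>" "surj \<theta>" and Z: "finite Z"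
    and pZ: "\<forall>t. poly (pderiv p) t = 0 \<longrightarrow> t \<in> Z"
    and sd: "\<forall>t. sgn (poly (pderiv p) t) = sgn (poly (pderiv q) (\<theta> t))"
    and sp: "\<forall>z\<in>Z. sgn (poly p z) = sgn (poly q (\<theta> z))"
    and w: "poly p w = 0" "w \<notin> Z" and pos: "poly (pderiv p) w > 0"
  shows "\<exists>u. poly q u = 0 \<and> (\<forall>z\<in>Z. (z < w \<longleftrightarrow> \<theta> z < u) \<and> (w < z \<longleftrightarrow> u < \<theta> z))"
proof -
  have mono: "\<theta> x < \<theta> y \<longleftrightarrow> x < y" "\<theta> x \<le> \<theta> y \<longleftrightarrow> x \<le> y" for x y
    using \<theta>(1) by (simp_all add: strict_mono_less strict_mono_less_eq)
  have pp: "poly (pderiv p) x > 0"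
    if "\<forall>z\<in>Z. \<not> (min x w \<le> z \<and> z \<le> max x w)" for x
  proof -
    have "sgn (poly (pderiv p) (min x w)) = sgn (poly (pderiv p) (max x w))"
      using that pZ by (intro poly_sgn_const) auto
    then have "sgn (poly (pderiv p) x) = sgn (poly (pderiv p) w)"
      by (cases "x \<le> w") (auto simp: min_def max_def)
    then show ?thesis using pos by (metis sgn_greater sgn_less zero_less_one sgn_pos)
  qed
  have low: "\<exists>y1 < \<theta> w. (\<forall>z\<in>Z. z < w \<longrightarrow> \<theta> z \<le> y1) \<and> poly q y1 < 0"
  proof (cases "{z\<in>Z. z < w} = {}")
    case False
    define a where "a = Max {z\<in>Z. z < w}"
    have a: "a \<in> Z" "a < w" using Max_in[OF _ False] Z by (auto simp: a_def)
    have amax: "z \<le> a" if "z \<in> Z" "z < w" for z using that Z by (auto simp: a_def)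
    obtain x where x: "a < x" "x < w" "poly p w - poly p a = (w - a) * poly (pderiv p) x"
      using poly_MVT[OF a(2)] by blast
    have "poly (pderiv p) x > 0" using x w amax by (intro pp) force
    then have "poly p a < 0" using x a w by (metis diff_gt_0_iff_gt mult_pos_pos)
    then have "poly q (\<theta> a) < 0" using sp a(1) by (metis sgn_less)
    then show ?thesis using a amax mono by blast
  next
    case True
    have pq: "poly (pderiv q) y > 0" if "y \<le> \<theta> w" for y
    proof -
      obtain t where t: "y = \<theta> t" using \<theta>(2) by (metis surjD)
      then have "t \<le> w" using that mono by simp
      then have "poly (pderiv p) t > 0" using True w by (intro pp) force
      then show ?thesis using sd t by (metis sgn_greater)
    qed
    have "\<exists>y1 < \<theta> w. poly q y1 < 0" using pq by (intro poly_neg_left) auto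
    then show ?thesis using True by blast
  qed
  have up: "\<exists>y2 > \<theta> w. (\<forall>z\<in>Z. w < z \<longrightarrow> y2 \<le> \<theta> z) \<and> poly q y2 > 0"
  proof (cases "{z\<in>Z. w < z} = {}")
    case False
    define a where "a = Min {z\<in>Z. w < z}"
    have a: "a \<in> Z" "w < a" using Min_in[OF _ False] Z by (auto simp: a_def)
    have amin: "a \<le> z" if "z \<in> Z" "w < z" for z using that Z by (auto simp: a_def)
    obtain x where x: "w < x" "x < a" "poly p a - poly p w = (a - w) * poly (pderiv p) x"
      using poly_MVT[OF a(2)] by blast
    have "poly (pderiv p) x > 0" using x w amin by (intro pp) force
    then have "poly p a > 0" using x a w by (metis diff_gt_0_iff_gt mult_pos_pos diff_zero)
    then have "poly q (\<theta> a) > 0" using sp a(1) by (metis sgn_greater)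
    then show ?thesis using a amin mono by blast
  next
    case True
    have pq: "poly (pderiv q) y > 0" if "\<theta> w \<le> y" for y
    proof -
      obtain t where t: "y = \<theta> t" using \<theta>(2) by (metis surjD)
      then have "w \<le> t" using that mono by simp
      then have "poly (pderiv p) t > 0" using True w by (intro pp) force
      then show ?thesis using sd t by (metis sgn_greater)
    qed
    have "\<exists>y2 > \<theta> w. poly q y2 > 0" using pq by (intro poly_pos_right) auto
    then show ?thesis using True by blast
  qed
  obtain y1 y2 where y: "y1 < \<theta> w" "\<forall>z\<in>Z. z < w \<longrightarrow> \<theta> z \<le> y1" "poly q y1 < 0"
    "\<theta> w < y2" "\<forall>z\<in>Z. w < z \<longrightarrow> y2 \<le> \<theta> z" "poly q y2 > 0" using low up by blast
  then obtain u where u: "y1 < u" "u < y2" "poly q u = 0"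
    using poly_IVT_pos[of y1 y2 q] by auto
  have "(z < w \<longleftrightarrow> \<theta> z < u) \<and> (w < z \<longleftrightarrow> u < \<theta> z)" if "z \<in> Z" for z
  proof (cases "z < w")
    case True then show ?thesis using y(2) u that by force
  next
    case False
    then have "w < z" using that w(2) by (metis linorder_cases)
    then show ?thesis using y(5) u that by force
  qed
  then show ?thesis using u by blast
qed

lemma matching_root:
  fixes p q :: "real poly"
  assumes \<theta>: "strict_mono \<theta>" "surj \<theta>" and Z: "finite Z"
    and pZ: "\<forall>t. poly (pderiv p) t = 0 \<longrightarrow> t \<in> Z"
    and sd: "\<forall>t. sgn (poly (pderiv p) t) = sgn (poly (pderiv q) (\<theta> t))"
    and sp: "\<forall>z\<in>Z. sgn (poly p z) = sgn (poly q (\<theta> z))"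
    and w: "poly p w = 0" "w \<notin> Z"
  shows "\<exists>u. poly q u = 0 \<and> (\<forall>z\<in>Z. (z < w \<longleftrightarrow> \<theta> z < u) \<and> (w < z \<longleftrightarrow> u < \<theta> z))"
proof (cases "poly (pderiv p) w > 0")
  case True
  then show ?thesis using matching_root_pos[OF assms] by blast
next
  case False
  have "poly (pderiv p) w \<noteq> 0" using pZ w by blast
  with False have "poly (pderiv (- p)) w > 0" by (simp add: pderiv_minus)
  then have "\<exists>u. poly (- q) u = 0 \<and> (\<forall>z\<in>Z. (z < w \<longleftrightarrow> \<theta> z < u) \<and> (w < z \<longleftrightarrow> u < \<theta> z))"
    using pZ sd sp w
    by (intro matching_root_pos[OF \<theta> Z, of "- p"]) (auto simp: pderiv_minus sgn_minus)
  then show ?thesis by simp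
qed

text \<open>All roots of \<open>r'\<close> lie in the image of \<open>Z\<close>. Increasing maps
  that agree on \<open>Z\<close> send \<open>t\<close> into the same gap of that image, and there
  \<open>r'\<close> keeps its sign.\<close>

lemma gap_sign:
  fixes r r' :: "real poly"
  assumes \<theta>: "strict_mono \<theta>" "surj \<theta>" and \<eta>: "strict_mono \<eta>" and Z: "\<forall>z\<in>Z. \<eta> z = \<theta> z"
    and rZ: "\<forall>t. poly r t = 0 \<longrightarrow> t \<in> Z"
    and sr: "\<forall>t. sgn (poly r t) = sgn (poly r' (\<theta> t))"
  shows "sgn (poly r t) = sgn (poly r' (\<eta> t))"
proof (cases "t \<in> Z")
  case True then show ?thesis using sr Z by simp
next
  case False
  have "poly r' u \<noteq> 0" if u: "min (\<theta> t) (\<eta> t) \<le> u" "u \<le> max (\<theta> t) (\<eta> t)" for u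
  proof
    assume 0: "poly r' u = 0"
    obtain c where c: "u = \<theta> c" using \<theta>(2) by (metis surjD)
    then have "c \<in> Z" using rZ sr 0 by (metis sgn_zero_iff)
    then have "u = \<eta> c" "c \<noteq> t" using c Z False by auto
    have "\<theta> t \<le> u \<longleftrightarrow> t \<le> c" "u \<le> \<theta> t \<longleftrightarrow> c \<le> t"
      unfolding c using \<theta>(1) by (simp_all add: strict_mono_less_eq)
    moreover have "u \<le> \<eta> t \<longleftrightarrow> c \<le> t" "\<eta> t \<le> u \<longleftrightarrow> t \<le> c"
      unfolding \<open>u = \<eta> c\<close> using \<eta> by (simp_all add: strict_mono_less_eq)
    ultimately show False
      using \<open>c \<noteq> t\<close> u by (auto simp: min_def max_def split: if_splits)
  qed
  then have "sgn (poly r' (min (\<theta> t) (\<eta> t))) = sgn (poly r' (max (\<theta> t) (\<eta> t)))"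
    by (intro poly_sgn_const) auto
  then show ?thesis using sr by (cases "\<theta> t \<le> \<eta> t") (auto simp: min_def max_def)
qed

text \<open>With no roots of \<open>p\<close> or of its derivative further left, \<open>p\<close>
  runs off to infinity as the argument decreases, so its sign is opposite to that of its
  slope.\<close>

lemma sgn_poly_left_unbounded:
  fixes p :: "real poly"
  assumes "\<forall>u\<le>t. poly p u \<noteq> 0" "\<forall>u\<le>t. poly (pderiv p) u \<noteq> 0"
  shows "sgn (poly p t) = - sgn (poly (pderiv p) t)"
proof -
  have *: "poly q t < 0"
    if q: "\<forall>u\<le>t. poly q u \<noteq> 0" "\<forall>u\<le>t. poly (pderiv q) u \<noteq> 0" "poly (pderiv q) t > 0"
    for q :: "real poly"
  proof -
    have "poly (pderiv q) y > 0" if "y \<le> t" for y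
      using poly_sgn_const[of y t "pderiv q"] q that by (metis sgn_greater)
    then obtain y where y: "y < t" "poly q y < 0" using poly_neg_left by blast
    have "sgn (poly q y) = sgn (poly q t)" using q y by (intro poly_sgn_const) auto
    then show ?thesis using y by (metis sgn_less)
  qed
  show ?thesis
  proof (cases "poly (pderiv p) t > 0")
    case True then show ?thesis using *[of p] assms by simp
  next
    case False
    then have "poly (pderiv p) t < 0" using assms(2) by (metis linorder_neqE_linordered_idom order_refl)
    then show ?thesis using *[of "- p"] assms by (simp add: pderiv_minus)
  qed
qed

lemma sgn_poly_right_of_root:
  fixes p :: "real poly"
  assumes "poly p a = 0" "a < t" "\<forall>u. a < u \<and> u \<le> t \<longrightarrow> poly (pderiv p) u \<noteq> 0"
  shows "sgn (poly p t) = sgn (poly (pderiv p) t)"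
proof -
  obtain x where x: "a < x" "x < t" "poly p t - poly p a = (t - a) * poly (pderiv p) x"
    using poly_MVT[OF assms(2)] by blast
  have "sgn (poly p t) = sgn (poly (pderiv p) x)"
    using x assms(1,2) by (simp add: sgn_mult)
  also have "\<dots> = sgn (poly (pderiv p) t)"
    using x assms(3) by (intro poly_sgn_const) auto
  finally show ?thesis .
qed

text \<open>The values of \<open>\<theta>\<close> on \<open>Z\<close> are kept, and inside the gaps
  it is changed so that each root of \<open>p\<close> goes to the matching root of \<open>q\<close>.
  Rolle's theorem leaves at most one root per gap. Once the roots correspond, the remaining signs
  are forced by the derivative or by the nearest marked point on the left.\<close>

lemma extend_sign_bijection:
  fixes p q :: "real poly"
  assumes \<theta>: "strict_mono \<theta>" "surj \<theta>" and Z: "finite Z"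
    and pZ: "\<forall>t. poly (pderiv p) t = 0 \<longrightarrow> t \<in> Z"
    and sd: "\<forall>t. sgn (poly (pderiv p) t) = sgn (poly (pderiv q) (\<theta> t))"
    and sp: "\<forall>z\<in>Z. sgn (poly p z) = sgn (poly q (\<theta> z))"
    and p0: "p \<noteq> 0"
  shows "\<exists>\<eta>. strict_mono \<eta> \<and> surj \<eta> \<and> (\<forall>z\<in>Z. \<eta> z = \<theta> z) \<and> (\<forall>t. sgn (poly p t) = sgn (poly q (\<eta> t)))"
proof -
  have mono: "\<theta> x < \<theta> y \<longleftrightarrow> x < y" "\<theta> x \<le> \<theta> y \<longleftrightarrow> x \<le> y" "\<theta> x = \<theta> y \<longleftrightarrow> x = y" for x y
    using \<theta>(1) by (simp_all add: strict_mono_less strict_mono_less_eq strict_mono_eq)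
  have qZ: "c \<in> Z" if "poly (pderiv q) (\<theta> c) = 0" for c
    using pZ sd that by (metis sgn_zero_iff)
  define W where "W = {t. poly p t = 0}"
  have fW: "finite W" using poly_roots_finite[OF p0] by (simp add: W_def)
  define \<mu> where "\<mu> w = (SOME u. poly q u = 0 \<and> (\<forall>z\<in>Z. (z < w \<longleftrightarrow> \<theta> z < u) \<and> (w < z \<longleftrightarrow> u < \<theta> z)))" for w
  have \<mu>: "poly q (\<mu> w) = 0" "\<forall>z\<in>Z. (z < w \<longleftrightarrow> \<theta> z < \<mu> w) \<and> (w < z \<longleftrightarrow> \<mu> w < \<theta> z)"
    if "poly p w = 0" "w \<notin> Z" for w
    using someI_ex[OF matching_root[OF \<theta> Z pZ sd sp that]] unfolding \<mu>_def by blast+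
  define g where "g x = (if x \<in> Z then \<theta> x else \<mu> x)" for x
  have "strict_mono_on (Z \<union> W) g"
  proof (rule monotone_onI)
    fix x y assume xy: "x \<in> Z \<union> W" "y \<in> Z \<union> W" "x < y"
    show "g x < g y"
    proof (cases "x \<in> Z \<or> y \<in> Z")
      case True
      then show ?thesis using xy \<mu> mono unfolding g_def W_def by auto
    next
      case False
      then have r: "poly p x = 0" "poly p y = 0" using xy by (auto simp: W_def)
      \<comment> \<open>By Rolle's theorem a point of \<open>Z\<close> separates the two roots of
        \<open>p\<close>, and their partners lie on opposite sides of its image.\<close>
      obtain c where c: "x < c" "c < y" "poly p y - poly p x = (y - x) * poly (pderiv p) c"
        using poly_MVT[OF xy(3)] by blast
      then have "c \<in> Z" using r xy(3) pZ by auto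
      then have "\<mu> x < \<theta> c" "\<theta> c < \<mu> y" using \<mu> r c False by blast+
      then show ?thesis using False by (simp add: g_def)
    qed
  qed
  then obtain \<eta> where \<eta>: "strict_mono \<eta>" "surj \<eta>" "\<forall>x\<in>Z \<union> W. \<eta> x = g x"
    using strict_mono_on_extend_bijection[of "Z \<union> W" g] Z fW by auto
  have mono\<eta>: "\<eta> x < \<eta> y \<longleftrightarrow> x < y" "\<eta> x \<le> \<eta> y \<longleftrightarrow> x \<le> y" "\<eta> x = \<eta> y \<longleftrightarrow> x = y" for x y
    using \<eta>(1) by (simp_all add: strict_mono_less strict_mono_less_eq strict_mono_eq)
  have \<eta>Z: "\<forall>z\<in>Z. \<eta> z = \<theta> z" using \<eta>(3) by (simp add: g_def)
  have root1: "poly q (\<eta> t) = 0" if "poly p t = 0" for t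
  proof -
    have "\<eta> t = g t" using that \<eta>(3) by (simp add: W_def)
    then show ?thesis using that \<mu> sp by (metis g_def sgn_zero_iff)
  qed
  have root2: "poly p t = 0" if qt: "poly q (\<eta> t) = 0" for t
  proof -
    define u where "u = \<eta> t"
    obtain t0 where t0: "u = \<theta> t0" using \<theta>(2) by (metis surjD)
    show ?thesis
    proof (cases "t0 \<in> Z")
      case True
      then have "\<eta> t0 = u" using \<eta>Z t0 by simp
      then have "t0 = t" using mono\<eta> u_def by simp
      then show ?thesis using True sp qt t0 u_def by (metis sgn_zero_iff)
    next
      case False
      have bij: "inv \<theta> (\<theta> x) = x" "\<theta> (inv \<theta> y) = y" for x y
        using \<theta> by (simp_all add: strict_mono_on_imp_inj_on inv_f_f surj_f_inv_f)
      have 1: "strict_mono (inv \<theta>)"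
        by (rule strict_monoI) (metis bij(2) mono(1))
      have 2: "surj (inv \<theta>)" using bij(1) by (metis surjI)
      \<comment> \<open>No extra root of \<open>q\<close> appears: root matching for the inverse of
        \<open>\<theta>\<close>, with \<open>p\<close> and \<open>q\<close> exchanged, gives a root
        \<open>v\<close> of \<open>p\<close> in the corresponding gap. Rolle's theorem for
        \<open>q\<close> then identifies the partner of \<open>v\<close> with
        \<open>u\<close>.\<close>
      have "\<exists>v. poly p v = 0 \<and> (\<forall>z\<in>\<theta> ` Z. (z < u \<longleftrightarrow> inv \<theta> z < v) \<and> (u < z \<longleftrightarrow> v < inv \<theta> z))"
      proof (rule matching_root[OF 1 2])
        show "finite (\<theta> ` Z)" using Z by simp
        show "\<forall>t. poly (pderiv q) t = 0 \<longrightarrow> t \<in> \<theta> ` Z" using qZ \<theta>(2) by (metis imageI surjD)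
        show "\<forall>t. sgn (poly (pderiv q) t) = sgn (poly (pderiv p) (inv \<theta> t))" using sd bij by metis
        show "\<forall>z\<in>\<theta> ` Z. sgn (poly q z) = sgn (poly p (inv \<theta> z))" using sp bij by auto
        show "poly q u = 0" using qt u_def by simp
        show "u \<notin> \<theta> ` Z" using False t0 mono by auto
      qed
      then obtain v where v: "poly p v = 0" "\<forall>z\<in>Z. (\<theta> z < u \<longleftrightarrow> z < v) \<and> (u < \<theta> z \<longleftrightarrow> v < z)"
        using bij by auto
      have vZ: "v \<notin> Z"
      proof
        assume "v \<in> Z"
        then have "\<theta> v = u" using v(2) by (metis less_irrefl linorder_cases)
        then show False using False t0 mono \<open>v \<in> Z\<close> by simp
      qed
      have "\<mu> v = u"
      proof (rule ccontr)
        assume ne: "\<mu> v \<noteq> u"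
        define x y where "x = min u (\<mu> v)" and "y = max u (\<mu> v)"
        have xy: "x < y" using ne by (auto simp: x_def y_def min_def max_def)
        have "poly q x = 0" "poly q y = 0"
          using \<mu>(1)[OF v(1) vZ] qt by (auto simp: x_def y_def min_def max_def u_def)
        moreover obtain c' where c': "x < c'" "c' < y" "poly q y - poly q x = (y - x) * poly (pderiv q) c'"
          using poly_MVT[OF xy] by blast
        ultimately have "poly (pderiv q) c' = 0" using xy by simp
        then obtain c where c: "c \<in> Z" "c' = \<theta> c" using qZ \<theta>(2) by (metis surjD)
        then have "(\<theta> c < u \<longleftrightarrow> \<theta> c < \<mu> v) \<and> (u < \<theta> c \<longleftrightarrow> \<mu> v < \<theta> c)"
          using v(2) \<mu>(2)[OF v(1) vZ] by metis
        then show False using c' c(2) by (auto simp: x_def y_def min_def max_def split: if_splits)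
      qed
      then have "\<eta> v = \<eta> t" using \<eta>(3) v(1) vZ by (simp add: W_def g_def u_def)
      then show ?thesis using mono\<eta> v(1) by simp
    qed
  qed
  have sd': "sgn (poly (pderiv p) t) = sgn (poly (pderiv q) (\<eta> t))" for t
    by (rule gap_sign[OF \<theta> \<eta>(1) \<eta>Z pZ sd])
  have "sgn (poly p t) = sgn (poly q (\<eta> t))" for t
  proof (cases "t \<in> Z \<union> W")
    case True
    then show ?thesis using sp \<eta>Z root1 by (auto simp: W_def)
  next
    case tA: False
    define S where "S = {a\<in>Z \<union> W. a < t}"
    have fS: "finite S" using Z fW by (simp add: S_def)
    show ?thesis
    proof (cases "S = {}")
      case True
      have A: "\<forall>u\<le>t. poly p u \<noteq> 0 \<and> poly (pderiv p) u \<noteq> 0"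
        using True tA pZ unfolding S_def W_def
        by (metis (mono_tags, lifting) Collect_empty_eq UnCI mem_Collect_eq order_le_less)
      have B: "\<forall>u\<le>\<eta> t. poly q u \<noteq> 0 \<and> poly (pderiv q) u \<noteq> 0"
      proof (intro allI impI)
        fix u assume "u \<le> \<eta> t"
        then obtain c where c: "u = \<eta> c" "c \<le> t" using \<eta>(2) mono\<eta> by (metis surjD)
        then have "poly p c \<noteq> 0" "poly (pderiv p) c \<noteq> 0" using A by auto
        then show "poly q u \<noteq> 0 \<and> poly (pderiv q) u \<noteq> 0" using root2 sd' c by (metis sgn_zero_iff)
      qed
      show ?thesis
        using sgn_poly_left_unbounded[of t p] sgn_poly_left_unbounded[of "\<eta> t" q] A B sd' by simp
    next
      case False
      define a where "a = Max S"
      have a: "a \<in> Z \<union> W" "a < t" using Max_in[OF fS False] by (auto simp: a_def S_def)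
      have amax: "c \<notin> Z \<union> W" if "a < c" "c \<le> t" for c
      proof
        assume c: "c \<in> Z \<union> W"
        then have "c \<noteq> t" using tA by blast
        then have "c \<in> S" using c that by (simp add: S_def)
        then show False using fS that by (metis Max_ge a_def leD)
      qed
      have A: "\<forall>u. a < u \<and> u \<le> t \<longrightarrow> poly p u \<noteq> 0 \<and> poly (pderiv p) u \<noteq> 0"
        using amax pZ by (auto simp: W_def)
      have B: "\<forall>u. \<eta> a < u \<and> u \<le> \<eta> t \<longrightarrow> poly q u \<noteq> 0 \<and> poly (pderiv q) u \<noteq> 0"
      proof (intro allI impI)
        fix u assume "\<eta> a < u \<and> u \<le> \<eta> t"
        then obtain c where c: "u = \<eta> c" "a < c" "c \<le> t" using \<eta>(2) mono\<eta> by (metis surjD)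
        then have "poly p c \<noteq> 0" "poly (pderiv p) c \<noteq> 0" using A by auto
        then show "poly q u \<noteq> 0 \<and> poly (pderiv q) u \<noteq> 0" using root2 sd' c by (metis sgn_zero_iff)
      qed
      show ?thesis
      proof (cases "poly p a = 0")
        case True
        then show ?thesis
          using sgn_poly_right_of_root[of p a t] sgn_poly_right_of_root[of q "\<eta> a" "\<eta> t"]
            root1 A B a mono\<eta> sd' by simp
      next
        case pa: False
        then have "a \<in> Z" using a by (simp add: W_def)
        have "sgn (poly p a) = sgn (poly p t)"
          using A pa a by (intro poly_sgn_const) (auto simp: order_le_less)
        moreover have "sgn (poly q (\<eta> a)) = sgn (poly q (\<eta> t))"
          using B root2[of a] pa a mono\<eta> by (intro poly_sgn_const) (auto simp: order_le_less)
        ultimately show ?thesis using sp \<eta>Z \<open>a \<in> Z\<close> by simp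
      qed
    qed
  qed
  then show ?thesis using \<eta> \<eta>Z by blast
qed

text \<open>The roots of all nonzero members of the family serve as \<open>Z\<close>; the derivative
  of \<open>p\<close> is among these members. A member that is identically zero has a partner that
  is zero everywhere, because \<open>\<theta>\<close> is surjective.\<close>

lemma extend_sign_bijection_family:
  fixes p p' :: "real poly" and q q' :: "'k \<Rightarrow> real poly"
  assumes \<theta>: "strict_mono \<theta>" "surj \<theta>" and K: "finite K"
    and sq: "\<forall>k\<in>K. \<forall>t. sgn (poly (q k) t) = sgn (poly (q' k) (\<theta> t))"
    and k0: "k0 \<in> K" "q k0 = pderiv p" "q' k0 = pderiv p'" and p0: "pderiv p \<noteq> 0"
    and sp: "\<forall>k\<in>K. \<forall>t. q k \<noteq> 0 \<and> poly (q k) t = 0 \<longrightarrow> sgn (poly p t) = sgn (poly p' (\<theta> t))"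
  shows "\<exists>\<eta>. strict_mono \<eta> \<and> surj \<eta> \<and> (\<forall>k\<in>K. \<forall>t. sgn (poly (q k) t) = sgn (poly (q' k) (\<eta> t)))
    \<and> (\<forall>t. sgn (poly p t) = sgn (poly p' (\<eta> t)))"
proof -
  define Z where "Z = (\<Union>k\<in>{k\<in>K. q k \<noteq> 0}. {t. poly (q k) t = 0})"
  have Z: "finite Z" using K poly_roots_finite by (auto simp: Z_def)
  have 1: "\<forall>t. poly (pderiv p) t = 0 \<longrightarrow> t \<in> Z" using k0 p0 by (auto simp: Z_def)
  have 2: "\<forall>t. sgn (poly (pderiv p) t) = sgn (poly (pderiv p') (\<theta> t))" using sq k0 by metis
  have 3: "\<forall>z\<in>Z. sgn (poly p z) = sgn (poly p' (\<theta> z))" using sp by (auto simp: Z_def)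
  have "p \<noteq> 0" using p0 by auto
  then obtain \<eta> where \<eta>: "strict_mono \<eta>" "surj \<eta>" "\<forall>z\<in>Z. \<eta> z = \<theta> z"
    "\<forall>t. sgn (poly p t) = sgn (poly p' (\<eta> t))"
    using extend_sign_bijection[OF \<theta> Z 1 2 3] by blast
  have "sgn (poly (q k) t) = sgn (poly (q' k) (\<eta> t))" if k: "k \<in> K" for k t
  proof (cases "q k = 0")
    case True
    obtain s where "\<eta> t = \<theta> s" using \<theta>(2) by (metis surjD)
    then show ?thesis using True sq k by (metis poly_0)
  next
    case False
    then show ?thesis
      using k sq by (intro gap_sign[OF \<theta> \<eta>(1,3)]) (auto simp: Z_def)
  qed
  then show ?thesis using \<eta> by blast
qed

section \<open>The Tarski-Seidenberg theorem\<close>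

lemmas rpf_const = real_polynomial_function.intros(2)
lemmas rpf_add = real_polynomial_function.intros(3)
lemmas rpf_mult = real_polynomial_function.intros(4)

text \<open>A polynomial in one variable whose coefficients are polynomial functions of a parameter,
  paired with a strict bound for its degree (so that the leading coefficient may vanish).\<close>

definition param_poly :: "nat \<times> ('a::real_normed_vector \<Rightarrow> real poly) \<Rightarrow> bool" where
  "param_poly F \<longleftrightarrow> (\<forall>i. real_polynomial_function (\<lambda>x. coeff (snd F x) i)) \<and>
    (\<forall>x i. fst F \<le> i \<longrightarrow> coeff (snd F x) i = 0)"

definition top_coeff :: "nat \<times> ('a \<Rightarrow> real poly) \<Rightarrow> 'a \<Rightarrow> real" where
  "top_coeff F x = coeff (snd F x) (fst F - 1)"

definition param_pderiv :: "nat \<times> ('a \<Rightarrow> real poly) \<Rightarrow> nat \<times> ('a \<Rightarrow> real poly)" where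
  "param_pderiv F = (fst F - 1, \<lambda>x. pderiv (snd F x))"

text \<open>This serves the case of a vanishing leading coefficient: at such a parameter the
  polynomial is unchanged while its degree bound drops.\<close>

definition truncate :: "nat \<times> ('a \<Rightarrow> real poly) \<Rightarrow> nat \<times> ('a \<Rightarrow> real poly)" where
  "truncate F = (fst F - 1, \<lambda>x. snd F x - monom (top_coeff F x) (fst F - 1))"

lemma param_poly_pderiv: "param_poly F \<Longrightarrow> param_poly (param_pderiv F)"
  unfolding param_poly_def param_pderiv_def
  by (auto simp: coeff_pderiv intro!: rpf_mult[OF rpf_const])

lemma param_poly_truncate: "param_poly F \<Longrightarrow> param_poly (truncate F)"
  unfolding param_poly_def truncate_def top_coeff_def
proof (intro conjI allI impI)
  assume F: "(\<forall>i. real_polynomial_function (\<lambda>x. coeff (snd F x) i)) \<and> (\<forall>x i. fst F \<le> i \<longrightarrow> coeff (snd F x) i = 0)"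
  fix i
  show "real_polynomial_function (\<lambda>x. coeff (snd (fst F - 1, \<lambda>x. snd F x - monom (coeff (snd F x) (fst F - 1)) (fst F - 1)) x) i)"
    using F by (cases "i = fst F - 1") (auto simp: rpf_const)
qed (auto simp: Suc_leI)

lemma truncate_eval: "top_coeff F x = 0 \<Longrightarrow> snd (truncate F) x = snd F x"
  by (simp add: truncate_def)

lemma param_poly_top_coeff: "param_poly F \<Longrightarrow> real_polynomial_function (top_coeff F)"
  by (simp add: param_poly_def top_coeff_def[abs_def])

text \<open>Division without inverting the leading coefficient of \<open>G\<close>. Only even powers
  of that coefficient are multiplied in, so at a root of \<open>G\<close> the remainder has the sign
  of \<open>F\<close> wherever the coefficient does not vanish.\<close>

lemma param_pseudo_remainder:
  assumes "param_poly F" "param_poly G" "fst G > 0"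
  shows "\<exists>R. param_poly R \<and> fst R < fst G \<and>
    (\<forall>x. \<exists>e s. smult (top_coeff G x ^ (2 * e)) (snd F x) = snd G x * s + snd R x)"
  using assms
proof (induction "fst F" arbitrary: F rule: less_induct)
  case less
  show ?case
  proof (cases "fst F < fst G")
    case True
    have "\<forall>x. \<exists>e s. smult (top_coeff G x ^ (2 * e)) (snd F x) = snd G x * s + snd F x"
      by (intro allI exI[of _ 0] exI[of _ "0::real poly"]) simp
    then show ?thesis using True less.prems(1) by blast
  next
    case False
    define d where "d = fst F - fst G"
    \<comment> \<open>One division step: both terms have the top coefficient
      \<open>(top_coeff G x)\<^sup>2 * top_coeff F x\<close>, so they cancel and the bound drops by
      one.\<close>
    define H where "H = (fst F - 1, \<lambda>x. smult ((top_coeff G x)\<^sup>2) (snd F x) -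
      smult (top_coeff G x * top_coeff F x) (monom 1 d * snd G x))"
    have F: "\<forall>i. real_polynomial_function (\<lambda>x. coeff (snd F x) i)"
      "fst F \<le> i \<Longrightarrow> coeff (snd F x) i = 0" for x i using less.prems(1) by (auto simp: param_poly_def)
    have G: "\<forall>i. real_polynomial_function (\<lambda>x. coeff (snd G x) i)"
      "fst G \<le> i \<Longrightarrow> coeff (snd G x) i = 0" for x i using less.prems(2) by (auto simp: param_poly_def)
    have cH: "coeff (snd H x) i = (top_coeff G x)\<^sup>2 * coeff (snd F x) i -
      top_coeff G x * top_coeff F x * (if d \<le> i then coeff (snd G x) (i - d) else 0)" for x i
      by (simp add: H_def coeff_monom_mult)
    have "param_poly H"
      unfolding param_poly_def
    proof (intro conjI allI impI)
      fix i
      have "real_polynomial_function (\<lambda>x. if d \<le> i then coeff (snd G x) (i - d) else 0)"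
        using G by (cases "d \<le> i") auto
      then show "real_polynomial_function (\<lambda>x. coeff (snd H x) i)"
        unfolding cH using F G less.prems param_poly_top_coeff[of F] param_poly_top_coeff[of G]
        by (intro real_polynomial_function_diff rpf_mult
            real_polynomial_function_power) auto
    next
      fix x i assume i: "fst H \<le> i"
      show "coeff (snd H x) i = 0"
      proof (cases "i = fst F - 1")
        case True
        then have "i - d = fst G - 1" "d \<le> i" using False less.prems(3) by (auto simp: d_def)
        then show ?thesis using True by (simp add: cH top_coeff_def power2_eq_square)
      next
        case i': False
        then have "fst F \<le> i" "fst G \<le> i - d" "d \<le> i" using i False less.prems(3)
          by (auto simp: H_def d_def)
        then show ?thesis using F(2) G(2) by (simp add: cH)
      qed
    qed
    moreover have "fst H < fst F" using False less.prems(3) by (simp add: H_def)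
    ultimately obtain R where R: "param_poly R" "fst R < fst G"
      "\<forall>x. \<exists>e s. smult (top_coeff G x ^ (2 * e)) (snd H x) = snd G x * s + snd R x"
      using less.hyps less.prems by blast
    have "\<exists>e s. smult (top_coeff G x ^ (2 * e)) (snd F x) = snd G x * s + snd R x" for x
    proof -
      obtain e s where es: "smult (top_coeff G x ^ (2 * e)) (snd H x) = snd G x * s + snd R x"
        using R by blast
      let ?c = "top_coeff G x"
      have "smult (?c ^ (2 * Suc e)) (snd F x) = smult (?c ^ (2 * e)) (snd H x) +
          snd G x * smult (?c ^ (2 * e) * (?c * top_coeff F x)) (monom 1 d)"
        by (simp add: H_def algebra_simps smult_diff_right power2_eq_square mult.assoc
            flip: power_Suc)
      also have "\<dots> = snd G x * (s + smult (?c ^ (2 * e) * (?c * top_coeff F x)) (monom 1 d)) + snd R x"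
        unfolding es by (simp only: algebra_simps)
      finally show ?thesis by blast
    qed
    then show ?thesis using R by blast
  qed
qed

lemma sgn_poly_mod_root:
  assumes "smult (c ^ (2 * e)) p = q * s + r" "c \<noteq> (0::real)" "poly q t = 0"
  shows "sgn (poly p t) = sgn (poly r t)"
proof -
  have "c ^ (2 * e) * poly p t = poly r t"
    using arg_cong[OF assms(1), of "\<lambda>p. poly p t"] assms(3) by simp
  moreover have "c ^ (2 * e) > 0" using assms(2) by (simp add: power_mult)
  ultimately show ?thesis by (metis mult_1 sgn_mult sgn_pos)
qed

text \<open>Finitely many signs at the parameter fix the sign table of the whole family up to
  reparametrization of the line. The induction is on the multiset of degree bounds: a polynomial of
  maximal bound is replaced by its derivative and by its pseudo-remainders modulo the derivative and
  the other members, all of which have smaller bound. At a root of a divisor the remainder knows the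
  sign of the polynomial that was removed.\<close>

lemma param_polys_signs:
  fixes M :: "(nat \<times> ('a::real_normed_vector \<Rightarrow> real poly)) multiset"
  assumes "\<forall>F\<in>#M. param_poly F"
  shows "\<exists>C. finite C \<and> (\<forall>p\<in>C. real_polynomial_function p) \<and>
    (\<forall>x x'. (\<forall>p\<in>C. sgn (p x) = sgn (p x')) \<longrightarrow>
      (\<exists>\<theta>. strict_mono \<theta> \<and> surj \<theta> \<and>
        (\<forall>F\<in>#M. \<forall>t. sgn (poly (snd F x) t) = sgn (poly (snd F x') (\<theta> t)))))"
  using assms
proof (induction M rule: wf_induct_rule[OF wf_inv_image[OF wf_mult[OF wf_less], of "image_mset fst"], case_names less])
  case (less M)
  show ?case (is "\<exists>C. ?P C M")
  proof (cases "\<forall>F\<in>#M. fst F \<le> 1")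
    case True
    define C where "C = (\<lambda>F x. coeff (snd F x) 0) ` set_mset M"
    have "?P C M"
    proof (intro conjI allI impI)
      show "finite C" by (simp add: C_def)
      show "\<forall>p\<in>C. real_polynomial_function p"
        using less.prems by (auto simp: C_def param_poly_def)
      fix x x' assume s: "\<forall>p\<in>C. sgn (p x) = sgn (p x')"
      have c: "poly (snd F x) t = coeff (snd F x) 0" if "F \<in># M" for F x t
      proof -
        have "snd F x = [:coeff (snd F x) 0:]"
        proof (rule poly_eqI)
          fix n show "coeff (snd F x) n = coeff [:coeff (snd F x) 0:] n"
            using True less.prems that by (cases n) (force simp: param_poly_def)+
        qed
        then show ?thesis by (metis poly_pCons poly_0 mult_zero_right add.right_neutral)
      qed
      have "\<forall>F\<in>#M. \<forall>t. sgn (poly (snd F x) t) = sgn (poly (snd F x') t)"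
        using s by (simp add: c C_def)
      then show "\<exists>\<theta>. strict_mono \<theta> \<and> surj \<theta> \<and>
        (\<forall>F\<in>#M. \<forall>t. sgn (poly (snd F x) t) = sgn (poly (snd F x') (\<theta> t)))"
        by (intro exI[of _ "\<lambda>t::real. t"]) (simp add: strict_mono_def)
    qed
    then show ?thesis by blast
  next
    case False
    define n where "n = Max (fst ` set_mset M)"
    have ne: "fst ` set_mset M \<noteq> {}" using False by auto
    have "n \<in> fst ` set_mset M" unfolding n_def by (rule Max_in) (use ne in auto)
    then obtain P where P: "P \<in># M" "fst P = n" by auto
    have nmax: "fst F \<le> n" if "F \<in># M" for F using that by (simp add: n_def)
    have n2: "n \<ge> 2" using False nmax by force
    \<comment> \<open>\<open>T F\<close> takes care of the parameters at which the top coefficient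
      of \<open>F\<close> vanishes, so that \<open>F\<close> may be truncated.\<close>
    have "\<exists>T. \<forall>F\<in>{F\<in>set_mset M. fst F > 0}. ?P (T F) (M - {#F#} + {#truncate F#})"
    proof (rule bchoice, rule ballI)
      fix F assume F: "F \<in> {F\<in>set_mset M. fst F > 0}"
      have "(image_mset fst (M - {#F#} + {#truncate F#}), image_mset fst M) \<in> mult {(x, y). x < y}"
      proof -
        have "image_mset fst M = image_mset fst (M - {#F#}) + {#fst F#}"
          using F by (metis (no_types, lifting) image_mset_single image_mset_union insert_DiffM2 mem_Collect_eq)
        moreover have "(image_mset fst (M - {#F#}) + {#fst (truncate F)#}, image_mset fst (M - {#F#}) + {#fst F#})
            \<in> mult {(x, y). x < y}"
          using F by (intro one_step_implies_mult) (auto simp: truncate_def)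
        ultimately show ?thesis by simp
      qed
      moreover have "\<forall>G\<in>#M - {#F#} + {#truncate F#}. param_poly G"
        using less.prems F param_poly_truncate[of F] by (auto dest: in_diffD)
      ultimately show "\<exists>C. ?P C (M - {#F#} + {#truncate F#})"
        by (intro less.IH) (auto simp: in_inv_image)
    qed
    then obtain T where T: "\<forall>F\<in>{F\<in>set_mset M. fst F > 0}. ?P (T F) (M - {#F#} + {#truncate F#})" by blast
    define I where "I = M - {#P#} + {#param_pderiv P#}"
    have okI: "param_poly F" if "F \<in># I" for F
      using that less.prems P param_poly_pderiv[of P] by (auto simp: I_def dest: in_diffD)
    have "\<exists>R. \<forall>G\<in>{G\<in>set_mset I. fst G > 0}. param_poly (R G) \<and> fst (R G) < fst G \<and>
        (\<forall>x. \<exists>e s. smult (top_coeff G x ^ (2 * e)) (snd P x) = snd G x * s + snd (R G) x)"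
      by (rule bchoice) (use param_pseudo_remainder okI less.prems P in blast)
    then obtain R where R: "\<And>G. G \<in># I \<Longrightarrow> fst G > 0 \<Longrightarrow> param_poly (R G) \<and> fst (R G) < fst G \<and>
        (\<forall>x. \<exists>e s. smult (top_coeff G x ^ (2 * e)) (snd P x) = snd G x * s + snd (R G) x)"
      by (metis (no_types, lifting) mem_Collect_eq)
    define N where "N = I + image_mset R (filter_mset (\<lambda>G. fst G > 0) I)"
    have fI: "fst F \<le> n" if "F \<in># I" for F
      using that nmax[of F] P by (auto simp: I_def param_pderiv_def dest: in_diffD)
    have "\<exists>C. ?P C N"
    proof (rule less.IH)
      have 1: "image_mset fst M = image_mset fst (M - {#P#}) + {#n#}"
        using P by (metis (no_types, lifting) image_mset_single image_mset_union insert_DiffM2)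
      have 2: "image_mset fst N = image_mset fst (M - {#P#}) +
          ({#n - 1#} + image_mset fst (image_mset R (filter_mset (\<lambda>G. fst G > 0) I)))"
      proof -
        have "image_mset fst I = image_mset fst (M - {#P#}) + {#n - 1#}"
          unfolding I_def image_mset_union using P by (simp add: param_pderiv_def)
        then show ?thesis unfolding N_def image_mset_union by (simp only: add.assoc)
      qed
      have "(image_mset fst N, image_mset fst M) \<in> mult {(x, y). x < y}"
        unfolding 1 2
      proof (rule one_step_implies_mult)
        show "\<forall>k\<in>#{#n - 1#} + image_mset fst (image_mset R (filter_mset (\<lambda>G. fst G > 0) I)).
          \<exists>j\<in>#{#n#}. (k, j) \<in> {(x, y). x < y}"
          using R fI n2 by (force dest!: in_diffD)
      qed simp
      then show "(N, M) \<in> inv_image (mult {(x, y). x < y}) (image_mset fst)"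
        by (simp add: in_inv_image)
      show "\<forall>F\<in>#N. param_poly F" using R okI by (auto simp: N_def)
    qed
    then obtain C' where C': "?P C' N" by blast
    \<comment> \<open>The signs of the top coefficients are included so that \<open>x\<close> and
      \<open>x'\<close> fall into the same case of the argument.\<close>
    define C where "C = top_coeff ` set_mset M \<union> top_coeff ` set_mset I \<union> C' \<union> (\<Union>F\<in>{F\<in>set_mset M. fst F > 0}. T F)"
    have "?P C M"
    proof (intro conjI allI impI)
      show "finite C" using T C' by (simp add: C_def)
      show "\<forall>p\<in>C. real_polynomial_function p"
        using T C' less.prems okI by (auto simp: C_def intro!: param_poly_top_coeff)
      fix x x' assume s: "\<forall>p\<in>C. sgn (p x) = sgn (p x')"
      show "\<exists>\<theta>. strict_mono \<theta> \<and> surj \<theta> \<and>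
        (\<forall>F\<in>#M. \<forall>t. sgn (poly (snd F x) t) = sgn (poly (snd F x') (\<theta> t)))"
      proof (cases "\<exists>F\<in>#M. fst F > 0 \<and> top_coeff F x = 0")
        case True
        then obtain F where F: "F \<in># M" "fst F > 0" "top_coeff F x = 0" by blast
        have "top_coeff F \<in> C" using F unfolding C_def by blast
        then have "sgn (top_coeff F x) = sgn (top_coeff F x')" using s by blast
        then have F': "top_coeff F x' = 0" using F by (simp add: sgn_zero_iff)
        have "T F \<subseteq> C" using F unfolding C_def by blast
        then have "\<forall>p\<in>T F. sgn (p x) = sgn (p x')" using s by blast
        then obtain \<theta> where \<theta>: "strict_mono \<theta>" "surj \<theta>"
          "\<forall>G\<in>#M - {#F#} + {#truncate F#}. \<forall>t. sgn (poly (snd G x) t) = sgn (poly (snd G x') (\<theta> t))"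
          using T F by blast
        have "sgn (poly (snd G x) t) = sgn (poly (snd G x') (\<theta> t))" if G: "G \<in># M" for G t
        proof (cases "G = F")
          case True
          then show ?thesis using \<theta>(3) truncate_eval[OF F(3)] truncate_eval[OF F'] by auto
        next
          case False
          then have "G \<in># M - {#F#}" using G F(1) by (metis insert_DiffM insert_noteq_member)
          then show ?thesis using \<theta>(3) by simp
        qed
        then show ?thesis using \<theta> by blast
      next
        case nz: False
        have "C' \<subseteq> C" unfolding C_def by blast
        then have "\<forall>p\<in>C'. sgn (p x) = sgn (p x')" using s by blast
        then obtain \<theta> where \<theta>: "strict_mono \<theta>" "surj \<theta>"
          "\<forall>G\<in>#N. \<forall>t. sgn (poly (snd G x) t) = sgn (poly (snd G x') (\<theta> t))"
          using C' by blast
        have P0: "top_coeff P x \<noteq> 0" using nz P n2 by auto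
        \<comment> \<open>The bound \<open>n\<close> is strict, so the top index of \<open>P\<close>
          is \<open>n - 1\<close> and that of its derivative is \<open>n - 2\<close>. Since
          \<open>n \<ge> 2\<close>, no natural subtraction is cut off.\<close>
        have pd: "coeff (pderiv (snd P x)) (n - 2) = real (n - 1) * top_coeff P x"
          using P n2 by (simp add: coeff_pderiv top_coeff_def Suc_diff_Suc numeral_2_eq_2)
        have pd0: "pderiv (snd P x) \<noteq> 0"
        proof
          assume "pderiv (snd P x) = 0"
          then show False using pd P0 n2 by simp
        qed
        have tI: "top_coeff G x \<noteq> 0" if "G \<in># I" "fst G > 0" for G
        proof (cases "G = param_pderiv P")
          case True
          have "top_coeff G x = coeff (pderiv (snd P x)) (n - 2)"
            using True P by (simp add: param_pderiv_def top_coeff_def numeral_2_eq_2)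
          then show ?thesis using pd P0 n2 by simp
        next
          case False
          then have "G \<in># M" using that by (auto simp: I_def dest: in_diffD)
          then show ?thesis using nz that by blast
        qed
        have "\<exists>\<eta>. strict_mono \<eta> \<and> surj \<eta> \<and>
          (\<forall>k\<in>set_mset I. \<forall>t. sgn (poly (snd k x) t) = sgn (poly (snd k x') (\<eta> t)))
          \<and> (\<forall>t. sgn (poly (snd P x) t) = sgn (poly (snd P x') (\<eta> t)))"
        proof (rule extend_sign_bijection_family[OF \<theta>(1,2), where ?k0.0 = "param_pderiv P"])
          show "finite (set_mset I)" by simp
          show "\<forall>k\<in>set_mset I. \<forall>t. sgn (poly (snd k x) t) = sgn (poly (snd k x') (\<theta> t))"
            using \<theta>(3) by (simp add: N_def)
          show "param_pderiv P \<in> set_mset I" by (simp add: I_def)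
          show "snd (param_pderiv P) x = pderiv (snd P x)" "snd (param_pderiv P) x' = pderiv (snd P x')"
            by (simp_all add: param_pderiv_def)
          show "pderiv (snd P x) \<noteq> 0" by (rule pd0)
          show "\<forall>k\<in>set_mset I. \<forall>t. snd k x \<noteq> 0 \<and> poly (snd k x) t = 0 \<longrightarrow>
            sgn (poly (snd P x) t) = sgn (poly (snd P x') (\<theta> t))"
          proof (intro ballI allI impI)
            fix G t assume G: "G \<in> set_mset I" "snd G x \<noteq> 0 \<and> poly (snd G x) t = 0"
            have "fst G > 0"
            proof (rule ccontr)
              assume "\<not> fst G > 0"
              then have "snd G x = 0" using okI[of G] G by (intro poly_eqI) (auto simp: param_poly_def)
              then show False using G by blast
            qed
            then have RG: "R G \<in># N" and RG': "\<forall>x. \<exists>e s. smult (top_coeff G x ^ (2 * e)) (snd P x) = snd G x * s + snd (R G) x"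
              using R G by (auto simp: N_def)
            have "top_coeff G x \<noteq> 0" using tI G \<open>fst G > 0\<close> by blast
            moreover have "top_coeff G \<in> C" using G unfolding C_def by blast
            then have "sgn (top_coeff G x) = sgn (top_coeff G x')" using s by blast
            ultimately have t0: "top_coeff G x \<noteq> 0" "top_coeff G x' \<noteq> 0" by (auto simp: sgn_zero_iff)
            have "poly (snd G x') (\<theta> t) = 0" using \<theta>(3) G by (metis N_def UnCI set_mset_union sgn_zero_iff)
            then have "sgn (poly (snd P x') (\<theta> t)) = sgn (poly (snd (R G) x') (\<theta> t))"
              using sgn_poly_mod_root RG' t0 by metis
            moreover have "sgn (poly (snd P x) t) = sgn (poly (snd (R G) x) t)"
              using sgn_poly_mod_root RG' t0 G by metis
            ultimately show "sgn (poly (snd P x) t) = sgn (poly (snd P x') (\<theta> t))"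
              using \<theta>(3) RG by simp
          qed
        qed
        then obtain \<eta> where \<eta>: "strict_mono \<eta>" "surj \<eta>"
          "\<forall>k\<in>#I. \<forall>t. sgn (poly (snd k x) t) = sgn (poly (snd k x') (\<eta> t))"
          "\<forall>t. sgn (poly (snd P x) t) = sgn (poly (snd P x') (\<eta> t))" by blast
        have "sgn (poly (snd G x) t) = sgn (poly (snd G x') (\<eta> t))" if G: "G \<in># M" for G t
        proof (cases "G = P")
          case True then show ?thesis using \<eta> by simp
        next
          case False
          then have "G \<in># M - {#P#}" using G P(1) by (metis insert_DiffM insert_noteq_member)
          then have "G \<in># I" by (simp add: I_def)
          then show ?thesis using \<eta>(3) by simp
        qed
        then show ?thesis using \<eta> by blast
      qed
    qed
    then show ?thesis by blast
  qed
qed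

section \<open>Semialgebraic sets as finite unions of sign classes, and their projections\<close>

definition sign_determined :: "'a::euclidean_space set \<Rightarrow> ('a \<Rightarrow> real) set \<Rightarrow> bool" where
  "sign_determined S C \<longleftrightarrow> finite C \<and> (\<forall>p\<in>C. real_polynomial_function p) \<and>
    (\<forall>x x'. (\<forall>p\<in>C. sgn (p x) = sgn (p x')) \<longrightarrow> (x \<in> S \<longleftrightarrow> x' \<in> S))"

lemma semialgebraic_imp_sign_determined:
  "semialgebraic_set S \<Longrightarrow> \<exists>C. sign_determined S C"
proof (induction rule: semialgebraic_set.induct)
  case (eq p)
  then show ?case
    by (intro exI[of _ "{p}"]) (simp add: sign_determined_def, metis sgn_zero_iff)
next
  case (gt p)
  then show ?case
    by (intro exI[of _ "{p}"]) (simp add: sign_determined_def, metis sgn_greater)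
next
  case (Un A B)
  then obtain C D where "sign_determined A C" "sign_determined B D" by blast
  then show ?case
    by (intro exI[of _ "C \<union> D"]) (simp add: sign_determined_def ball_Un; blast)
next
  case (Int A B)
  then obtain C D where "sign_determined A C" "sign_determined B D" by blast
  then show ?case
    by (intro exI[of _ "C \<union> D"]) (simp add: sign_determined_def ball_Un; blast)
next
  case (Compl A)
  then show ?case by (auto simp: sign_determined_def)
qed

lemma semialgebraic_UNIV: "semialgebraic_set UNIV"
  using semialgebraic_set.eq[OF rpf_const[of 0]] by simp

lemma semialgebraic_empty: "semialgebraic_set {}"
  using semialgebraic_set.Compl[OF semialgebraic_UNIV] by simp

lemma semialgebraic_Union:
  "finite I \<Longrightarrow> (\<And>i. i \<in> I \<Longrightarrow> semialgebraic_set (S i)) \<Longrightarrow> semialgebraic_set (\<Union>i\<in>I. S i)"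
  by (induction I rule: finite_induct)
     (auto intro: semialgebraic_empty semialgebraic_set.Un)

lemma semialgebraic_Inter:
  "finite I \<Longrightarrow> (\<And>i. i \<in> I \<Longrightarrow> semialgebraic_set (S i)) \<Longrightarrow> semialgebraic_set (\<Inter>i\<in>I. S i)"
  by (induction I rule: finite_induct)
     (auto intro: semialgebraic_UNIV semialgebraic_set.Int)

lemma semialgebraic_sgn_class:
  assumes "real_polynomial_function p"
  shows "semialgebraic_set {x. sgn (p x) = (c::real)}"
proof -
  have 1: "semialgebraic_set {x. p x = 0}" "semialgebraic_set {x. p x > 0}"
    using assms semialgebraic_set.eq semialgebraic_set.gt by blast+
  have 2: "semialgebraic_set {x. p x < 0}"
    using semialgebraic_set.gt[OF real_polynomial_function_minus[OF assms]] by simp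
  consider "c = 0" | "c = 1" | "c = -1" | "c \<notin> {0, 1, -1}" by blast
  then show ?thesis
  proof cases
    case 4
    then have "{x. sgn (p x) = c} = {}" by (auto simp: sgn_real_def split: if_splits)
    then show ?thesis by (simp add: semialgebraic_empty)
  qed (use 1 2 in \<open>simp_all add: sgn_zero_iff sgn_1_pos sgn_1_neg\<close>)
qed

text \<open>Each of the finitely many polynomials has only three possible signs, so \<open>S\<close>
  is a finite union of sign classes.\<close>

lemma sign_determined_imp_semialgebraic:
  assumes "sign_determined S C"
  shows "semialgebraic_set S"
proof -
  have C: "finite C" "\<forall>p\<in>C. real_polynomial_function p" using assms by (auto simp: sign_determined_def)
  define V where "V = (\<lambda>x. restrict (\<lambda>p. sgn (p x)) C) ` S"
  have "V \<subseteq> PiE C (\<lambda>_. {-1, 0, 1::real})"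
    by (auto simp: V_def sgn_real_def split: if_splits)
  then have fV: "finite V" using C finite_PiE[of C "\<lambda>_. {-1, 0, 1::real}"] by (auto intro: finite_subset)
  have "S = (\<Union>v\<in>V. \<Inter>p\<in>C. {x. sgn (p x) = v p})"
  proof (intro equalityI subsetI)
    fix x assume "x \<in> (\<Union>v\<in>V. \<Inter>p\<in>C. {x. sgn (p x) = v p})"
    then obtain y where y: "y \<in> S" "\<forall>p\<in>C. sgn (p x) = sgn (p y)" by (auto simp: V_def)
    then show "x \<in> S" using assms by (auto simp: sign_determined_def)
  qed (auto simp: V_def)
  also have "semialgebraic_set \<dots>"
    using fV C by (intro semialgebraic_Union semialgebraic_Inter semialgebraic_sgn_class) auto
  finally show ?thesis .
qed

lemma param_poly_expansion:
  assumes "real_polynomial_function p"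
  shows "\<exists>F. param_poly F \<and> (\<forall>x t. p (x + t *\<^sub>R b) = poly (snd F x) t)"
  using assms
proof (induction rule: real_polynomial_function.induct)
  case (linear f)
  let ?F = "(2::nat, \<lambda>x. [:f x, f b:])"
  have "f (x + t *\<^sub>R b) = poly (snd ?F x) t" for x t
    using linear by (simp add: bounded_linear.linear linear_add linear_scale)
  moreover have "param_poly ?F"
    unfolding param_poly_def
  proof (intro conjI allI impI)
    fix i
    consider "i = 0" | "i = 1" | j where "i = Suc (Suc j)" by (metis One_nat_def not0_implies_Suc)
    then show "real_polynomial_function (\<lambda>x. coeff (snd ?F x) i)"
      using linear by cases (auto simp: rpf_const intro: real_polynomial_function.intros(1))
  next
    fix x :: 'a and i assume "fst ?F \<le> i"
    then have "i = Suc (Suc (i - 2))" by simp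
    then show "coeff (snd ?F x) i = 0" by (metis coeff_0 coeff_pCons_Suc snd_conv)
  qed
  ultimately show ?case by blast
next
  case (const c)
  have "param_poly (1::nat, \<lambda>x. [:c:])"
    by (auto simp: param_poly_def coeff_pCons rpf_const split: nat.split)
  then show ?case by (intro exI[of _ "(1::nat, \<lambda>x. [:c:])"]) simp
next
  case (add f g)
  then obtain F G where FG: "param_poly F" "param_poly G"
    "\<forall>x t. f (x + t *\<^sub>R b) = poly (snd F x) t" "\<forall>x t. g (x + t *\<^sub>R b) = poly (snd G x) t" by blast
  then have "param_poly (max (fst F) (fst G), \<lambda>x. snd F x + snd G x)"
    by (auto simp: param_poly_def intro: rpf_add)
  then show ?case using FG by (intro exI[of _ "(max (fst F) (fst G), \<lambda>x. snd F x + snd G x)"]) simp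
next
  case (mult f g)
  then obtain F G where FG: "param_poly F" "param_poly G"
    "\<forall>x t. f (x + t *\<^sub>R b) = poly (snd F x) t" "\<forall>x t. g (x + t *\<^sub>R b) = poly (snd G x) t" by blast
  have "param_poly (fst F + fst G, \<lambda>x. snd F x * snd G x)"
    unfolding param_poly_def
  proof (intro conjI allI impI)
    fix i show "real_polynomial_function (\<lambda>x. coeff (snd (fst F + fst G, \<lambda>x. snd F x * snd G x) x) i)"
      using FG by (auto simp: coeff_mult param_poly_def intro!: real_polynomial_function_sum rpf_mult)
  next
    fix x i assume "fst (fst F + fst G, \<lambda>x. snd F x * snd G x) \<le> i"
    then have "coeff (snd F x) j * coeff (snd G x) (i - j) = 0" for j
      using FG(1,2) by (cases "fst F \<le> j") (auto simp: param_poly_def)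
    then show "coeff (snd (fst F + fst G, \<lambda>x. snd F x * snd G x) x) i = 0"
      by (simp add: coeff_mult sum.neutral)
  qed
  then show ?case using FG by (intro exI[of _ "(fst F + fst G, \<lambda>x. snd F x * snd G x)"]) simp
qed

text \<open>If the chosen signs agree at \<open>x\<close> and \<open>x'\<close>, the
  reparametrization \<open>\<theta>\<close> carries a point of \<open>S\<close> on the line through
  \<open>x\<close> to a point on the line through \<open>x'\<close> with the same signs, hence again
  in \<open>S\<close>. So membership in the projection is decided by finitely many signs.\<close>

lemma semialgebraic_projection_line:
  assumes "semialgebraic_set S"
  shows "semialgebraic_set {x. \<exists>t. x + t *\<^sub>R b \<in> S}"
proof -
  obtain C where C: "sign_determined S C" using semialgebraic_imp_sign_determined[OF assms] by blast
  then have fC: "finite C" "\<forall>p\<in>C. real_polynomial_function p" by (auto simp: sign_determined_def)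
  then have "\<exists>E. \<forall>p\<in>C. param_poly (E p) \<and> (\<forall>x t. p (x + t *\<^sub>R b) = poly (snd (E p) x) t)"
    by (intro bchoice ballI param_poly_expansion) blast
  then obtain E where E: "\<And>p. p \<in> C \<Longrightarrow> param_poly (E p)"
    "\<And>p x t. p \<in> C \<Longrightarrow> p (x + t *\<^sub>R b) = poly (snd (E p) x) t" by blast
  have "\<forall>F\<in>#mset_set (E ` C). param_poly F" using E(1) fC by auto
  then obtain D where D: "finite D" "\<forall>p\<in>D. real_polynomial_function p"
    "\<And>x x'. (\<forall>p\<in>D. sgn (p x) = sgn (p x')) \<Longrightarrow> \<exists>\<theta>. strict_mono \<theta> \<and> surj \<theta> \<and>
        (\<forall>F\<in>#mset_set (E ` C). \<forall>t. sgn (poly (snd F x) t) = sgn (poly (snd F x') (\<theta> t)))"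
    using param_polys_signs[of "mset_set (E ` C)"] by blast
  have imp: "\<exists>t. x' + t *\<^sub>R b \<in> S" if s: "\<forall>p\<in>D. sgn (p x) = sgn (p x')" and t: "x + t *\<^sub>R b \<in> S" for x x' t
  proof -
    obtain \<theta> where \<theta>: "\<forall>F\<in>E ` C. \<forall>t. sgn (poly (snd F x) t) = sgn (poly (snd F x') (\<theta> t))"
      using D(3)[OF s] fC by auto
    have "\<forall>p\<in>C. sgn (p (x + t *\<^sub>R b)) = sgn (p (x' + \<theta> t *\<^sub>R b))" using \<theta> E by auto
    then show ?thesis using C t unfolding sign_determined_def by blast
  qed
  have "sign_determined {x. \<exists>t. x + t *\<^sub>R b \<in> S} D"
    unfolding sign_determined_def
  proof (intro conjI allI impI)
    fix x x' assume s: "\<forall>p\<in>D. sgn (p x) = sgn (p x')"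
    then have s': "\<forall>p\<in>D. sgn (p x') = sgn (p x)" by simp
    show "(x \<in> {x. \<exists>t. x + t *\<^sub>R b \<in> S}) = (x' \<in> {x. \<exists>t. x + t *\<^sub>R b \<in> S})"
      using imp[OF s] imp[OF s'] by blast
  qed (use D in auto)
  then show ?thesis by (rule sign_determined_imp_semialgebraic)
qed

lemma semialgebraic_vimage:
  fixes \<phi> :: "'a::euclidean_space \<Rightarrow> 'b::euclidean_space"
  assumes "semialgebraic_set S" "polynomial_function \<phi>"
  shows "semialgebraic_set {x. \<phi> x \<in> S}"
  using assms(1)
proof (induction rule: semialgebraic_set.induct)
  case (eq p)
  have "real_polynomial_function (p \<circ> \<phi>)" by (rule real_polynomial_function_compose[OF assms(2) eq])
  from semialgebraic_set.eq[OF this] show ?case by simp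
next
  case (gt p)
  have "real_polynomial_function (p \<circ> \<phi>)" by (rule real_polynomial_function_compose[OF assms(2) gt])
  from semialgebraic_set.gt[OF this] show ?case by simp
next
  case (Un A B)
  have "{x. \<phi> x \<in> A \<union> B} = {x. \<phi> x \<in> A} \<union> {x. \<phi> x \<in> B}" by auto
  then show ?case using semialgebraic_set.Un[OF Un.IH] by simp
next
  case (Int A B)
  have "{x. \<phi> x \<in> A \<inter> B} = {x. \<phi> x \<in> A} \<inter> {x. \<phi> x \<in> B}" by auto
  then show ?case using semialgebraic_set.Int[OF Int.IH] by simp
next
  case (Compl A)
  have "{x. \<phi> x \<in> - A} = - {x. \<phi> x \<in> A}" by auto
  then show ?case using semialgebraic_set.Compl[OF Compl.IH] by simp
qed

theorem semialgebraic_Ex: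
  fixes S :: "('a::euclidean_space \<times> 'b::euclidean_space) set"
  assumes "semialgebraic_set S"
  shows "semialgebraic_set {x. \<exists>y. (x, y) \<in> S}"
proof -
  \<comment> \<open>The basis directions of the second factor are projected out one at a
    time.\<close>
  have "semialgebraic_set {z. \<exists>c. z + (\<Sum>b\<in>B. c b *\<^sub>R (0, b)) \<in> S}"
    if "finite B" for B :: "'b set"
    using that
  proof (induction B rule: finite_induct)
    case empty then show ?case using assms by simp
  next
    case (insert b B)
    have "{z. \<exists>c. z + (\<Sum>b\<in>insert b B. c b *\<^sub>R (0, b)) \<in> S} =
      {z. \<exists>t. z + t *\<^sub>R (0, b) \<in> {z. \<exists>c. z + (\<Sum>b\<in>B. c b *\<^sub>R (0, b)) \<in> S}}" (is "?L = ?R")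
    proof (intro equalityI subsetI)
      fix z assume "z \<in> ?L"
      then show "z \<in> ?R" using insert.hyps by (auto simp: add.assoc)
    next
      fix z assume "z \<in> ?R"
      then obtain t c where tc: "z + t *\<^sub>R (0, b) + (\<Sum>b\<in>B. c b *\<^sub>R (0, b)) \<in> S" by auto
      have "(\<Sum>x\<in>B. (c(b := t)) x *\<^sub>R (0, x)) = (\<Sum>x\<in>B. c x *\<^sub>R (0::'a, x))"
        using insert.hyps by (intro sum.cong) auto
      then have "z + (\<Sum>x\<in>insert b B. (c(b := t)) x *\<^sub>R (0, x)) \<in> S"
        using tc insert.hyps by (simp add: add.assoc)
      then show "z \<in> ?L" by blast
    qed
    then show ?case using semialgebraic_projection_line[OF insert.IH, of "(0, b)"] by simp
  qed
  from this[of Basis] have 1: "semialgebraic_set {z. \<exists>c. z + (\<Sum>b\<in>Basis. c b *\<^sub>R (0, b::'b)) \<in> S}"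
    by simp
  have "polynomial_function (\<lambda>x::'a. (x, 0::'b))"
    by (rule polynomial_function_bounded_linear) (intro bounded_linear_Pair bounded_linear_ident bounded_linear_zero)
  from semialgebraic_vimage[OF 1 this]
  have 2: "semialgebraic_set {x. \<exists>c. (x, 0) + (\<Sum>b\<in>Basis. c b *\<^sub>R (0, b::'b)) \<in> S}" by simp
  have e: "(x, 0) + (\<Sum>b\<in>Basis. c b *\<^sub>R (0, b::'b)) = (x, \<Sum>b\<in>Basis. c b *\<^sub>R b)" for x :: 'a and c
    by (simp add: prod_eq_iff fst_sum snd_sum)
  have "(\<exists>c. (x, 0) + (\<Sum>b\<in>Basis. c b *\<^sub>R (0, b::'b)) \<in> S) \<longleftrightarrow> (\<exists>y. (x, y) \<in> S)" for x
    unfolding e by (metis euclidean_representation)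
  then show ?thesis using 2 by simp
qed

lemma semialgebraic_All:
  fixes S :: "('a::euclidean_space \<times> 'b::euclidean_space) set"
  assumes "semialgebraic_set S"
  shows "semialgebraic_set {x. \<forall>y. (x, y) \<in> S}"
proof -
  have "{x. \<forall>y. (x, y) \<in> S} = - {x. \<exists>y. (x, y) \<in> - S}" by auto
  then show ?thesis
    using semialgebraic_set.Compl[OF semialgebraic_Ex[OF semialgebraic_set.Compl[OF assms]]] by simp
qed

section \<open>Polynomial functions and elimination\<close>

lemmas cpf_const = complex_polynomial_function.const
lemmas cpf_coord = complex_polynomial_function.coord
lemmas cpf_add = complex_polynomial_function.add
lemmas cpf_mult = complex_polynomial_function.mult

lemma cpf_minus: "complex_polynomial_function p \<Longrightarrow> complex_polynomial_function (\<lambda>x. - p x)"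
  using cpf_mult[OF cpf_const[of "-1"]] by simp

lemma cpf_diff:
  "complex_polynomial_function p \<Longrightarrow> complex_polynomial_function q \<Longrightarrow> complex_polynomial_function (\<lambda>x. p x - q x)"
  using cpf_add[OF _ cpf_minus] by simp

lemma cpf_sum:
  "(\<And>i. i \<in> I \<Longrightarrow> complex_polynomial_function (p i)) \<Longrightarrow> complex_polynomial_function (\<lambda>x. \<Sum>i\<in>I. p i x)"
  by (induction I rule: infinite_finite_induct) (auto intro: cpf_const cpf_add)

lemma cpf_prod:
  "(\<And>i. i \<in> I \<Longrightarrow> complex_polynomial_function (p i)) \<Longrightarrow> complex_polynomial_function (\<lambda>x. \<Prod>i\<in>I. p i x)"
  by (induction I rule: infinite_finite_induct) (auto intro: cpf_const cpf_mult)

lemma cpf_power: "complex_polynomial_function p \<Longrightarrow> complex_polynomial_function (\<lambda>x. p x ^ n)"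
  by (induction n) (auto intro: cpf_const cpf_mult)

lemma cpf_compose:
  assumes "complex_polynomial_function p" "\<And>i. complex_polynomial_function (\<lambda>x. \<phi> x $ i)"
  shows "complex_polynomial_function (\<lambda>x. p (\<phi> x))"
  using assms by (induction) (auto intro: cpf_const cpf_add cpf_mult)

lemma algebraic_set_vimage:
  assumes "algebraic_set Y" "\<And>i. complex_polynomial_function (\<lambda>x. \<phi> x $ i)"
  shows "algebraic_set {x. \<phi> x \<in> Y}"
proof -
  obtain P where P: "\<forall>p\<in>P. complex_polynomial_function p" "Y = {x. \<forall>p\<in>P. p x = 0}"
    using assms(1) by (auto simp: algebraic_set_def)
  show ?thesis
    unfolding algebraic_set_def
    by (rule exI[of _ "(\<lambda>p x. p (\<phi> x)) ` P"]) (use P cpf_compose[OF _ assms(2)] in auto)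
qed

lemma algebraic_set_INT:
  assumes "\<And>i. i \<in> I \<Longrightarrow> algebraic_set (Y i)"
  shows "algebraic_set (\<Inter>i\<in>I. Y i)"
proof -
  have "\<exists>P. \<forall>i\<in>I. (\<forall>p\<in>P i. complex_polynomial_function p) \<and> Y i = {x. \<forall>p\<in>P i. p x = 0}"
    by (rule bchoice) (use assms in \<open>auto simp: algebraic_set_def\<close>)
  then obtain P where P: "\<forall>i\<in>I. (\<forall>p\<in>P i. complex_polynomial_function p) \<and> Y i = {x. \<forall>p\<in>P i. p x = 0}" ..
  show ?thesis
    unfolding algebraic_set_def
    by (rule exI[of _ "\<Union>i\<in>I. P i"]) (use P in auto)
qed

lemma algebraic_set_Int: "algebraic_set A \<Longrightarrow> algebraic_set B \<Longrightarrow> algebraic_set (A \<inter> B)"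
  using algebraic_set_INT[of "{A, B}" "\<lambda>x. x"] by auto

definition coord_space :: "'n set \<Rightarrow> (complex ^ 'n) set" where
  "coord_space J = {x. \<forall>i. i \<notin> J \<longrightarrow> x $ i = 0}"

lemma algebraic_coord_space: "algebraic_set (coord_space J)"
  unfolding algebraic_set_def coord_space_def
  by (rule exI[of _ "(\<lambda>i x. x $ i) ` (- J)"]) (auto intro: cpf_coord)

lemma coord_space_add: "x \<in> coord_space J \<Longrightarrow> y \<in> coord_space J \<Longrightarrow> x + t *s y \<in> coord_space J"
  by (auto simp: coord_space_def)

lemma coord_space_scale: "y \<in> coord_space J \<Longrightarrow> t *s y \<in> coord_space J"
  by (auto simp: coord_space_def)

section \<open>Degree bounds and expansions of polynomial functions\<close>

inductive pdeg :: "nat \<Rightarrow> (complex ^ 'n \<Rightarrow> complex) \<Rightarrow> bool" where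
  const: "pdeg d (\<lambda>x. c)"
| coord: "pdeg (Suc d) (\<lambda>x. x $ i)"
| add: "pdeg d p \<Longrightarrow> pdeg d q \<Longrightarrow> pdeg d (\<lambda>x. p x + q x)"
| mult: "pdeg a p \<Longrightarrow> pdeg b q \<Longrightarrow> pdeg (a + b) (\<lambda>x. p x * q x)"

lemma pdeg_mono: "pdeg d p \<Longrightarrow> d \<le> e \<Longrightarrow> pdeg e p"
proof (induction arbitrary: e rule: pdeg.induct)
  case (coord d i)
  then show ?case by (cases e) (auto intro: pdeg.coord)
next
  case (mult a p b q)
  then have "pdeg a p" "pdeg (e - a) q" by auto
  from pdeg.mult[OF this] show ?case using mult.prems by simp
qed (auto intro: pdeg.intros)

lemma pdeg_cmult: "pdeg d p \<Longrightarrow> pdeg d (\<lambda>x. c * p x)"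
  using pdeg.mult[OF pdeg.const[of 0 c], of d p] by simp

lemma pdeg_mult: "pdeg a p \<Longrightarrow> pdeg b q \<Longrightarrow> a + b \<le> c \<Longrightarrow> pdeg c (\<lambda>x. p x * q x)"
  using pdeg.mult pdeg_mono by blast

lemma pdeg_sum: "(\<And>i. i \<in> I \<Longrightarrow> pdeg d (p i)) \<Longrightarrow> pdeg d (\<lambda>x. \<Sum>i\<in>I. p i x)"
  by (induction I rule: infinite_finite_induct) (auto intro: pdeg.intros)

lemma pdeg_diff: "pdeg d p \<Longrightarrow> pdeg d q \<Longrightarrow> pdeg d (\<lambda>x. p x - q x)"
  using pdeg.add[OF _ pdeg_cmult[of d q "-1"]] by simp

lemma pdeg_power: "pdeg d p \<Longrightarrow> pdeg (n * d) (\<lambda>x. p x ^ n)"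
  by (induction n) (auto intro: pdeg.intros)

lemma pdeg_prod: "(\<And>i. i \<in> I \<Longrightarrow> pdeg (d i) (p i)) \<Longrightarrow> pdeg (\<Sum>i\<in>I. d i) (\<lambda>x. \<Prod>i\<in>I. p i x)"
  by (induction I rule: infinite_finite_induct) (auto intro: pdeg.intros)

lemma pdeg_compose:
  assumes "pdeg d p" "\<And>i. pdeg e (\<lambda>x. \<phi> x $ i)"
  shows "pdeg (d * e) (\<lambda>x. p (\<phi> x))"
  using assms(1)
proof induction
  case (coord d i)
  show ?case by (rule pdeg_mono[OF assms(2)]) simp
qed (auto intro: pdeg.intros simp: distrib_right)

lemma pdeg_imp_cpf: "pdeg d p \<Longrightarrow> complex_polynomial_function p"
  by (induction rule: pdeg.induct) (auto intro: cpf_const cpf_coord cpf_add cpf_mult)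

lemma cpf_imp_pdeg: "complex_polynomial_function p \<Longrightarrow> \<exists>d. pdeg d p"
proof (induction rule: complex_polynomial_function.induct)
  case (add p q)
  then obtain a b where "pdeg a p" "pdeg b q" by blast
  then have "pdeg (max a b) p" "pdeg (max a b) q" by (auto intro: pdeg_mono)
  then show ?case by (blast intro: pdeg.add)
qed (blast intro: pdeg.intros)+

lemma pdeg_0: "pdeg d p \<Longrightarrow> d = 0 \<Longrightarrow> p x = p y"
  by (induction arbitrary: x y rule: pdeg.induct) (auto, metis+)

lemma coeff_mult_eq_0:
  fixes P Q :: "'a \<Rightarrow> complex poly"
  assumes "\<forall>x i. a < i \<longrightarrow> coeff (P x) i = 0" "\<forall>x i. b < i \<longrightarrow> coeff (Q x) i = 0"
  shows "\<forall>x i. a + b < i \<longrightarrow> coeff (P x * Q x) i = 0"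
proof (intro allI impI)
  fix x i assume i: "a + b < i"
  have "coeff (P x) j * coeff (Q x) (i - j) = 0" for j
    using assms i by (cases "a < j") auto
  then show "coeff (P x * Q x) i = 0" by (simp add: coeff_mult sum.neutral)
qed

text \<open>Every power of \<open>t\<close> uses up one degree. In particular the coefficient of
  \<open>t ^ d\<close> does not depend on \<open>z\<close>; this is the source of monic
  equations.\<close>

lemma pdeg_expansion:
  assumes "pdeg d p"
  shows "\<exists>P. (\<forall>i. pdeg (d - i) (\<lambda>z. coeff (P z) i)) \<and> (\<forall>z i. d < i \<longrightarrow> coeff (P z) i = 0) \<and>
    (\<forall>z t. p (z + t *s v) = poly (P z) t)"
  using assms
proof induction
  case (const d c)
  show ?case
    by (intro exI[of _ "\<lambda>z. [:c:]"] conjI allI; (rule pdeg.const)?)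
       (auto simp: coeff_pCons split: nat.split)
next
  case (coord d j)
  have "pdeg (Suc d - i) (\<lambda>z. coeff [:z $ j, v $ j:] i)" for i
    by (cases i) (auto intro: pdeg.intros)
  moreover have "coeff [:z $ j, v $ j:] i = 0" if "Suc d < i" for z i
    using that by (auto simp: coeff_pCons split: nat.split)
  ultimately show ?case by (intro exI[of _ "\<lambda>z. [:z $ j, v $ j:]"]) auto
next
  case (add d p q)
  then obtain P Q where
    "\<forall>i. pdeg (d - i) (\<lambda>z. coeff (P z) i)" "\<forall>z i. d < i \<longrightarrow> coeff (P z) i = 0"
    "\<forall>z t. p (z + t *s v) = poly (P z) t"
    "\<forall>i. pdeg (d - i) (\<lambda>z. coeff (Q z) i)" "\<forall>z i. d < i \<longrightarrow> coeff (Q z) i = 0"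
    "\<forall>z t. q (z + t *s v) = poly (Q z) t" by blast
  then show ?case by (intro exI[of _ "\<lambda>z. P z + Q z"]) (auto intro: pdeg.add)
next
  case (mult a p b q)
  then obtain P Q where PQ:
    "\<forall>i. pdeg (a - i) (\<lambda>z. coeff (P z) i)" "\<forall>z i. a < i \<longrightarrow> coeff (P z) i = 0"
    "\<forall>z t. p (z + t *s v) = poly (P z) t"
    "\<forall>i. pdeg (b - i) (\<lambda>z. coeff (Q z) i)" "\<forall>z i. b < i \<longrightarrow> coeff (Q z) i = 0"
    "\<forall>z t. q (z + t *s v) = poly (Q z) t" by blast
  have "pdeg (a + b - i) (\<lambda>z. coeff (P z * Q z) i)" for i
    unfolding coeff_mult
  proof (rule pdeg_sum)
    fix j assume j: "j \<in> {..i}"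
    show "pdeg (a + b - i) (\<lambda>z. coeff (P z) j * coeff (Q z) (i - j))"
    proof (cases "j \<le> a \<and> i - j \<le> b")
      case True
      then show ?thesis using j by (intro pdeg_mult[OF PQ(1)[rule_format] PQ(4)[rule_format]]) auto
    next
      case False
      then have "(\<lambda>z. coeff (P z) j * coeff (Q z) (i - j)) = (\<lambda>z. 0)" using PQ(2,5) by auto
      then show ?thesis by (simp add: pdeg.const)
    qed
  qed
  moreover have "\<forall>z i. a + b < i \<longrightarrow> coeff (P z * Q z) i = 0" by (rule coeff_mult_eq_0) (use PQ in auto)
  ultimately show ?case using PQ by (intro exI[of _ "\<lambda>z. P z * Q z"]) auto
qed

lemma pdeg_homogeneous_parts:
  assumes "pdeg d p"
  shows "\<exists>H. (\<forall>i. pdeg i (\<lambda>x. coeff (H x) i)) \<and> (\<forall>x i. d < i \<longrightarrow> coeff (H x) i = 0) \<and>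
    (\<forall>x t. p (t *s x) = poly (H x) t)"
  using assms
proof induction
  case (const d c)
  show ?case
    by (intro exI[of _ "\<lambda>z. [:c:]"] conjI allI; (rule pdeg.const)?)
       (auto simp: coeff_pCons split: nat.split)
next
  case (coord d j)
  have "pdeg i (\<lambda>z. coeff [:0, z $ j:] i)" for i
    by (cases i; cases "i - 1") (auto intro: pdeg.intros)
  moreover have "coeff [:0, z $ j:] i = 0" if "Suc d < i" for z i
    using that by (auto simp: coeff_pCons split: nat.split)
  ultimately show ?case by (intro exI[of _ "\<lambda>z. [:0, z $ j:]"]) auto
next
  case (add d p q)
  then obtain P Q where
    "\<forall>i. pdeg i (\<lambda>z. coeff (P z) i)" "\<forall>z i. d < i \<longrightarrow> coeff (P z) i = 0"
    "\<forall>x t. p (t *s x) = poly (P x) t"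
    "\<forall>i. pdeg i (\<lambda>z. coeff (Q z) i)" "\<forall>z i. d < i \<longrightarrow> coeff (Q z) i = 0"
    "\<forall>x t. q (t *s x) = poly (Q x) t" by blast
  then show ?case by (intro exI[of _ "\<lambda>z. P z + Q z"]) (auto intro: pdeg.add)
next
  case (mult a p b q)
  then obtain P Q where PQ:
    "\<forall>i. pdeg i (\<lambda>z. coeff (P z) i)" "\<forall>z i. a < i \<longrightarrow> coeff (P z) i = 0"
    "\<forall>x t. p (t *s x) = poly (P x) t"
    "\<forall>i. pdeg i (\<lambda>z. coeff (Q z) i)" "\<forall>z i. b < i \<longrightarrow> coeff (Q z) i = 0"
    "\<forall>x t. q (t *s x) = poly (Q x) t" by blast
  have "pdeg i (\<lambda>z. coeff (P z * Q z) i)" for i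
    unfolding coeff_mult
  proof (rule pdeg_sum)
    fix j assume j: "j \<in> {..i}"
    then show "pdeg i (\<lambda>z. coeff (P z) j * coeff (Q z) (i - j))"
      by (intro pdeg_mult[OF PQ(1)[rule_format] PQ(4)[rule_format]]) auto
  qed
  moreover have "\<forall>z i. a + b < i \<longrightarrow> coeff (P z * Q z) i = 0" by (rule coeff_mult_eq_0) (use PQ in auto)
  ultimately show ?case using PQ by (intro exI[of _ "\<lambda>z. P z * Q z"]) auto
qed

lemma cpf_on_line:
  assumes "complex_polynomial_function f"
  shows "\<exists>P. \<forall>t. f (a + t *s v) = poly P t"
proof -
  obtain d where "pdeg d f" using cpf_imp_pdeg[OF assms] by blast
  from pdeg_expansion[OF this, of v] show ?thesis by metis
qed

text \<open>On the line joining the two points both functions restrict to nonzero polynomials in one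
  variable, and their product has only finitely many roots.\<close>

lemma cpf_nonzero_common:
  assumes "complex_polynomial_function f" "complex_polynomial_function g"
    and "a \<in> coord_space J" "f a \<noteq> 0" "b \<in> coord_space J" "g b \<noteq> 0"
  shows "\<exists>c\<in>coord_space J. f c \<noteq> 0 \<and> g c \<noteq> 0"
proof -
  obtain P where P: "\<forall>t. f (a + t *s (b - a)) = poly P t" using cpf_on_line[OF assms(1)] by blast
  obtain Q where Q: "\<forall>t. g (a + t *s (b - a)) = poly Q t" using cpf_on_line[OF assms(2)] by blast
  have ab: "b - a \<in> coord_space J" using assms by (auto simp: coord_space_def)
  have e: "a + 0 *s (b - a) = a" "a + 1 *s (b - a) = b" by (simp_all add: vec_eq_iff)
  have "poly P 0 \<noteq> 0" "poly Q 1 \<noteq> 0" using P[rule_format, of 0] Q[rule_format, of 1] assms by (simp_all add: e)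
  then have "P * Q \<noteq> 0" by auto
  then have "finite {t. poly (P * Q) t = 0}" by (rule poly_roots_finite)
  then obtain t where "poly (P * Q) t \<noteq> 0"
    using infinite_UNIV_char_0 by (metis (mono_tags, lifting) UNIV_eq_I mem_Collect_eq)
  then show ?thesis using P Q coord_space_add[OF assms(3) ab, of t] by (intro bexI[of _ "a + t *s (b - a)"]) auto
qed

text \<open>A monic equation for the parameter on the lines in direction \<open>v\<close>; in
  algebraic terms, \<open>Y\<close> is finite over its projection along \<open>v\<close>. The bound
  on the degrees of the coefficients is recorded for the growth estimate.\<close>

definition integral_along :: "(complex ^ 'n) set \<Rightarrow> complex ^ 'n \<Rightarrow> nat \<Rightarrow> (nat \<Rightarrow> complex ^ 'n \<Rightarrow> complex) \<Rightarrow> bool" where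
  "integral_along Y v D B \<longleftrightarrow> (\<forall>l. pdeg D (B l)) \<and>
    (\<forall>z t. z + t *s v \<in> Y \<longrightarrow> t ^ D = (\<Sum>l<D. B l z * t ^ l))"

lemma poly_sum_atMost: "degree (p :: complex poly) \<le> n \<Longrightarrow> poly p x = (\<Sum>i\<le>n. coeff p i * x ^ i)"
  unfolding poly_altdef by (intro sum.mono_neutral_left) (auto simp: coeff_eq_0)

lemma integral_along_subset: "integral_along Y v D B \<Longrightarrow> Z \<subseteq> Y \<Longrightarrow> integral_along Z v D B"
  by (auto simp: integral_along_def)

text \<open>Noether's choice of coordinates: if \<open>v\<close> is not a zero of the leading form
  of \<open>R\<close>, then \<open>R\<close> along lines in direction \<open>v\<close> has a
  constant nonzero leading coefficient, and division by it gives a monic equation. The other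
  conditions on \<open>v\<close> also exclude only the zeros of nonzero polynomials on
  \<open>coord_space J\<close>, so all of them can be met together.\<close>

lemma exists_integral_direction:
  assumes Y: "Y \<subseteq> coord_space J" and R: "complex_polynomial_function R" "\<forall>x\<in>Y. R x = 0"
    and a: "a \<in> coord_space J" "R a \<noteq> 0"
    and Q: "complex_polynomial_function Q" "b \<in> coord_space J" "Q b \<noteq> 0" and j: "j \<in> J"
  shows "\<exists>v\<in>coord_space J. v $ j \<noteq> 0 \<and> Q v \<noteq> 0 \<and> (\<exists>D B. integral_along Y v D B)"
proof -
  obtain d where "pdeg d R" using cpf_imp_pdeg[OF R(1)] by blast
  then obtain H where H: "\<forall>i. pdeg i (\<lambda>x. coeff (H x) i)" "\<forall>x i. d < i \<longrightarrow> coeff (H x) i = 0"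
    "\<forall>x t. R (t *s x) = poly (H x) t" using pdeg_homogeneous_parts by blast
  define E where "E = {i. \<exists>x\<in>coord_space J. coeff (H x) i \<noteq> 0}"
  have fE: "finite E" using H(2) by (intro finite_subset[of E "{..d}"]) (auto simp: E_def not_less[symmetric])
  have "H a \<noteq> 0" using H(3)[rule_format, of 1 a] a by auto
  then have neE: "E \<noteq> {}" using a by (auto simp: E_def poly_eq_iff)
  \<comment> \<open>This is the degree of \<open>R\<close> on \<open>coord_space J\<close>.
    Homogeneous parts of higher degree vanish on that subspace, though perhaps not elsewhere, and
    \<open>R'\<close> omits them.\<close>
  define e where "e = Max E"
  have "e \<in> E" using fE neE by (simp add: e_def)
  then obtain u where u: "u \<in> coord_space J" "coeff (H u) e \<noteq> 0" by (auto simp: E_def)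
  have above: "coeff (H x) i = 0" if "x \<in> coord_space J" "i > e" for x i
    using that fE by (metis (mono_tags, lifting) E_def Max_ge e_def leD mem_Collect_eq)
  have cj: "complex_polynomial_function (\<lambda>x. Q x * x $ j)" by (intro cpf_mult Q cpf_coord)
  have "\<exists>c\<in>coord_space J. Q c \<noteq> 0 \<and> c $ j \<noteq> 0"
  proof (rule cpf_nonzero_common[OF Q(1) cpf_coord Q(2,3)])
    show "axis j 1 \<in> coord_space J" "axis j 1 $ j \<noteq> (0::complex)" using j by (auto simp: coord_space_def axis_def)
  qed
  then obtain c where c: "c \<in> coord_space J" "Q c * c $ j \<noteq> 0" by auto
  have ce: "complex_polynomial_function (\<lambda>x. coeff (H x) e)" using H(1) pdeg_imp_cpf by blast
  obtain v where v: "v \<in> coord_space J" "Q v \<noteq> 0" "v $ j \<noteq> 0" "coeff (H v) e \<noteq> 0"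
    using cpf_nonzero_common[OF cj ce c u] by auto
  define R' where "R' x = (\<Sum>i\<le>e. coeff (H x) i)" for x
  have pR': "pdeg e R'" unfolding R'_def[abs_def] using H(1) by (intro pdeg_sum) (auto intro: pdeg_mono)
  have RR': "R' x = R x" if "x \<in> coord_space J" for x
  proof -
    have "degree (H x) \<le> e" using above[OF that] by (auto intro: degree_le)
    then have "poly (H x) 1 = R' x" by (simp add: poly_sum_atMost R'_def)
    then show ?thesis using H(3)[rule_format, of 1 x] by simp
  qed
  obtain P where P: "\<forall>i. pdeg (e - i) (\<lambda>z. coeff (P z) i)" "\<forall>z i. e < i \<longrightarrow> coeff (P z) i = 0"
    "\<forall>z t. R' (z + t *s v) = poly (P z) t" using pdeg_expansion[OF pR'] by blast
  define c where "c = coeff (P 0) e"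
  have cP: "coeff (P z) e = c" for z
    using pdeg_0[of "e - e" "\<lambda>z. coeff (P z) e" z 0] P(1) by (metis c_def cancel_comm_monoid_add_class.diff_cancel)
  have "poly (P 0) t = poly (H v) t" for t
  proof -
    have "R' (0 + t *s v) = R (t *s v)" using RR' coord_space_scale[OF v(1)] by simp
    then show ?thesis using P(3) H(3) by metis
  qed
  then have "P 0 = H v" by (metis poly_eq_poly_eq_iff ext)
  then have c0: "c \<noteq> 0" using v(4) by (simp add: c_def)
  define B where "B l z = - (1 / c) * coeff (P z) l" for l z
  have "pdeg e (B l)" for l
    unfolding B_def[abs_def] using P(1) by (intro pdeg_cmult) (meson diff_le_self pdeg_mono)
  moreover have "t ^ e = (\<Sum>l<e. B l z * t ^ l)" if zt: "z + t *s v \<in> Y" for z t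
  proof -
    have "0 = poly (P z) t" using zt P(3) RR' R(2) Y by (metis subsetD)
    also have "\<dots> = (\<Sum>l\<le>e. coeff (P z) l * t ^ l)"
      using P(2) by (intro poly_sum_atMost degree_le) auto
    also have "\<dots> = (\<Sum>l<e. coeff (P z) l * t ^ l) + c * t ^ e"
      using cP by (simp add: lessThan_Suc_atMost[symmetric])
    finally have "t ^ e = - (1 / c) * (\<Sum>l<e. coeff (P z) l * t ^ l)"
      using c0 by (simp add: field_simps eq_neg_iff_add_eq_0)
    then show ?thesis unfolding B_def sum_distrib_left by (simp add: mult.assoc)
  qed
  ultimately have "integral_along Y v e B" by (simp add: integral_along_def)
  then show ?thesis using v by blast
qed

text \<open>Multiplication by \<open>t\<close> shifts the coefficients and replaces
  \<open>t ^ D\<close> by means of the monic equation, which raises degrees by at most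
  \<open>D\<close>. For \<open>D = 0\<close> the equation reads \<open>1 = 0\<close>, so no point
  \<open>z + t *s v\<close> lies in \<open>Y\<close>.\<close>

lemma integral_along_reduce:
  assumes I: "integral_along Y v D B"
  shows "\<exists>a. (\<forall>l. pdeg (D * i) (a l)) \<and> (\<forall>z t. z + t *s v \<in> Y \<longrightarrow> t ^ i = (\<Sum>l<D. a l z * t ^ l))"
proof (induction i)
  case 0
  show ?case
  proof (cases "D = 0")
    case True
    then have "z + t *s v \<notin> Y" for z t using I by (auto simp: integral_along_def)
    then show ?thesis by (intro exI[of _ "\<lambda>l z. 0"]) (auto intro: pdeg.const)
  next
    case False
    have "(\<Sum>l<D. (if l = 0 then 1 else 0) * t ^ l) = (1::complex)" for t
      using False by (subst sum.remove[of _ 0]) auto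
    then show ?thesis by (intro exI[of _ "\<lambda>l z. if l = 0 then 1 else 0"]) (auto intro: pdeg.const)
  qed
next
  case (Suc i)
  then obtain a where a: "\<forall>l. pdeg (D * i) (a l)"
    "\<forall>z t. z + t *s v \<in> Y \<longrightarrow> t ^ i = (\<Sum>l<D. a l z * t ^ l)" by blast
  have B: "\<forall>l. pdeg D (B l)" "\<forall>z t. z + t *s v \<in> Y \<longrightarrow> t ^ D = (\<Sum>l<D. B l z * t ^ l)"
    using I by (auto simp: integral_along_def)
  show ?case
  proof (cases D)
    case 0
    then have "z + t *s v \<notin> Y" for z t using B by auto
    then show ?thesis by (intro exI[of _ "\<lambda>l z. 0"]) (auto intro: pdeg.const)
  next
    case (Suc D')
    define a' where "a' l z = (if l = 0 then 0 else a (l - 1) z) + a D' z * B l z" for l z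
    have "pdeg (D * Suc i) (a' l)" for l
    proof -
      have "pdeg (D * Suc i) (\<lambda>z. if l = 0 then 0 else a (l - 1) z)"
        using a(1) by (cases "l = 0") (auto intro: pdeg.const pdeg_mono[of "D * i"])
      then show ?thesis unfolding a'_def[abs_def] using a(1) B(1)
        by (intro pdeg.add pdeg_mult[of "D * i" _ D]) auto
    qed
    moreover have "t ^ Suc i = (\<Sum>l<D. a' l z * t ^ l)" if zt: "z + t *s v \<in> Y" for z t
    proof -
      have "t ^ Suc i = (\<Sum>l<D. a l z * t ^ Suc l)"
        using a(2) zt by (simp add: sum_distrib_left mult_ac)
      also have "\<dots> = (\<Sum>l<D'. a l z * t ^ Suc l) + a D' z * t ^ D" by (simp add: Suc)
      also have "(\<Sum>l<D'. a l z * t ^ Suc l) = (\<Sum>l<D. (if l = 0 then 0 else a (l - 1) z) * t ^ l)"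
        unfolding Suc sum.lessThan_Suc_shift by simp
      also have "t ^ D = (\<Sum>l<D. B l z * t ^ l)" using B(2) zt by blast
      finally show ?thesis
        by (simp add: a'_def distrib_right sum.distrib sum_distrib_left mult.assoc)
    qed
    ultimately show ?thesis by blast
  qed
qed

lemma integral_along_finite:
  assumes I: "integral_along Y v D B"
  shows "finite {t. z + t *s v \<in> Y}"
proof -
  define P where "P = monom 1 D - (\<Sum>l<D. monom (B l z) l)"
  have "coeff P D = 1" by (simp add: P_def coeff_sum)
  then have "P \<noteq> 0" by auto
  moreover have "{t. z + t *s v \<in> Y} \<subseteq> {t. poly P t = 0}"
    using I by (auto simp: P_def integral_along_def poly_sum poly_monom)
  ultimately show ?thesis using poly_roots_finite finite_subset by blast
qed

text \<open>The determinant-free core of Nakayama's lemma: a matrix of polynomials which is the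
  identity at \<open>z0\<close> has a multiplier that kills its kernel and is \<open>1\<close> at \<open>z0\<close>.\<close>

lemma cpf_matrix_kernel:
  fixes D :: nat
  assumes "\<And>i l. i < D \<Longrightarrow> l < D \<Longrightarrow> complex_polynomial_function (M i l)"
    and "\<And>i l. i < D \<Longrightarrow> l < D \<Longrightarrow> M i l z0 = (if i = l then 1 else 0)"
  shows "\<exists>q. complex_polynomial_function q \<and> q z0 = 1 \<and>
    (\<forall>z T. (\<forall>i<D. (\<Sum>l<D. M i l z * T l) = 0) \<longrightarrow> (\<forall>l<D. q z * T l = 0))"
  using assms
proof (induction D arbitrary: M)
  case 0
  show ?case by (rule exI[of _ "\<lambda>x. 1"]) (auto intro: cpf_const)
next
  case (Suc D)
  \<comment> \<open>Elimination of the last unknown without division. The pivot \<open>M D D\<close>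
    is 1 at \<open>z0\<close>, so \<open>M'\<close> is again the identity there.\<close>
  define M' where "M' i l z = M D D z * M i l z - M i D z * M D l z" for i l z
  have "\<exists>q. complex_polynomial_function q \<and> q z0 = 1 \<and>
    (\<forall>z T. (\<forall>i<D. (\<Sum>l<D. M' i l z * T l) = 0) \<longrightarrow> (\<forall>l<D. q z * T l = 0))"
    by (rule Suc.IH) (auto simp: M'_def[abs_def] Suc.prems intro!: cpf_diff cpf_mult)
  then obtain q where q: "complex_polynomial_function q" "q z0 = 1"
    "\<forall>z T. (\<forall>i<D. (\<Sum>l<D. M' i l z * T l) = 0) \<longrightarrow> (\<forall>l<D. q z * T l = 0)" by blast
  have "q z * M D D z * T l = 0" if T: "\<forall>i<Suc D. (\<Sum>l<Suc D. M i l z * T l) = 0" and l: "l < Suc D" for z T l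
  proof -
    have S: "(\<Sum>l<D. M i l z * T l) = - (M i D z * T D)" if "i < Suc D" for i
      using T that by (simp add: eq_neg_iff_add_eq_0)
    have "(\<Sum>l<D. M' i l z * T l) = 0" if i: "i < D" for i
    proof -
      have "(\<Sum>l<D. M' i l z * T l) = M D D z * (\<Sum>l<D. M i l z * T l) - M i D z * (\<Sum>l<D. M D l z * T l)"
        unfolding M'_def sum_distrib_left sum_subtractf[symmetric] by (intro sum.cong) (auto simp: algebra_simps)
      then show ?thesis using S i by simp
    qed
    then have qT: "\<forall>l<D. q z * T l = 0" using q(3) by blast
    show ?thesis
    proof (cases "l = D")
      case True
      have "q z * (M D D z * T D) = - (\<Sum>l<D. M D l z * (q z * T l))"
        using S[of D] by (simp add: sum_distrib_left[symmetric] mult.left_commute)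
      then show ?thesis using qT True by (simp add: mult.assoc)
    next
      case False
      then have "q z * T l = 0" using qT l by simp
      then show ?thesis by auto
    qed
  qed
  then show ?case using q Suc.prems
    by (intro exI[of _ "\<lambda>z. q z * M D D z"]) (auto intro!: cpf_mult)
qed

text \<open>A nonzero member of least degree divides all members. If it were not constant, one of
  its roots would be common to the whole ideal.\<close>

lemma poly_ideal_unit:
  fixes I :: "complex poly set"
  assumes add: "\<And>g h. g \<in> I \<Longrightarrow> h \<in> I \<Longrightarrow> g + h \<in> I" and mult: "\<And>g h. g \<in> I \<Longrightarrow> g * h \<in> I"
    and "h0 \<in> I" "h0 \<noteq> 0" and nr: "\<And>t. \<exists>h\<in>I. poly h t \<noteq> 0"
  shows "1 \<in> I"
proof -
  obtain g where g: "g \<in> I" "g \<noteq> 0" "\<And>h. h \<in> I \<Longrightarrow> h \<noteq> 0 \<Longrightarrow> degree g \<le> degree h"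
    using ex_has_least_nat[of "\<lambda>g. g \<in> I \<and> g \<noteq> 0" h0 degree] assms(3,4) by auto
  have "degree g = 0"
  proof (rule ccontr)
    assume d: "degree g \<noteq> 0"
    then have "\<not> constant (poly g)" by (simp add: constant_degree)
    then obtain t where t: "poly g t = 0" using fundamental_theorem_of_algebra by blast
    obtain h where h: "h \<in> I" "poly h t \<noteq> 0" using nr by blast
    have "h + g * (- (h div g)) \<in> I" by (intro add mult h g)
    moreover have "h + g * (- (h div g)) = h mod g" by (simp add: minus_mult_div_eq_mod)
    ultimately have "h mod g \<in> I" by simp
    then have "h mod g = 0" using g degree_mod_less[of g h] by force
    then have "g dvd h" by (simp add: mod_eq_0_iff_dvd)
    then show False using t h by (auto simp: dvd_def)
  qed
  then obtain c where c: "g = [:c:]" by (metis degree_eq_zeroE)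
  then have "c \<noteq> 0" using g by auto
  then have "g * [:1 / c:] = 1" using c by (simp add: one_pCons)
  then show ?thesis using mult[OF g(1), of "[:1 / c:]"] by simp
qed

text \<open>Finite maps are closed. Over a point \<open>z0\<close> outside the projection the fibre
  is empty, so the maximal ideal of \<open>z0\<close> generates the unit ideal in the coordinate
  ring of \<open>Y\<close>. Nakayama's lemma then produces a polynomial that is 1 at
  \<open>z0\<close> and vanishes on the projection.\<close>

theorem algebraic_projection:
  assumes Y: "algebraic_set Y" and I: "integral_along Y v D B"
  shows "algebraic_set {z. \<exists>t. z + t *s v \<in> Y}"
proof -
  define W where "W = {z. \<exists>t. z + t *s v \<in> Y}"
  obtain P where P: "\<forall>p\<in>P. complex_polynomial_function p" "Y = {x. \<forall>p\<in>P. p x = 0}"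
    using Y by (auto simp: algebraic_set_def)
  have main: "\<exists>q. complex_polynomial_function q \<and> (\<forall>z\<in>W. q z = 0) \<and> q z0 \<noteq> 0" if z0: "z0 \<notin> W" for z0
  proof -
    \<comment> \<open>\<open>K\<close> consists of the polynomials in \<open>t\<close> that agree on
      \<open>Y\<close> with some \<open>E z\<close> whose coefficients vanish at \<open>z0\<close>:
      membership in the ideal generated on \<open>Y\<close> by the maximal ideal of
      \<open>z0\<close>.\<close>
    define K where "K = {h. \<exists>E d. (\<forall>i. complex_polynomial_function (\<lambda>z. coeff (E z) i)) \<and>
      (\<forall>z. degree (E z) \<le> d) \<and> E z0 = 0 \<and> (\<forall>z t. z + t *s v \<in> Y \<longrightarrow> poly h t = poly (E z) t)}"
    have KI: "h \<in> K" if "\<forall>i. complex_polynomial_function (\<lambda>z. coeff (E z) i)" "\<forall>z. degree (E z) \<le> d"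
      "E z0 = 0" "\<forall>z t. z + t *s v \<in> Y \<longrightarrow> poly h t = poly (E z) t" for h E d
      using that unfolding K_def by blast
    have add: "g + h \<in> K" if gh: "g \<in> K" "h \<in> K" for g h
    proof -
      obtain E d where E: "\<forall>i. complex_polynomial_function (\<lambda>z. coeff (E z) i)" "\<forall>z. degree (E z) \<le> d"
        "E z0 = 0" "\<forall>z t. z + t *s v \<in> Y \<longrightarrow> poly g t = poly (E z) t" using gh(1) unfolding K_def by blast
      obtain F e where F: "\<forall>i. complex_polynomial_function (\<lambda>z. coeff (F z) i)" "\<forall>z. degree (F z) \<le> e"
        "F z0 = 0" "\<forall>z t. z + t *s v \<in> Y \<longrightarrow> poly h t = poly (F z) t" using gh(2) unfolding K_def by blast
      show ?thesis using E F
        by (intro KI[of "\<lambda>z. E z + F z" "max d e"])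
           (auto intro!: cpf_add degree_add_le intro: max.coboundedI1 max.coboundedI2)
    qed
    have mult: "g * h \<in> K" if gh: "g \<in> K" for g h
    proof -
      obtain E d where E: "\<forall>i. complex_polynomial_function (\<lambda>z. coeff (E z) i)" "\<forall>z. degree (E z) \<le> d"
        "E z0 = 0" "\<forall>z t. z + t *s v \<in> Y \<longrightarrow> poly g t = poly (E z) t" using gh unfolding K_def by blast
      have "degree (E z * h) \<le> d + degree h" for z
        using degree_mult_le[of "E z" h] E(2) by (meson add_le_mono1 le_trans)
      then show ?thesis using E
        by (intro KI[of "\<lambda>z. E z * h" "d + degree h"])
           (auto simp: coeff_mult intro!: cpf_sum cpf_mult cpf_const)
    qed
    have B: "\<forall>l. pdeg D (B l)" "\<forall>z t. z + t *s v \<in> Y \<longrightarrow> t ^ D = (\<Sum>l<D. B l z * t ^ l)"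
      using I by (auto simp: integral_along_def)
    define R where "R z = monom 1 D - (\<Sum>l<D. monom (B l z) l)" for z
    have cR: "coeff (R z) i = (if i = D then 1 else if i < D then - B i z else 0)" for z i
      by (auto simp: R_def coeff_sum)
    have dR: "degree (R z) \<le> D" for z by (rule degree_le) (auto simp: cR)
    \<comment> \<open>\<open>R z\<close> vanishes on \<open>Y\<close>, so there \<open>R z0\<close>
      agrees with \<open>R z0 - R z\<close>, whose coefficients vanish at \<open>z0\<close>.\<close>
    have "R z0 \<in> K"
    proof (rule KI)
      show "\<forall>i. complex_polynomial_function (\<lambda>z. coeff (R z0 - R z) i)"
        using B(1) pdeg_imp_cpf by (auto simp: cR intro!: cpf_diff cpf_const cpf_minus)
      show "\<forall>z. degree (R z0 - R z) \<le> D" using dR by (auto intro: degree_diff_le)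
      show "\<forall>z t. z + t *s v \<in> Y \<longrightarrow> poly (R z0) t = poly (R z0 - R z) t"
        using B(2) by (auto simp: R_def poly_sum poly_monom)
    qed auto
    moreover have "R z0 \<noteq> 0" using cR[of z0 D] by auto
    moreover have "\<exists>h\<in>K. poly h t \<noteq> 0" for t
    proof -
      have "z0 + t *s v \<notin> Y" using z0 by (auto simp: W_def)
      then obtain p where p: "p \<in> P" "p (z0 + t *s v) \<noteq> 0" using P by blast
      obtain d where "pdeg d p" using cpf_imp_pdeg P p by blast
      then obtain E where E: "\<forall>i. pdeg (d - i) (\<lambda>z. coeff (E z) i)" "\<forall>z i. d < i \<longrightarrow> coeff (E z) i = 0"
        "\<forall>z t. p (z + t *s v) = poly (E z) t" using pdeg_expansion by blast
      have "degree (E z) \<le> d" for z using E(2) by (auto intro: degree_le)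
      then have "E z0 \<in> K"
        using E P p by (intro KI[of "\<lambda>z. E z0 - E z" d])
          (auto intro!: cpf_diff cpf_const degree_diff_le intro: pdeg_imp_cpf)
      then show ?thesis using p E by auto
    qed
    ultimately have K1: "1 \<in> K" using add mult by (intro poly_ideal_unit[of K "R z0"]) auto
    have "\<exists>N. \<forall>i. (\<forall>l. complex_polynomial_function (N i l) \<and> N i l z0 = 0) \<and>
      (\<forall>z t. z + t *s v \<in> Y \<longrightarrow> t ^ i = (\<Sum>l<D. N i l z * t ^ l))"
    proof (rule choice, rule allI)
      fix i
      have "monom 1 i \<in> K" using mult[OF K1, of "monom 1 i"] by simp
      then obtain E d where E: "\<forall>i. complex_polynomial_function (\<lambda>z. coeff (E z) i)" "\<forall>z. degree (E z) \<le> d"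
        "E z0 = 0" "\<forall>z t. z + t *s v \<in> Y \<longrightarrow> poly (monom 1 i) t = poly (E z) t" unfolding K_def by blast
      have "\<exists>a. \<forall>j. (\<forall>l. pdeg (D * j) (a j l)) \<and> (\<forall>z t. z + t *s v \<in> Y \<longrightarrow> t ^ j = (\<Sum>l<D. a j l z * t ^ l))"
        by (rule choice) (use integral_along_reduce[OF I] in blast)
      then obtain a where a: "\<forall>j l. pdeg (D * j) (a j l)"
        "\<forall>j z t. z + t *s v \<in> Y \<longrightarrow> t ^ j = (\<Sum>l<D. a j l z * t ^ l)" by blast
      define n where "n l z = (\<Sum>j\<le>d. coeff (E z) j * a j l z)" for l z
      have "t ^ i = (\<Sum>l<D. n l z * t ^ l)" if zt: "z + t *s v \<in> Y" for z t
      proof -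
        have "t ^ i = poly (E z) t" using E(4) zt by (simp add: poly_monom)
        also have "\<dots> = (\<Sum>j\<le>d. coeff (E z) j * t ^ j)" using E(2) by (simp add: poly_sum_atMost)
        also have "\<dots> = (\<Sum>j\<le>d. coeff (E z) j * (\<Sum>l<D. a j l z * t ^ l))" using a(2) zt by (intro sum.cong) auto
        also have "\<dots> = (\<Sum>l<D. n l z * t ^ l)"
          unfolding n_def sum_distrib_left sum_distrib_right by (subst sum.swap) (simp add: mult.assoc)
        finally show ?thesis .
      qed
      moreover have "complex_polynomial_function (n l)" for l
        unfolding n_def[abs_def] using E(1) a(1) by (intro cpf_sum cpf_mult) (auto intro: pdeg_imp_cpf)
      moreover have "n l z0 = 0" for l using E(3) by (simp add: n_def)
      ultimately show "\<exists>N. (\<forall>l. complex_polynomial_function (N l) \<and> N l z0 = 0) \<and>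
        (\<forall>z t. z + t *s v \<in> Y \<longrightarrow> t ^ i = (\<Sum>l<D. N l z * t ^ l))" by blast
    qed
    then obtain N where N: "\<forall>i l. complex_polynomial_function (N i l) \<and> N i l z0 = 0"
      "\<forall>i z t. z + t *s v \<in> Y \<longrightarrow> t ^ i = (\<Sum>l<D. N i l z * t ^ l)" by blast
    \<comment> \<open>The identity minus a matrix that vanishes at \<open>z0\<close>. At a point
      \<open>z + t *s v\<close> of \<open>Y\<close> its kernel contains the vector of powers
      \<open>t ^ l\<close>.\<close>
    define M where "M i l z = (if i = l then 1 else 0) - N i l z" for i l z
    have "\<exists>q. complex_polynomial_function q \<and> q z0 = 1 \<and>
      (\<forall>z T. (\<forall>i<D. (\<Sum>l<D. M i l z * T l) = 0) \<longrightarrow> (\<forall>l<D. q z * T l = 0))"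
    proof (rule cpf_matrix_kernel)
      fix i l
      show "complex_polynomial_function (M i l)"
        unfolding M_def[abs_def] using N(1) by (intro cpf_diff cpf_const) blast
      show "M i l z0 = (if i = l then 1 else 0)" using N(1) by (simp add: M_def)
    qed
    then obtain q where q: "complex_polynomial_function q" "q z0 = 1"
      "\<forall>z T. (\<forall>i<D. (\<Sum>l<D. M i l z * T l) = 0) \<longrightarrow> (\<forall>l<D. q z * T l = 0)" by blast
    have "q z = 0" if z: "z \<in> W" for z
    proof -
      obtain t where t: "z + t *s v \<in> Y" using z by (auto simp: W_def)
      then have D0: "D > 0" using B(2) by (cases D) auto
      have "\<forall>i<D. (\<Sum>l<D. M i l z * t ^ l) = 0"
      proof (intro allI impI)
        fix i assume i: "i < D"
        have "(\<Sum>l<D. M i l z * t ^ l) = (\<Sum>l<D. if i = l then t ^ l else 0) - (\<Sum>l<D. N i l z * t ^ l)"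
          unfolding sum_subtractf[symmetric] M_def by (intro sum.cong) (auto simp: algebra_simps)
        also have "\<dots> = 0" using i N(2) t by simp
        finally show "(\<Sum>l<D. M i l z * t ^ l) = 0" .
      qed
      \<comment> \<open>The entry with index 0 of this vector is \<open>t ^ 0 = 1\<close>, so
        \<open>q\<close> itself vanishes at \<open>z\<close>.\<close>
      then have "q z * t ^ 0 = 0" using q(3)[rule_format, of z "\<lambda>l. t ^ l" 0] D0 by blast
      then show ?thesis by simp
    qed
    then show ?thesis using q by auto
  qed
  have "W = {z. \<forall>q\<in>{q. complex_polynomial_function q \<and> (\<forall>z\<in>W. q z = 0)}. q z = 0}" using main by blast
  moreover have "\<forall>q\<in>{q. complex_polynomial_function q \<and> (\<forall>z\<in>W. q z = 0)}. complex_polynomial_function q" by simp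
  ultimately have "algebraic_set W"
    unfolding algebraic_set_def by (intro exI[of _ "{q. complex_polynomial_function q \<and> (\<forall>z\<in>W. q z = 0)}"] conjI)
  then show ?thesis by (simp add: W_def)
qed

section \<open>Growth and Noether normalization\<close>

inductive lin_comb :: "('a \<Rightarrow> complex) set \<Rightarrow> ('a \<Rightarrow> complex) \<Rightarrow> bool" for B where
  zero: "lin_comb B (\<lambda>x. 0)"
| step: "lin_comb B f \<Longrightarrow> b \<in> B \<Longrightarrow> lin_comb B (\<lambda>x. f x + c * b x)"

lemma lin_comb_base: "b \<in> B \<Longrightarrow> lin_comb B b"
  using lin_comb.step[OF lin_comb.zero, of b B 1] by simp

lemma lin_comb_add: "lin_comb B g \<Longrightarrow> lin_comb B f \<Longrightarrow> lin_comb B (\<lambda>x. f x + g x)"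
  by (induction rule: lin_comb.induct) (auto simp: add.assoc[symmetric] intro: lin_comb.step)

lemma lin_comb_cmult: "lin_comb B f \<Longrightarrow> lin_comb B (\<lambda>x. a * f x)"
  by (induction rule: lin_comb.induct)
     (auto simp: distrib_left mult.assoc[symmetric] intro: lin_comb.intros)

lemma lin_comb_sum: "(\<And>i. i \<in> I \<Longrightarrow> lin_comb B (f i)) \<Longrightarrow> lin_comb B (\<lambda>x. \<Sum>i\<in>I. f i x)"
  by (induction I rule: infinite_finite_induct) (auto intro: lin_comb.zero lin_comb_add)

lemma lin_comb_mono: "lin_comb A f \<Longrightarrow> A \<subseteq> B \<Longrightarrow> lin_comb B f"
  by (induction rule: lin_comb.induct) (auto intro: lin_comb.intros)

lemma lin_comb_mult1: "lin_comb B g \<Longrightarrow> lin_comb ((\<lambda>b x. a x * b x) ` B) (\<lambda>x. a x * g x)"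
proof (induction rule: lin_comb.induct)
  case (step f b c)
  have "lin_comb ((\<lambda>b x. a x * b x) ` B) (\<lambda>x. a x * f x + c * (a x * b x))"
    using lin_comb.step[OF step.IH, of "\<lambda>x. a x * b x" c] step.hyps by auto
  then show ?case by (simp add: algebra_simps)
qed (simp add: lin_comb.zero)

lemma lin_comb_mult:
  "lin_comb A f \<Longrightarrow> lin_comb B g \<Longrightarrow> lin_comb ((\<lambda>(a, b) x. a x * b x) ` (A \<times> B)) (\<lambda>x. f x * g x)"
proof (induction rule: lin_comb.induct)
  case (step f a c)
  have "lin_comb ((\<lambda>b x. a x * b x) ` B) (\<lambda>x. a x * g x)" by (rule lin_comb_mult1[OF step.prems])
  then have "lin_comb ((\<lambda>(a, b) x. a x * b x) ` (A \<times> B)) (\<lambda>x. a x * g x)"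
    by (rule lin_comb_mono) (use step.hyps in auto)
  then have "lin_comb ((\<lambda>(a, b) x. a x * b x) ` (A \<times> B)) (\<lambda>x. f x * g x + c * (a x * g x))"
    by (intro lin_comb_add lin_comb_cmult step.IH step.prems)
  then show ?case by (simp add: algebra_simps)
qed (simp add: lin_comb.zero)

lemma lin_comb_compose: "lin_comb B f \<Longrightarrow> lin_comb ((\<lambda>b x. b (\<phi> x)) ` B) (\<lambda>x. f (\<phi> x))"
proof (induction rule: lin_comb.induct)
  case (step f b c)
  then show ?case using lin_comb.step[OF step.IH, of "\<lambda>x. b (\<phi> x)" c] by auto
qed (simp add: lin_comb.zero)

lemma lin_comb_finite:
  assumes "lin_comb B f" "finite B"
  shows "\<exists>c. \<forall>x. f x = (\<Sum>b\<in>B. c b * b x)"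
  using assms(1)
proof (induction rule: lin_comb.induct)
  case zero
  show ?case by (rule exI[of _ "\<lambda>_. 0"]) simp
next
  case (step f b c)
  then obtain d where d: "\<forall>x. f x = (\<Sum>b\<in>B. d b * b x)" by blast
  have "f x + c * b x = (\<Sum>b'\<in>B. (d(b := d b + c)) b' * b' x)" for x
  proof -
    have "(\<Sum>b'\<in>B. (d(b := d b + c)) b' * b' x) = (\<Sum>b'\<in>B. d b' * b' x + (if b' = b then c * b' x else 0))"
      by (intro sum.cong) (auto simp: algebra_simps)
    also have "\<dots> = f x + c * b x" using d step.hyps assms(2) by (simp add: sum.distrib)
    finally show ?thesis by simp
  qed
  then show ?case by blast
qed

text \<open>The Hilbert function of \<open>X\<close> is \<open>O(s^k)\<close>.\<close>

definition growth :: "(complex ^ 'n) set \<Rightarrow> nat \<Rightarrow> bool" where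
  "growth X k \<longleftrightarrow> (\<exists>C. \<forall>s. \<exists>B. finite B \<and> card B \<le> C * (s + 1) ^ k \<and>
    (\<forall>p. pdeg s p \<longrightarrow> (\<exists>q. lin_comb B q \<and> (\<forall>x\<in>X. p x = q x))))"

lemma growth_mono_exponent:
  assumes "growth X d" "d \<le> k"
  shows "growth X k"
proof -
  obtain C where C: "\<forall>s. \<exists>B. finite B \<and> card B \<le> C * (s + 1) ^ d \<and>
    (\<forall>p. pdeg s p \<longrightarrow> (\<exists>q. lin_comb B q \<and> (\<forall>x\<in>X. p x = q x)))" using assms(1) by (auto simp: growth_def)
  have "C * (s + 1) ^ d \<le> C * (s + 1) ^ k" for s :: nat
    using assms(2) by (intro mult_le_mono2 power_increasing) auto
  then show ?thesis unfolding growth_def using C by (meson le_trans)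
qed

text \<open>The monomials with each exponent at most \<open>s\<close> span the polynomials of degree
  at most \<open>s\<close> on the subspace. Bounding the exponents separately gives the closed count
  \<open>(s + 1) ^ card J\<close>.\<close>

lemma growth_coord_space: "growth (coord_space J :: (complex ^ 'n) set) (card J)"
proof -
  define mono where "mono \<alpha> x = (\<Prod>j\<in>J. x $ j ^ \<alpha> j)" for \<alpha> :: "'n \<Rightarrow> nat" and x :: "complex ^ 'n"
  define B where "B s = mono ` (PiE J (\<lambda>_. {..s}))" for s
  have monoE: "mono \<alpha> = mono (restrict \<alpha> J)" for \<alpha> by (auto simp: mono_def fun_eq_iff intro!: prod.cong)
  have inB: "mono \<alpha> \<in> B s" if "\<forall>j\<in>J. \<alpha> j \<le> s" for \<alpha> s
    unfolding B_def by (subst monoE) (use that in auto)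
  have BE: "\<exists>\<alpha>. b = mono \<alpha> \<and> (\<forall>j\<in>J. \<alpha> j \<le> s)" if "b \<in> B s" for b s
    using that by (auto simp: B_def PiE_iff)
  have "finite (B s) \<and> card (B s) \<le> 1 * (s + 1) ^ card J" for s
  proof -
    have f: "finite (PiE J (\<lambda>_. {..s}))" by (intro finite_PiE) auto
    have "card (B s) \<le> card (PiE J (\<lambda>_. {..s}))" unfolding B_def by (rule card_image_le[OF f])
    then show ?thesis using f by (simp add: card_PiE B_def)
  qed
  moreover have "\<exists>q. lin_comb (B s) q \<and> (\<forall>x\<in>coord_space J. p x = q x)" if "pdeg s p" for s and p :: "complex ^ 'n \<Rightarrow> complex"
    using that
  proof induction
    case (const d c)
    have "lin_comb (B d) (\<lambda>x. c * mono (\<lambda>_. 0) x)" by (intro lin_comb_cmult lin_comb_base inB) simp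
    then show ?case by (intro exI[of _ "\<lambda>x. c * mono (\<lambda>_. 0) x"]) (simp add: mono_def)
  next
    case (coord d i)
    show ?case
    proof (cases "i \<in> J")
      case True
      have "mono (\<lambda>j. if j = i then 1 else 0) x = x $ i" for x
      proof -
        have "(\<Prod>j\<in>J. x $ j ^ (if j = i then 1 else 0)) = (\<Prod>j\<in>J. if j = i then x $ j else 1)"
          by (intro prod.cong) auto
        then show ?thesis using True by (simp add: mono_def)
      qed
      moreover have "lin_comb (B (Suc d)) (mono (\<lambda>j. if j = i then 1 else 0))"
        by (intro lin_comb_base inB) auto
      ultimately show ?thesis by auto
    next
      case False
      then show ?thesis by (intro exI[of _ "\<lambda>x. 0"]) (auto simp: coord_space_def intro: lin_comb.zero)
    qed
  next
    case (add d p q)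
    then obtain p' q' where "lin_comb (B d) p'" "\<forall>x\<in>coord_space J. p x = p' x"
      "lin_comb (B d) q'" "\<forall>x\<in>coord_space J. q x = q' x" by blast
    then show ?case by (intro exI[of _ "\<lambda>x. p' x + q' x"]) (auto intro: lin_comb_add)
  next
    case (mult a p b q)
    then obtain p' q' where pq: "lin_comb (B a) p'" "\<forall>x\<in>coord_space J. p x = p' x"
      "lin_comb (B b) q'" "\<forall>x\<in>coord_space J. q x = q' x" by blast
    have "(\<lambda>(f, g) x. f x * g x) ` (B a \<times> B b) \<subseteq> B (a + b)"
    proof (rule image_subsetI, clarify)
      fix f g assume "f \<in> B a" "g \<in> B b"
      then obtain \<alpha> \<beta> where ab: "f = mono \<alpha>" "g = mono \<beta>" "\<forall>j\<in>J. \<alpha> j \<le> a" "\<forall>j\<in>J. \<beta> j \<le> b"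
        using BE by meson
      then have "(\<lambda>x. f x * g x) = mono (\<lambda>j. \<alpha> j + \<beta> j)"
        by (simp add: mono_def fun_eq_iff power_add prod.distrib)
      then show "(\<lambda>x. f x * g x) \<in> B (a + b)" using ab by (auto intro!: inB add_mono)
    qed
    then have "lin_comb (B (a + b)) (\<lambda>x. p' x * q' x)"
      using lin_comb_mult[OF pq(1,3)] lin_comb_mono by blast
    then show ?case using pq by (intro exI[of _ "\<lambda>x. p' x * q' x"]) auto
  qed
  ultimately show ?thesis unfolding growth_def by (intro exI[of _ 1]) blast
qed

section \<open>Finite projections and Noether normalization\<close>

definition proj_along :: "'n \<Rightarrow> complex ^ 'n \<Rightarrow> complex ^ 'n \<Rightarrow> complex ^ 'n" where
  "proj_along j v x = x - (x $ j / v $ j) *s v"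

lemma pdeg_proj_along: "pdeg 1 (\<lambda>x. proj_along j v x $ i)"
proof -
  have "pdeg (Suc 0) (\<lambda>x. x $ i - (v $ i / v $ j) * x $ j)"
    by (intro pdeg_diff pdeg_cmult pdeg.coord)
  then show ?thesis by (simp add: proj_along_def mult.commute)
qed

lemma proj_along_eq: "x = proj_along j v x + (x $ j / v $ j) *s v"
  by (simp add: proj_along_def)

lemma proj_along_image:
  assumes "Z \<subseteq> coord_space J" "v \<in> coord_space J" "v $ j \<noteq> 0"
  shows "proj_along j v ` Z = coord_space (J - {j}) \<inter> {z. \<exists>t. z + t *s v \<in> Z}"
proof (intro equalityI subsetI)
  fix z assume "z \<in> proj_along j v ` Z"
  then obtain x where x: "x \<in> Z" "z = proj_along j v x" by blast
  have "z + (x $ j / v $ j) *s v = x" using proj_along_eq x by metis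
  moreover have "z \<in> coord_space (J - {j})"
    using x assms by (auto simp: coord_space_def proj_along_def)
  ultimately show "z \<in> coord_space (J - {j}) \<inter> {z. \<exists>t. z + t *s v \<in> Z}"
    using x(1) by (intro IntI CollectI exI[of _ "x $ j / v $ j"]) simp_all
next
  fix z assume "z \<in> coord_space (J - {j}) \<inter> {z. \<exists>t. z + t *s v \<in> Z}"
  then obtain t where t: "z $ j = 0" "z + t *s v \<in> Z" by (auto simp: coord_space_def)
  then have "proj_along j v (z + t *s v) = z" using assms(3) by (simp add: proj_along_def vec_eq_iff)
  then show "z \<in> proj_along j v ` Z" using t by (metis imageI)
qed

lemma algebraic_proj_along:
  assumes "algebraic_set Z" "Z \<subseteq> coord_space J" "v \<in> coord_space J" "v $ j \<noteq> 0" "integral_along Z v D B"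
  shows "algebraic_set (proj_along j v ` Z)"
  unfolding proj_along_image[OF assms(2-4)]
  by (intro algebraic_set_Int algebraic_coord_space algebraic_projection[OF assms(1,5)])

text \<open>By the monic equation every polynomial on \<open>Y\<close> is a combination of the
  powers below \<open>D\<close> of the line parameter, with coefficients pulled back from the
  projection. The reduction raises degrees from \<open>s\<close> to at most
  \<open>s + D * s\<close>, which affects the constant but not the exponent.\<close>

lemma growth_proj_along:
  assumes I: "integral_along Y v D B" and g: "growth (proj_along j v ` Y) k"
  shows "growth Y k"
proof -
  define \<pi> where "\<pi> = proj_along j v"
  define \<tau> where "\<tau> x = x $ j / v $ j" for x
  have eq: "x = \<pi> x + \<tau> x *s v" for x using proj_along_eq by (simp add: \<pi>_def \<tau>_def)
  obtain C where C: "\<forall>s. \<exists>B. finite B \<and> card B \<le> C * (s + 1) ^ k \<and>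
    (\<forall>p. pdeg s p \<longrightarrow> (\<exists>q. lin_comb B q \<and> (\<forall>x\<in>\<pi> ` Y. p x = q x)))" using g by (auto simp: growth_def \<pi>_def)
  obtain a where a: "\<forall>i l. pdeg (D * i) (a i l)"
    "\<forall>i z t. z + t *s v \<in> Y \<longrightarrow> t ^ i = (\<Sum>l<D. a i l z * t ^ l)"
    using choice[of "\<lambda>i a. (\<forall>l. pdeg (D * i) (a l)) \<and> (\<forall>z t. z + t *s v \<in> Y \<longrightarrow> t ^ i = (\<Sum>l<D. a l z * t ^ l))"]
      integral_along_reduce[OF I] by blast
  have "\<exists>A. finite A \<and> card A \<le> D * C * (D + 1) ^ k * (s + 1) ^ k \<and>
    (\<forall>p. pdeg s p \<longrightarrow> (\<exists>q. lin_comb A q \<and> (\<forall>x\<in>Y. p x = q x)))" for s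
  proof -
    obtain B where B: "finite B" "card B \<le> C * ((s + D * s) + 1) ^ k"
      "\<forall>p. pdeg (s + D * s) p \<longrightarrow> (\<exists>q. lin_comb B q \<and> (\<forall>x\<in>\<pi> ` Y. p x = q x))" using C by metis
    define A where "A = (\<lambda>(l, b) x. \<tau> x ^ l * b (\<pi> x)) ` ({..<D} \<times> B)"
    have "card A \<le> D * card B"
      unfolding A_def using card_image_le[of "{..<D} \<times> B" "\<lambda>(l, b) x. \<tau> x ^ l * b (\<pi> x)"] B(1)
      by (simp add: card_cartesian_product)
    also have "\<dots> \<le> D * (C * ((s + D * s) + 1) ^ k)" using B(2) by simp
    also have "\<dots> \<le> D * (C * ((D + 1) * (s + 1)) ^ k)"
      by (intro mult_le_mono2 power_mono) auto
    finally have "card A \<le> D * C * (D + 1) ^ k * (s + 1) ^ k"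
      by (simp only: power_mult_distrib mult.assoc)
    moreover have "finite A" using B(1) by (simp add: A_def)
    moreover have "\<exists>q. lin_comb A q \<and> (\<forall>x\<in>Y. p x = q x)" if p: "pdeg s p" for p
    proof -
      obtain P where P: "\<forall>i. pdeg (s - i) (\<lambda>z. coeff (P z) i)" "\<forall>z i. s < i \<longrightarrow> coeff (P z) i = 0"
        "\<forall>z t. p (z + t *s v) = poly (P z) t" using pdeg_expansion[OF p] by blast
      define e where "e l z = (\<Sum>i\<le>s. coeff (P z) i * a i l z)" for l z
      have "pdeg (s + D * s) (e l)" for l
        unfolding e_def[abs_def]
      proof (rule pdeg_sum)
        fix i assume "i \<in> {..s}"
        then have "D * i \<le> D * s" by simp
        then show "pdeg (s + D * s) (\<lambda>z. coeff (P z) i * a i l z)"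
          by (intro pdeg_mult[OF P(1)[rule_format] a(1)[rule_format]] add_mono) auto
      qed
      then have "\<forall>l. \<exists>q. lin_comb B q \<and> (\<forall>x\<in>\<pi> ` Y. e l x = q x)" using B(3) by blast
      then obtain b where b: "\<forall>l. lin_comb B (b l) \<and> (\<forall>x\<in>\<pi> ` Y. e l x = b l x)" by metis
      have "p x = (\<Sum>l<D. \<tau> x ^ l * b l (\<pi> x))" if x: "x \<in> Y" for x
      proof -
        have xY: "\<pi> x + \<tau> x *s v \<in> Y" using x eq[of x] by simp
        have "p x = poly (P (\<pi> x)) (\<tau> x)" using P(3) eq[of x] by metis
        also have "\<dots> = (\<Sum>i\<le>s. coeff (P (\<pi> x)) i * \<tau> x ^ i)"
          using P(2) by (intro poly_sum_atMost degree_le) auto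
        also have "\<dots> = (\<Sum>i\<le>s. coeff (P (\<pi> x)) i * (\<Sum>l<D. a i l (\<pi> x) * \<tau> x ^ l))"
          using a(2) xY by (intro sum.cong) auto
        also have "\<dots> = (\<Sum>l<D. \<tau> x ^ l * e l (\<pi> x))"
          unfolding e_def sum_distrib_left by (subst sum.swap) (simp add: mult_ac)
        also have "\<dots> = (\<Sum>l<D. \<tau> x ^ l * b l (\<pi> x))" using b x by (intro sum.cong) auto
        finally show ?thesis .
      qed
      moreover have "lin_comb A (\<lambda>x. \<Sum>l<D. \<tau> x ^ l * b l (\<pi> x))"
      proof (rule lin_comb_sum)
        fix l assume l: "l \<in> {..<D}"
        have "lin_comb ((\<lambda>b x. \<tau> x ^ l * b x) ` ((\<lambda>b x. b (\<pi> x)) ` B)) (\<lambda>x. \<tau> x ^ l * b l (\<pi> x))"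
          by (intro lin_comb_mult1 lin_comb_compose) (use b in blast)
        then show "lin_comb A (\<lambda>x. \<tau> x ^ l * b l (\<pi> x))"
          by (rule lin_comb_mono) (use l in \<open>auto simp: A_def\<close>)
      qed
      ultimately show ?thesis by blast
    qed
    ultimately show ?thesis by blast
  qed
  then show ?thesis unfolding growth_def by blast
qed

text \<open>Finiteness of the map is recorded through its consequences: images of algebraic subsets
  are algebraic, fibres are finite, and \<open>X\<close> has the growth of the target.\<close>

definition noether_normalization :: "(complex ^ 'n) set \<Rightarrow> (complex ^ 'n \<Rightarrow> complex ^ 'n) \<Rightarrow> 'n set \<Rightarrow> bool" where
  "noether_normalization X p J \<longleftrightarrow> (\<forall>i. pdeg 1 (\<lambda>x. p x $ i)) \<and> p ` X = coord_space J \<and>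
    (\<forall>Z. Z \<subseteq> X \<and> algebraic_set Z \<longrightarrow> algebraic_set (p ` Z)) \<and>
    (\<forall>z. finite {x\<in>X. p x = z}) \<and> growth X (card J)"

text \<open>As long as \<open>X\<close> is a proper subset of the coordinate subspace, some
  polynomial vanishes on \<open>X\<close> but not on the subspace. It supplies an integral
  direction, and projecting along it removes one coordinate.\<close>

lemma exists_noether_normalization:
  fixes X :: "(complex ^ 'n) set"
  assumes "algebraic_set X" "X \<subseteq> coord_space J" "X \<noteq> {}"
  shows "\<exists>p J'. noether_normalization X p J'"
  using assms
proof (induction "card J" arbitrary: X J rule: less_induct)
  case less
  show ?case
  proof (cases "X = coord_space J")
    case True
    have "noether_normalization X (\<lambda>x. x) J"
      using True growth_coord_space pdeg.coord[of 0] by (auto simp: noether_normalization_def)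
    then show ?thesis by blast
  next
    case False
    then obtain a where a: "a \<in> coord_space J" "a \<notin> X" using less.prems by blast
    then obtain R where R: "complex_polynomial_function R" "\<forall>x\<in>X. R x = 0" "R a \<noteq> 0"
      using less.prems(1) unfolding algebraic_set_def by auto
    obtain x where x: "x \<in> X" using less.prems by blast
    then have "x \<in> coord_space J" "x \<noteq> a" using less.prems a by auto
    then obtain j where "x $ j \<noteq> a $ j" by (auto simp: vec_eq_iff)
    then have j: "j \<in> J" using a(1) \<open>x \<in> coord_space J\<close> unfolding coord_space_def by force
    obtain v D B where v: "v \<in> coord_space J" "v $ j \<noteq> 0" "integral_along X v D B"
      using exists_integral_direction[OF less.prems(2) R(1,2) a(1) R(3) cpf_const[of 1] a(1) _ j] by auto
    define q where "q = proj_along j v"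
    have im: "q ` X = coord_space (J - {j}) \<inter> {z. \<exists>t. z + t *s v \<in> X}"
      unfolding q_def by (rule proj_along_image[OF less.prems(2) v(1,2)])
    have alg: "algebraic_set (q ` Z)" if "Z \<subseteq> X" "algebraic_set Z" for Z
      unfolding q_def using algebraic_proj_along[OF that(2) _ v(1,2) integral_along_subset[OF v(3) that(1)]]
        that(1) less.prems(2) by blast
    have "card (J - {j}) < card J" using card_Diff1_less[OF finite j] .
    then obtain p J' where p: "noether_normalization (q ` X) p J'"
      using less.hyps[of "J - {j}" "q ` X"] alg[OF order_refl less.prems(1)] less.prems(3) im by blast
    have "noether_normalization X (\<lambda>x. p (q x)) J'"
      unfolding noether_normalization_def
    proof (intro conjI allI impI)
      fix i
      have "pdeg (1 * 1) (\<lambda>x. p (q x) $ i)"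
        using p by (intro pdeg_compose) (auto simp: noether_normalization_def q_def pdeg_proj_along[unfolded One_nat_def])
      then show "pdeg 1 (\<lambda>x. p (q x) $ i)" by simp
    next
      show "(\<lambda>x. p (q x)) ` X = coord_space J'"
        using p by (simp add: noether_normalization_def image_image)
    next
      fix Z assume Z: "Z \<subseteq> X \<and> algebraic_set Z"
      then have "algebraic_set (p ` (q ` Z))" using p alg by (simp add: noether_normalization_def image_mono)
      then show "algebraic_set ((\<lambda>x. p (q x)) ` Z)" by (simp add: image_image)
    next
      fix z
      have fib: "finite {x\<in>X. q x = y}" for y
      proof (rule finite_subset)
        show "{x\<in>X. q x = y} \<subseteq> (\<lambda>t. y + t *s v) ` {t. y + t *s v \<in> X}"
        proof clarify
          fix x assume x: "x \<in> X" "y = q x"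
          have "x = q x + (x $ j / v $ j) *s v" unfolding q_def by (rule proj_along_eq)
          then show "x \<in> (\<lambda>t. q x + t *s v) ` {t. q x + t *s v \<in> X}" using x by (intro image_eqI) auto
        qed
        show "finite ((\<lambda>t. y + t *s v) ` {t. y + t *s v \<in> X})" using integral_along_finite[OF v(3)] by blast
      qed
      have "{x\<in>X. p (q x) = z} \<subseteq> (\<Union>y\<in>{y\<in>q ` X. p y = z}. {x\<in>X. q x = y})" by auto
      moreover have "finite (\<Union>y\<in>{y\<in>q ` X. p y = z}. {x\<in>X. q x = y})"
        using p fib by (intro finite_UN_I) (auto simp: noether_normalization_def)
      ultimately show "finite {x\<in>X. p (q x) = z}" by (rule finite_subset)
    next
      show "growth X (card J')"
        using p unfolding noether_normalization_def q_def by (intro growth_proj_along[OF v(3)]) blast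
    qed
    then show ?thesis by blast
  qed
qed

section \<open>Lifting flags of coordinate subspaces to chains of irreducible sets\<close>

lemma coord_space_irreducible:
  assumes "algebraic_set A" "algebraic_set B" "coord_space J = A \<union> B"
  shows "coord_space J = A \<or> coord_space J = B"
proof (rule ccontr)
  assume "\<not> ?thesis"
  then obtain a b where ab: "a \<in> coord_space J" "a \<notin> A" "b \<in> coord_space J" "b \<notin> B" using assms by blast
  obtain f where f: "complex_polynomial_function f" "\<forall>x\<in>A. f x = 0" "f a \<noteq> 0"
    using assms(1) ab unfolding algebraic_set_def by auto
  obtain g where g: "complex_polynomial_function g" "\<forall>x\<in>B. g x = 0" "g b \<noteq> 0"
    using assms(2) ab unfolding algebraic_set_def by auto
  show False using cpf_nonzero_common[OF f(1) g(1) ab(1) f(3) ab(3) g(3)] f g assms(3) by blast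
qed

text \<open>A minimal algebraic set with a given irreducible image is irreducible; finiteness of the
  fibres replaces Noetherianity in the application of Zorn's lemma.\<close>

lemma exists_irreducible_over:
  fixes X :: "(complex ^ 'n) set"
  assumes fin: "\<forall>z. finite {x\<in>X. p x = z}" and clos: "\<forall>Z. Z \<subseteq> X \<and> algebraic_set Z \<longrightarrow> algebraic_set (p ` Z)"
    and Y: "algebraic_set Y" "Y \<subseteq> X" "p ` Y = coord_space J"
  shows "\<exists>Z\<subseteq>Y. irreducible_algebraic_set Z \<and> p ` Z = coord_space J"
proof -
  \<comment> \<open>Passing to complements turns the minimal set that is wanted into a maximal
    one.\<close>
  define \<A> where "\<A> = {U. algebraic_set (- U) \<and> - U \<subseteq> Y \<and> p ` (- U) = coord_space J}"
  have "- Y \<in> \<A>" using Y by (simp add: \<A>_def)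
  then have ne: "\<A> \<noteq> {}" by blast
  have "\<exists>M\<in>\<A>. \<forall>U\<in>\<A>. M \<subseteq> U \<longrightarrow> U = M"
  proof (rule subset_Zorn_nonempty[OF ne])
    fix \<C> assume \<C>: "\<C> \<noteq> {}" "subset.chain \<A> \<C>"
    then have sub: "\<C> \<subseteq> \<A>" and ch: "\<And>U V. U \<in> \<C> \<Longrightarrow> V \<in> \<C> \<Longrightarrow> U \<subseteq> V \<or> V \<subseteq> U"
      by (auto simp: subset_chain_def)
    obtain U1 where U1: "U1 \<in> \<C>" using \<C> by blast
    have "- \<Union>\<C> = (\<Inter>U\<in>\<C>. - U)" by auto
    moreover have "algebraic_set (\<Inter>U\<in>\<C>. - U)" by (rule algebraic_set_INT) (use sub in \<open>auto simp: \<A>_def\<close>)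
    moreover have "- \<Union>\<C> \<subseteq> Y" using U1 sub by (auto simp: \<A>_def)
    moreover have "p ` (- \<Union>\<C>) = coord_space J"
    proof (intro equalityI subsetI)
      fix e assume e: "e \<in> coord_space J"
      define F where "F U = {x\<in>- U. p x = e}" for U
      have F: "finite (F U)" "F U \<noteq> {}" if U: "U \<in> \<C>" for U
      proof -
        have "F U \<subseteq> {x\<in>X. p x = e}" using U sub Y(2) by (auto simp: F_def \<A>_def)
        then show "finite (F U)" using fin finite_subset by blast
        have "e \<in> p ` (- U)" using U sub e by (auto simp: \<A>_def)
        then show "F U \<noteq> {}" by (auto simp: F_def)
      qed
      \<comment> \<open>Along the chain the fibres over \<open>e\<close> are finite, nonempty and
        nested, so a fibre of least cardinality is contained in all the others.\<close>
      obtain U0 where U0: "U0 \<in> \<C>" "\<And>U. U \<in> \<C> \<Longrightarrow> card (F U0) \<le> card (F U)"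
        using ex_has_least_nat[of "\<lambda>U. U \<in> \<C>" U1 "\<lambda>U. card (F U)"] U1 by auto
      have le: "F U0 \<subseteq> F U" if U: "U \<in> \<C>" for U
      proof (cases "U \<subseteq> U0")
        case True then show ?thesis by (auto simp: F_def)
      next
        case False
        then have "F U \<subseteq> F U0" using ch[OF U U0(1)] by (auto simp: F_def)
        then have "F U = F U0" using card_seteq F U0 U by metis
        then show ?thesis by simp
      qed
      obtain x where "x \<in> F U0" using F U0 by blast
      then have "x \<in> - \<Union>\<C>" "p x = e" using le by (auto simp: F_def)
      then show "e \<in> p ` (- \<Union>\<C>)" by blast
    next
      fix e assume "e \<in> p ` (- \<Union>\<C>)"
      then have "e \<in> p ` (- U1)" using U1 by blast
      then show "e \<in> coord_space J" using U1 sub by (auto simp: \<A>_def)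
    qed
    ultimately show "\<Union>\<C> \<in> \<A>" by (simp add: \<A>_def)
  qed
  then obtain M where M: "M \<in> \<A>" "\<forall>U\<in>\<A>. M \<subseteq> U \<longrightarrow> U = M" by blast
  define Z where "Z = - M"
  have Z: "algebraic_set Z" "Z \<subseteq> Y" "p ` Z = coord_space J" using M by (auto simp: Z_def \<A>_def)
  have min: "A = Z" if "algebraic_set A" "A \<subseteq> Z" "p ` A = coord_space J" for A
  proof -
    have "- A \<in> \<A>" using that Z by (auto simp: \<A>_def)
    then show ?thesis using M that by (auto simp: Z_def)
  qed
  have "0 \<in> coord_space J" by (simp add: coord_space_def)
  then have "Z \<noteq> {}" using Z(3) by blast
  moreover have "Z = A \<or> Z = B" if AB: "algebraic_set A" "algebraic_set B" "Z = A \<union> B" for A B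
  proof -
    have "algebraic_set (p ` A)" "algebraic_set (p ` B)" using clos AB Z Y by auto
    moreover have "coord_space J = p ` A \<union> p ` B" using Z AB by blast
    ultimately have "coord_space J = p ` A \<or> coord_space J = p ` B" by (rule coord_space_irreducible)
    then show ?thesis using min AB by blast
  qed
  ultimately have "irreducible_algebraic_set Z" using Z by (auto simp: irreducible_algebraic_set_def)
  then show ?thesis using Z by blast
qed

text \<open>In an irreducible set over the larger coordinate subspace, the part lying over the
  smaller subspace is algebraic, proper, and still maps onto it. The chain found inside that part is
  continued by the irreducible set.\<close>

lemma exists_chain_over:
  fixes X :: "(complex ^ 'n) set"
  assumes fin: "\<forall>z. finite {x\<in>X. p x = z}" and clos: "\<forall>Z. Z \<subseteq> X \<and> algebraic_set Z \<longrightarrow> algebraic_set (p ` Z)"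
    and pol: "\<forall>i. pdeg 1 (\<lambda>x. p x $ i)"
    and J: "finite J" and Y: "algebraic_set Y" "Y \<subseteq> X" "p ` Y = coord_space J"
  shows "\<exists>Z. irreducible_chain Y (card J) Z"
  using J Y
proof (induction J arbitrary: Y rule: finite_induct)
  case empty
  obtain Z where "Z \<subseteq> Y" "irreducible_algebraic_set Z" using exists_irreducible_over[OF fin clos empty.prems] by blast
  then show ?case by (intro exI[of _ "\<lambda>_. Z"]) (auto simp: irreducible_chain_def)
next
  case (insert j J)
  obtain Z where Z: "Z \<subseteq> Y" "irreducible_algebraic_set Z" "p ` Z = coord_space (insert j J)"
    using exists_irreducible_over[OF fin clos insert.prems] by blast
  define Y' where "Y' = Z \<inter> {x. p x \<in> coord_space J}"
  have "algebraic_set Y'" unfolding Y'_def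
    using Z(2) pol by (intro algebraic_set_Int algebraic_set_vimage algebraic_coord_space)
      (auto simp: irreducible_algebraic_set_def intro: pdeg_imp_cpf)
  moreover have "Y' \<subseteq> X" using Z insert.prems by (auto simp: Y'_def)
  moreover have sub: "coord_space J \<subseteq> coord_space (insert j J)" by (auto simp: coord_space_def)
  have pY': "p ` Y' = coord_space J"
  proof (intro equalityI subsetI)
    fix e assume e: "e \<in> coord_space J"
    then have "e \<in> p ` Z" using sub Z by blast
    then show "e \<in> p ` Y'" using e by (auto simp: Y'_def)
  qed (auto simp: Y'_def)
  ultimately obtain C where C: "irreducible_chain Y' (card J) C" using insert.IH by blast
  define C' where "C' i = (if i \<le> card J then C i else Z)" for i
  have "axis j 1 \<in> coord_space (insert j J)" "axis j (1::complex) \<notin> coord_space J"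
    using insert.hyps by (auto simp: coord_space_def axis_def)
  then have "p ` Y' \<noteq> p ` Z" using Z pY' by metis
  then have "Y' \<subset> Z" by (auto simp: Y'_def)
  have "irreducible_chain Y (Suc (card J)) C'"
    unfolding irreducible_chain_def
  proof (intro conjI allI impI)
    fix i assume "i \<le> Suc (card J)"
    have "irreducible_algebraic_set (C' i) \<and> C' i \<subseteq> Z"
      using C Z(2) \<open>Y' \<subset> Z\<close> unfolding C'_def irreducible_chain_def by (cases "i \<le> card J") force+
    then show "irreducible_algebraic_set (C' i)" "C' i \<subseteq> Y" using Z(1) by auto
  next
    fix i assume "i < Suc (card J)"
    then show "C' i \<subset> C' (Suc i)"
    proof (cases "i = card J")
      case True
      have "C i \<subseteq> Y'" using C True by (simp add: irreducible_chain_def)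
      then show ?thesis using True \<open>Y' \<subset> Z\<close> by (auto simp: C'_def)
    next
      case False
      then have "i < card J" using \<open>i < Suc (card J)\<close> by simp
      then show ?thesis using C unfolding C'_def irreducible_chain_def by simp
    qed
  qed
  then show ?case using insert.hyps by auto
qed

text \<open>The chain lifted through a Noether normalization has length \<open>card J\<close>, so
  \<open>card J\<close> is at most the Krull dimension \<open>k\<close>; the growth exponent
  \<open>card J\<close> can then be raised to \<open>k\<close>.\<close>

theorem algebraic_dim_growth:
  assumes "algebraic_set X" "has_algebraic_dim X k"
  shows "growth X k" "X \<noteq> {}"
proof -
  show ne: "X \<noteq> {}"
    using assms(2) by (auto simp: has_algebraic_dim_def irreducible_chain_def irreducible_algebraic_set_def)
  have "X \<subseteq> coord_space UNIV" by (simp add: coord_space_def)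
  then obtain p J where "noether_normalization X p J"
    using exists_noether_normalization[OF assms(1) _ ne] by blast
  then have p: "\<forall>i. pdeg 1 (\<lambda>x. p x $ i)" "p ` X = coord_space J"
    "\<forall>Z. Z \<subseteq> X \<and> algebraic_set Z \<longrightarrow> algebraic_set (p ` Z)"
    "\<forall>z. finite {x\<in>X. p x = z}" "growth X (card J)" by (auto simp: noether_normalization_def)
  have "\<exists>Z. irreducible_chain X (card J) Z"
    using exists_chain_over[OF p(4,3,1) _ assms(1) _ p(2)] by auto
  then have "card J \<le> k" using assms(2) by (auto simp: has_algebraic_dim_def)
  then show "growth X k" using p(5) growth_mono_exponent by blast
qed

section \<open>Existence of embeddings\<close>

lemma underdetermined_linear_system:
  fixes c :: "'k \<Rightarrow> 'b \<Rightarrow> complex"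
  assumes "finite B" "finite K" "card B < card K"
  shows "\<exists>l. (\<exists>\<kappa>\<in>K. l \<kappa> \<noteq> 0) \<and> (\<forall>b\<in>B. (\<Sum>\<kappa>\<in>K. l \<kappa> * c \<kappa> b) = 0)"
  using assms
proof (induction B arbitrary: K c rule: finite_induct)
  case empty
  then obtain \<kappa> where "\<kappa> \<in> K" by fastforce
  then show ?case by (intro exI[of _ "\<lambda>_. 1"]) auto
next
  case (insert b B)
  show ?case
  proof (cases "\<forall>\<kappa>\<in>K. c \<kappa> b = 0")
    case True
    have "card B < card K" using insert by simp
    then obtain l where "\<exists>\<kappa>\<in>K. l \<kappa> \<noteq> 0" "\<forall>b\<in>B. (\<Sum>\<kappa>\<in>K. l \<kappa> * c \<kappa> b) = 0"
      using insert.IH[OF insert.prems(1)] by blast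
    then show ?thesis using True by (intro exI[of _ l]) auto
  next
    case False
    then obtain k where k: "k \<in> K" "c k b \<noteq> 0" by blast
    define c' where "c' \<kappa> b' = c \<kappa> b' - c \<kappa> b / c k b * c k b'" for \<kappa> b'
    have "card B < card (K - {k})" using insert k by simp
    then obtain l where l: "\<exists>\<kappa>\<in>K - {k}. l \<kappa> \<noteq> 0" "\<forall>b\<in>B. (\<Sum>\<kappa>\<in>K - {k}. l \<kappa> * c' \<kappa> b) = 0"
      using insert.IH[of "K - {k}" c'] insert.prems(1) by blast
    define m where "m = l(k := - (\<Sum>\<kappa>\<in>K - {k}. l \<kappa> * (c \<kappa> b / c k b)))"
    have S: "(\<Sum>\<kappa>\<in>K. m \<kappa> * c \<kappa> b') = (\<Sum>\<kappa>\<in>K - {k}. l \<kappa> * c' \<kappa> b')" for b'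
    proof -
      have "(\<Sum>\<kappa>\<in>K. m \<kappa> * c \<kappa> b') = m k * c k b' + (\<Sum>\<kappa>\<in>K - {k}. m \<kappa> * c \<kappa> b')"
        using k insert.prems by (simp add: sum.remove)
      also have "(\<Sum>\<kappa>\<in>K - {k}. m \<kappa> * c \<kappa> b') = (\<Sum>\<kappa>\<in>K - {k}. l \<kappa> * c \<kappa> b')"
        by (intro sum.cong) (auto simp: m_def)
      also have "m k * c k b' = - (\<Sum>\<kappa>\<in>K - {k}. l \<kappa> * (c \<kappa> b / c k b * c k b'))"
        by (simp add: m_def sum_distrib_right mult.assoc)
      finally show ?thesis by (simp add: c'_def right_diff_distrib sum_subtractf)
    qed
    have "(\<Sum>\<kappa>\<in>K. m \<kappa> * c \<kappa> b) = 0" unfolding S using k by (simp add: c'_def)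
    moreover have "\<exists>\<kappa>\<in>K. m \<kappa> \<noteq> 0" using l(1) by (auto simp: m_def)
    ultimately show ?thesis using S l(2) by (intro exI[of _ m]) auto
  qed
qed

text \<open>One variable at a time: suitable values for the old variables leave a nonzero polynomial
  in the new one, which has only finitely many roots.\<close>

lemma monomials_independent:
  fixes J :: "'i::finite set" and c :: "('i \<Rightarrow> nat) \<Rightarrow> complex"
  assumes "finite J" "\<exists>\<alpha>\<in>PiE J (\<lambda>_. {..s}). c \<alpha> \<noteq> 0"
  shows "\<exists>a\<in>coord_space J. (\<Sum>\<alpha>\<in>PiE J (\<lambda>_. {..s}). c \<alpha> * (\<Prod>j\<in>J. a $ j ^ \<alpha> j)) \<noteq> 0"
  using assms
proof (induction J arbitrary: c rule: finite_induct)
  case empty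
  have "0 \<in> coord_space {}" by (simp add: coord_space_def)
  then show ?case using empty by (intro bexI[of _ 0]) auto
next
  case (insert j J)
  obtain y0 g0 where 0: "y0 \<le> s" "g0 \<in> PiE J (\<lambda>_. {..s})" "c (g0(j := y0)) \<noteq> 0"
    using insert.prems unfolding PiE_insert_eq by auto
  obtain a where a: "a \<in> coord_space J"
    "(\<Sum>g\<in>PiE J (\<lambda>_. {..s}). c (g(j := y0)) * (\<Prod>i\<in>J. a $ i ^ g i)) \<noteq> 0"
    using insert.IH[of "\<lambda>g. c (g(j := y0))"] 0 by blast
  define P where "P = (\<Sum>y\<le>s. monom (\<Sum>g\<in>PiE J (\<lambda>_. {..s}). c (g(j := y)) * (\<Prod>i\<in>J. a $ i ^ g i)) y)"
  have "coeff P y0 \<noteq> 0" using a 0 by (simp add: P_def coeff_sum)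
  then have "P \<noteq> 0" by auto
  then have "finite {t. poly P t = 0}" by (rule poly_roots_finite)
  then obtain t where t: "poly P t \<noteq> 0"
    using infinite_UNIV_char_0 by (metis (mono_tags, lifting) UNIV_eq_I mem_Collect_eq)
  define a' where "a' = (\<chi> i. if i = j then t else a $ i)"
  have "a' \<in> coord_space (insert j J)" using a by (auto simp: coord_space_def a'_def)
  moreover have "(\<Sum>\<alpha>\<in>PiE (insert j J) (\<lambda>_. {..s}). c \<alpha> * (\<Prod>i\<in>insert j J. a' $ i ^ \<alpha> i)) = poly P t"
  proof -
    have inj: "inj_on (\<lambda>(y, g). g(j := y)) ({..s} \<times> PiE J (\<lambda>_. {..s}))"
      using insert.hyps(2) by (intro inj_combinator)
    have "(\<Sum>\<alpha>\<in>PiE (insert j J) (\<lambda>_. {..s}). c \<alpha> * (\<Prod>i\<in>insert j J. a' $ i ^ \<alpha> i)) =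
      (\<Sum>(y, g)\<in>{..s} \<times> PiE J (\<lambda>_. {..s}). c (g(j := y)) * (\<Prod>i\<in>insert j J. a' $ i ^ (g(j := y)) i))"
      unfolding PiE_insert_eq by (subst sum.reindex[OF inj]) (simp add: case_prod_unfold)
    also have "\<dots> = (\<Sum>(y, g)\<in>{..s} \<times> PiE J (\<lambda>_. {..s}). c (g(j := y)) * (\<Prod>i\<in>J. a $ i ^ g i) * t ^ y)"
    proof (intro sum.cong refl, clarify)
      fix y g
      have "(\<Prod>i\<in>J. a' $ i ^ (g(j := y)) i) = (\<Prod>i\<in>J. a $ i ^ g i)"
        using insert.hyps by (intro prod.cong) (auto simp: a'_def)
      then show "c (g(j := y)) * (\<Prod>i\<in>insert j J. a' $ i ^ (g(j := y)) i) =
          c (g(j := y)) * (\<Prod>i\<in>J. a $ i ^ g i) * t ^ y"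
        using insert.hyps by (simp add: a'_def)
    qed
    also have "\<dots> = poly P t"
      by (simp add: P_def poly_sum poly_monom sum.cartesian_product[symmetric] sum_distrib_right)
    finally show ?thesis .
  qed
  ultimately show ?case using t by metis
qed

lemma polynomial_power_bound:
  fixes C D K d :: nat
  assumes "K < d"
  shows "\<exists>s. C * (s * D + 1) ^ K < (s + 1) ^ d"
proof -
  \<comment> \<open>With this choice the constant factor becomes \<open>s\<close> itself, and one
    additional power of \<open>s + 1\<close> outweighs it.\<close>
  define s where "s = C * (D + 1) ^ K"
  have "C * (s * D + 1) ^ K \<le> C * ((D + 1) * (s + 1)) ^ K"
    by (intro mult_le_mono2 power_mono) auto
  also have "\<dots> = s * (s + 1) ^ K" by (simp only: s_def power_mult_distrib mult.assoc)
  also have "\<dots> < (s + 1) * (s + 1) ^ K" by simp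
  also have "\<dots> = (s + 1) ^ Suc K" by simp
  also have "\<dots> \<le> (s + 1) ^ d" using assms by (intro power_increasing) auto
  finally show ?thesis by blast
qed

text \<open>The image of a rational map from a set of dimension \<open>K\<close> into a space of larger dimension
  lies in a hypersurface: there are more monomials than functions on the source.\<close>

theorem rational_image_in_hypersurface:
  fixes Z :: "(complex ^ 'z) set" and J :: "'i::finite set"
  assumes g: "growth Z K" and p: "\<And>j. pdeg e (p j)" and w: "pdeg e w" and J: "K < card J"
  shows "\<exists>Q. complex_polynomial_function Q \<and> (\<exists>a\<in>coord_space J. Q a \<noteq> 0) \<and>
    (\<forall>z\<in>Z. w z \<noteq> 0 \<longrightarrow> (\<forall>x. (\<forall>j\<in>J. x $ j = p j z / w z) \<longrightarrow> Q x = 0))"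
proof -
  define d where "d = card J"
  obtain C where C: "\<forall>s. \<exists>B. finite B \<and> card B \<le> C * (s + 1) ^ K \<and>
    (\<forall>p. pdeg s p \<longrightarrow> (\<exists>q. lin_comb B q \<and> (\<forall>x\<in>Z. p x = q x)))" using g by (auto simp: growth_def)
  obtain s where s: "C * (s * (d * e) + 1) ^ K < (s + 1) ^ d"
    using polynomial_power_bound J unfolding d_def by blast
  obtain B where B: "finite B" "card B \<le> C * (s * (d * e) + 1) ^ K"
    "\<forall>p. pdeg (s * (d * e)) p \<longrightarrow> (\<exists>q. lin_comb B q \<and> (\<forall>x\<in>Z. p x = q x))" using C by metis
  define A where "A = PiE J (\<lambda>_. {..s})"
  have fA: "finite A" unfolding A_def by (intro finite_PiE) auto
  have cA: "card A = (s + 1) ^ d" by (simp add: A_def card_PiE d_def)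
  \<comment> \<open>The monomial \<open>\<alpha>\<close> evaluated at the rational map and
    multiplied by \<open>w z ^ (s * d)\<close>. Since \<open>s * d\<close> is the largest possible
    total exponent, all denominators are cleared at once.\<close>
  define F where "F \<alpha> z = (\<Prod>j\<in>J. p j z ^ \<alpha> j) * w z ^ (s * d - (\<Sum>j\<in>J. \<alpha> j))" for \<alpha> z
  have le: "(\<Sum>j\<in>J. \<alpha> j) \<le> s * d" if "\<alpha> \<in> A" for \<alpha>
    using sum_bounded_above[of J \<alpha> s] that by (auto simp: A_def d_def mult.commute)
  have "pdeg (s * (d * e)) (F \<alpha>)" if "\<alpha> \<in> A" for \<alpha>
  proof -
    have "pdeg (\<Sum>j\<in>J. \<alpha> j * e) (\<lambda>z. \<Prod>j\<in>J. p j z ^ \<alpha> j)" by (intro pdeg_prod pdeg_power p)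
    moreover have "(\<Sum>j\<in>J. \<alpha> j * e) + (s * d - (\<Sum>j\<in>J. \<alpha> j)) * e = s * (d * e)"
      using le[OF that] by (simp add: sum_distrib_right[symmetric] add_mult_distrib[symmetric])
    ultimately show ?thesis
      unfolding F_def[abs_def] by (intro pdeg_mult[OF _ pdeg_power[OF w]]) auto
  qed
  then have "\<forall>\<alpha>\<in>A. \<exists>c. \<forall>z\<in>Z. F \<alpha> z = (\<Sum>b\<in>B. c b * b z)"
    using B(3) lin_comb_finite[OF _ B(1)] by metis
  then obtain c where c: "\<And>\<alpha> z. \<alpha> \<in> A \<Longrightarrow> z \<in> Z \<Longrightarrow> F \<alpha> z = (\<Sum>b\<in>B. c \<alpha> b * b z)" by metis
  \<comment> \<open>There are more exponents \<open>\<alpha>\<close> than spanning functions in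
    \<open>B\<close>, so a nontrivial combination of the \<open>F \<alpha>\<close> vanishes on
    \<open>Z\<close>; its coefficients are those of \<open>Q\<close>.\<close>
  obtain l where l: "\<exists>\<alpha>\<in>A. l \<alpha> \<noteq> 0" "\<forall>b\<in>B. (\<Sum>\<alpha>\<in>A. l \<alpha> * c \<alpha> b) = 0"
    using underdetermined_linear_system[OF B(1) fA, of c] B(2) s cA by auto
  define Q where "Q x = (\<Sum>\<alpha>\<in>A. l \<alpha> * (\<Prod>j\<in>J. x $ j ^ \<alpha> j))" for x
  have "complex_polynomial_function Q"
    unfolding Q_def[abs_def] by (intro cpf_sum cpf_mult cpf_const cpf_prod cpf_power cpf_coord)
  moreover have "\<exists>a\<in>coord_space J. Q a \<noteq> 0"
    unfolding Q_def A_def using l(1) by (intro monomials_independent) (auto simp: A_def)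
  moreover have "Q x = 0" if z: "z \<in> Z" "w z \<noteq> 0" and x: "\<forall>j\<in>J. x $ j = p j z / w z" for z x
  proof -
    have "w z ^ (s * d) * (\<Prod>j\<in>J. x $ j ^ \<alpha> j) = F \<alpha> z" if "\<alpha> \<in> A" for \<alpha>
    proof -
      have "(\<Prod>j\<in>J. x $ j ^ \<alpha> j) = (\<Prod>j\<in>J. p j z ^ \<alpha> j / w z ^ \<alpha> j)"
        using x by (intro prod.cong) (auto simp: power_divide)
      also have "\<dots> = (\<Prod>j\<in>J. p j z ^ \<alpha> j) / w z ^ (\<Sum>j\<in>J. \<alpha> j)" by (simp add: prod_dividef power_sum)
      finally show ?thesis using le[OF that] z(2) by (simp add: F_def power_diff)
    qed
    then have "w z ^ (s * d) * Q x = (\<Sum>\<alpha>\<in>A. l \<alpha> * F \<alpha> z)"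
      unfolding Q_def sum_distrib_left by (intro sum.cong) (auto simp: mult.left_commute)
    also have "\<dots> = (\<Sum>\<alpha>\<in>A. l \<alpha> * (\<Sum>b\<in>B. c \<alpha> b * b z))" using c z by (intro sum.cong) auto
    also have "\<dots> = (\<Sum>b\<in>B. (\<Sum>\<alpha>\<in>A. l \<alpha> * c \<alpha> b) * b z)"
      unfolding sum_distrib_left sum_distrib_right by (subst sum.swap) (simp add: mult.assoc)
    also have "\<dots> = 0" using l(2) by simp
    finally show ?thesis using z by simp
  qed
  ultimately show ?thesis by blast
qed

section \<open>Growth of products and images\<close>

definition vec_Inl :: "complex ^ ('a::finite + 'b::finite) \<Rightarrow> complex ^ 'a" where "vec_Inl z = (\<chi> i. z $ Inl i)"
definition vec_Inr :: "complex ^ ('a::finite + 'b::finite) \<Rightarrow> complex ^ 'b" where "vec_Inr z = (\<chi> i. z $ Inr i)"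
definition vec_pair :: "complex ^ 'a::finite \<Rightarrow> complex ^ 'b::finite \<Rightarrow> complex ^ ('a + 'b)" where
  "vec_pair x y = (\<chi> i. case i of Inl a \<Rightarrow> x $ a | Inr b \<Rightarrow> y $ b)"

lemma vec_pair_simps [simp]: "vec_Inl (vec_pair x y) = x" "vec_Inr (vec_pair x y) = y"
  by (simp_all add: vec_Inl_def vec_Inr_def vec_pair_def vec_eq_iff)

definition vec_Times :: "(complex ^ 'a::finite) set \<Rightarrow> (complex ^ 'b::finite) set \<Rightarrow> (complex ^ ('a + 'b)) set" where
  "vec_Times A B = {z. vec_Inl z \<in> A \<and> vec_Inr z \<in> B}"

lemma pdeg_vec_Inl:
  assumes "pdeg d p"
  shows "pdeg d (\<lambda>z. p (vec_Inl z))"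
proof -
  have "pdeg (d * 1) (\<lambda>z. p (vec_Inl z))"
    by (rule pdeg_compose[OF assms]) (use pdeg.coord[of 0] in \<open>simp add: vec_Inl_def\<close>)
  then show ?thesis by simp
qed

lemma pdeg_vec_Inr:
  assumes "pdeg d p"
  shows "pdeg d (\<lambda>z. p (vec_Inr z))"
proof -
  have "pdeg (d * 1) (\<lambda>z. p (vec_Inr z))"
    by (rule pdeg_compose[OF assms]) (use pdeg.coord[of 0] in \<open>simp add: vec_Inr_def\<close>)
  then show ?thesis by simp
qed

definition split_products :: "nat \<Rightarrow> (complex ^ ('a::finite + 'b::finite) \<Rightarrow> complex) set" where
  "split_products s = {h. \<exists>f g. h = (\<lambda>z. f (vec_Inl z) * g (vec_Inr z)) \<and> pdeg s f \<and> pdeg s g}"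

lemma split_productsI:
  "pdeg s f \<Longrightarrow> pdeg s g \<Longrightarrow> h = (\<lambda>z. f (vec_Inl z) * g (vec_Inr z)) \<Longrightarrow> h \<in> split_products s"
  by (auto simp: split_products_def)

lemma pdeg_split_product:
  fixes p :: "complex ^ ('a::finite + 'b::finite) \<Rightarrow> complex"
  assumes "pdeg s p"
  shows "lin_comb (split_products s) p"
  using assms
proof induction
  case (const d c)
  show ?case
    by (rule lin_comb_base, rule split_productsI[of _ "\<lambda>_. c" "\<lambda>_. 1"]) (simp_all add: pdeg.const)
next
  case (coord d i)
  show ?case
  proof (cases i)
    case (Inl a)
    show ?thesis
      by (rule lin_comb_base, rule split_productsI[of _ "\<lambda>x. x $ a" "\<lambda>_. 1"])
         (simp_all add: pdeg.const pdeg.coord vec_Inl_def Inl)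
  next
    case (Inr b)
    show ?thesis
      by (rule lin_comb_base, rule split_productsI[of _ "\<lambda>_. 1" "\<lambda>x. x $ b"])
         (simp_all add: pdeg.const pdeg.coord vec_Inr_def Inr)
  qed
next
  case (add d p q)
  show ?case by (rule lin_comb_add[OF add.IH(2,1)])
next
  case (mult a p b q)
  have "(\<lambda>(f, g) x. f x * g x) ` (split_products a \<times> split_products b) \<subseteq>
    (split_products (a + b) :: (complex ^ ('a + 'b) \<Rightarrow> complex) set)"
  proof (rule image_subsetI, clarify)
    fix F G :: "complex ^ ('a + 'b) \<Rightarrow> complex"
    assume "F \<in> split_products a" "G \<in> split_products b"
    then obtain f g f' g' where fg: "F = (\<lambda>z. f (vec_Inl z) * g (vec_Inr z))" "pdeg a f" "pdeg a g"
      "G = (\<lambda>z. f' (vec_Inl z) * g' (vec_Inr z))" "pdeg b f'" "pdeg b g'"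
      unfolding split_products_def by blast
    show "(\<lambda>x. F x * G x) \<in> split_products (a + b)"
      by (rule split_productsI[OF pdeg.mult[OF fg(2,5)] pdeg.mult[OF fg(3,6)]])
         (simp add: fg(1,4) mult_ac)
  qed
  with lin_comb_mult[OF mult.IH] show ?case by (rule lin_comb_mono)
qed

lemma lin_comb_trans:
  assumes "lin_comb B f" "\<forall>b\<in>B. \<exists>q. lin_comb A q \<and> (\<forall>x\<in>X. b x = q x)"
  shows "\<exists>q. lin_comb A q \<and> (\<forall>x\<in>X. f x = q x)"
  using assms(1)
proof induction
  case zero
  show ?case by (intro exI[of _ "\<lambda>x. 0"]) (auto intro: lin_comb.zero)
next
  case (step f b c)
  then obtain q where q: "lin_comb A q" "\<forall>x\<in>X. f x = q x" by blast
  obtain r where r: "lin_comb A r" "\<forall>x\<in>X. b x = r x" using assms(2) step.hyps by blast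
  show ?case using q r by (intro exI[of _ "\<lambda>x. q x + c * r x"]) (auto intro: lin_comb_add lin_comb_cmult)
qed

text \<open>Polynomials on the product are spanned by products of a polynomial from each factor, so
  the sizes of spanning sets multiply and the exponents add.\<close>

lemma growth_vec_Times:
  assumes "growth X a" "growth Y b"
  shows "growth (vec_Times X Y) (a + b)"
proof -
  obtain C where C: "\<forall>s. \<exists>B. finite B \<and> card B \<le> C * (s + 1) ^ a \<and>
    (\<forall>p. pdeg s p \<longrightarrow> (\<exists>q. lin_comb B q \<and> (\<forall>x\<in>X. p x = q x)))" using assms(1) by (auto simp: growth_def)
  obtain D where D: "\<forall>s. \<exists>B. finite B \<and> card B \<le> D * (s + 1) ^ b \<and>
    (\<forall>p. pdeg s p \<longrightarrow> (\<exists>q. lin_comb B q \<and> (\<forall>x\<in>Y. p x = q x)))" using assms(2) by (auto simp: growth_def)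
  have "\<exists>A. finite A \<and> card A \<le> C * D * (s + 1) ^ (a + b) \<and>
    (\<forall>p. pdeg s p \<longrightarrow> (\<exists>q. lin_comb A q \<and> (\<forall>x\<in>vec_Times X Y. p x = q x)))" for s
  proof -
    obtain A where A: "finite A" "card A \<le> C * (s + 1) ^ a"
      "\<forall>p. pdeg s p \<longrightarrow> (\<exists>q. lin_comb A q \<and> (\<forall>x\<in>X. p x = q x))" using C by blast
    obtain B where B: "finite B" "card B \<le> D * (s + 1) ^ b"
      "\<forall>p. pdeg s p \<longrightarrow> (\<exists>q. lin_comb B q \<and> (\<forall>x\<in>Y. p x = q x))" using D by blast
    define A' where "A' = (\<lambda>f (z :: complex ^ ('a + 'b)). f (vec_Inl z)) ` A"
    define B' where "B' = (\<lambda>f (z :: complex ^ ('a + 'b)). f (vec_Inr z)) ` B"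
    define G where "G = (\<lambda>(f, g) x. f x * g x) ` (A' \<times> B')"
    have f: "finite A'" "finite B'" using A(1) B(1) by (simp_all add: A'_def B'_def)
    have "card G \<le> card A' * card B'"
      unfolding G_def using card_image_le[of "A' \<times> B'" "\<lambda>(f, g) x. f x * g x"] f by (simp add: card_cartesian_product)
    also have "\<dots> \<le> card A * card B" using A(1) B(1) by (intro mult_le_mono) (auto simp: A'_def B'_def card_image_le)
    also have "\<dots> \<le> (C * (s + 1) ^ a) * (D * (s + 1) ^ b)" using A(2) B(2) by (rule mult_le_mono)
    finally have "card G \<le> C * D * (s + 1) ^ (a + b)" by (simp add: power_add mult_ac)
    moreover have "finite G" using f by (simp add: G_def)
    moreover have "\<exists>q. lin_comb G q \<and> (\<forall>x\<in>vec_Times X Y. p x = q x)" if p: "pdeg s p" for p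
    proof (rule lin_comb_trans[OF pdeg_split_product[OF p]], rule ballI)
      fix h :: "complex ^ ('a + 'b) \<Rightarrow> complex"
      assume "h \<in> split_products s"
      then obtain f g where h: "h = (\<lambda>z. f (vec_Inl z) * g (vec_Inr z))" "pdeg s f" "pdeg s g"
        unfolding split_products_def by blast
      obtain f' where f': "lin_comb A f'" "\<forall>x\<in>X. f x = f' x" using A(3) h(2) by blast
      obtain g' where g': "lin_comb B g'" "\<forall>x\<in>Y. g x = g' x" using B(3) h(3) by blast
      have "lin_comb G (\<lambda>z. f' (vec_Inl z) * g' (vec_Inr z))"
        unfolding G_def A'_def B'_def by (intro lin_comb_mult lin_comb_compose f' g')
      then show "\<exists>q. lin_comb G q \<and> (\<forall>x\<in>vec_Times X Y. h x = q x)"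
        using f' g' h(1) by (intro exI[of _ "\<lambda>z. f' (vec_Inl z) * g' (vec_Inr z)"]) (auto simp: vec_Times_def)
    qed
    ultimately show ?thesis by blast
  qed
  then show ?thesis unfolding growth_def by blast
qed

text \<open>Pulling back along \<open>f\<close> does not raise degrees, and \<open>inv_into\<close>
  carries the spanning functions from \<open>X\<close> to its image. These functions are allowed to
  be arbitrary, so a choice of preimages does no harm.\<close>

lemma growth_image:
  assumes g: "growth X k" and f: "\<And>i. pdeg 1 (\<lambda>x. f x $ i)"
  shows "growth (f ` X) k"
proof -
  obtain C where C: "\<forall>s. \<exists>B. finite B \<and> card B \<le> C * (s + 1) ^ k \<and>
    (\<forall>p. pdeg s p \<longrightarrow> (\<exists>q. lin_comb B q \<and> (\<forall>x\<in>X. p x = q x)))" using g by (auto simp: growth_def)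
  have "\<exists>A. finite A \<and> card A \<le> C * (s + 1) ^ k \<and>
    (\<forall>p. pdeg s p \<longrightarrow> (\<exists>q. lin_comb A q \<and> (\<forall>x\<in>f ` X. p x = q x)))" for s
  proof -
    obtain B where B: "finite B" "card B \<le> C * (s + 1) ^ k"
      "\<forall>p. pdeg s p \<longrightarrow> (\<exists>q. lin_comb B q \<and> (\<forall>x\<in>X. p x = q x))" using C by blast
    define A where "A = (\<lambda>b y. b (inv_into X f y)) ` B"
    have "finite A" "card A \<le> C * (s + 1) ^ k"
      using B card_image_le[of B "\<lambda>b y. b (inv_into X f y)"] by (auto simp: A_def)
    moreover have "\<exists>q. lin_comb A q \<and> (\<forall>y\<in>f ` X. p y = q y)" if p: "pdeg s p" for p
    proof -
      have "pdeg s (\<lambda>x. p (f x))" using pdeg_compose[OF p f] by simp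
      then obtain q where q: "lin_comb B q" "\<forall>x\<in>X. p (f x) = q x" using B(3) by blast
      have "p y = q (inv_into X f y)" if y: "y \<in> f ` X" for y
        using q(2) inv_into_into[OF y] f_inv_into_f[OF y] by metis
      moreover have "lin_comb A (\<lambda>y. q (inv_into X f y))" unfolding A_def by (rule lin_comb_compose[OF q(1)])
      ultimately show ?thesis by blast
    qed
    ultimately show ?thesis by blast
  qed
  then show ?thesis unfolding growth_def by blast
qed

text \<open>Multiples of secants are the values of \<open>t *s (x - y)\<close> on the product of two
  copies of \<open>Y\<close> and a line. This source has growth exponent \<open>2 * k + 1\<close>,
  less than the number of target coordinates. Including every multiple makes the zero set of
  \<open>Q\<close> contain the whole secant cone.\<close>

lemma secants_in_hypersurface:
  fixes Y :: "(complex ^ 'n) set"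
  assumes g: "growth Y k" and J: "2 * k + 1 < card J"
  shows "\<exists>Q. complex_polynomial_function Q \<and> (\<exists>b\<in>coord_space J. Q b \<noteq> 0) \<and>
    (\<forall>x\<in>Y. \<forall>y\<in>Y. \<forall>t. x - y \<in> coord_space J \<longrightarrow> Q (t *s (x - y)) = 0)"
proof -
  define Z where "Z = vec_Times Y (vec_Times Y (coord_space UNIV :: (complex ^ unit) set))"
  have Z: "growth Z (k + (k + card (UNIV :: unit set)))"
    unfolding Z_def by (intro growth_vec_Times g growth_coord_space)
  define p where "p j z = vec_Inr (vec_Inr z) $ () * (vec_Inl z $ j - vec_Inl (vec_Inr z) $ j)"
    for j and z :: "complex ^ ('n + 'n + unit)"
  have "pdeg (1 + 1) (p j)" for j
    unfolding p_def[abs_def] One_nat_def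
    by (intro pdeg.mult pdeg_diff pdeg_vec_Inr[of _ "\<lambda>z. vec_Inr z $ ()"] pdeg_vec_Inl[of _ "\<lambda>z. z $ j"]
        pdeg_vec_Inr[of _ "\<lambda>z. vec_Inl z $ j"] pdeg_vec_Inr[of _ "\<lambda>z. z $ ()"] pdeg.coord)
  then obtain Q where Q: "complex_polynomial_function Q" "\<exists>a\<in>coord_space J. Q a \<noteq> 0"
    "\<forall>z\<in>Z. (1::complex) \<noteq> 0 \<longrightarrow> (\<forall>x. (\<forall>j\<in>J. x $ j = p j z / 1) \<longrightarrow> Q x = 0)"
    using rational_image_in_hypersurface[OF Z _ pdeg.const, of "1 + 1" p J 1] J by auto
  have "Q (t *s (x - y)) = 0" if "x \<in> Y" "y \<in> Y" for x y t
  proof -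
    have "vec_pair x (vec_pair y (\<chi> i. t)) \<in> Z" using that by (simp add: Z_def vec_Times_def coord_space_def)
    moreover have "\<forall>j\<in>J. (t *s (x - y)) $ j = p j (vec_pair x (vec_pair y (\<chi> i. t))) / 1"
      by (simp add: p_def algebra_simps)
    ultimately show ?thesis using Q(3) by (metis one_neq_zero)
  qed
  then show ?thesis using Q by blast
qed

section \<open>Bi-Lipschitz projections away from the secant cone\<close>

lemma cpf_continuous: "complex_polynomial_function p \<Longrightarrow> continuous_on UNIV p"
  by (induction rule: complex_polynomial_function.induct) (auto intro!: continuous_intros)

lemma algebraic_set_closed:
  assumes "algebraic_set X"
  shows "closed X"
proof -
  obtain P where P: "\<forall>p\<in>P. complex_polynomial_function p" "X = {x. \<forall>p\<in>P. p x = 0}"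
    using assms by (auto simp: algebraic_set_def)
  have "X = (\<Inter>p\<in>P. {x. p x = 0})" using P by auto
  also have "closed \<dots>"
    using P by (intro closed_INT ballI closed_Collect_eq cpf_continuous continuous_on_const) auto
  finally show ?thesis .
qed

lemma norm_vector_scalar: "norm (c *s x) = norm c * norm (x :: complex ^ 'n)"
  by (simp add: norm_vec_def norm_mult L2_set_right_distrib)

lemma proj_along_diff: "proj_along j v x - proj_along j v y = proj_along j v (x - y)"
  by (simp add: proj_along_def vec_eq_iff algebra_simps diff_divide_distrib)

text \<open>A secant that is almost annihilated by the projection is almost parallel to
  \<open>v\<close>. A multiple of it then falls into the ball around \<open>v\<close> on which
  \<open>Q\<close> has no zero.\<close>

lemma proj_along_lower_bound:
  fixes Y :: "(complex ^ 'n) set"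
  assumes Q: "complex_polynomial_function Q" "Q v \<noteq> 0" "v $ j \<noteq> 0"
    and sec: "\<forall>x\<in>Y. \<forall>y\<in>Y. \<forall>t. Q (t *s (x - y)) = 0"
  shows "\<exists>c>0. \<forall>x\<in>Y. \<forall>y\<in>Y. c * norm (x - y) \<le> norm (proj_along j v x - proj_along j v y)"
proof -
  have "isCont Q v" using cpf_continuous[OF Q(1)] by (simp add: continuous_on_eq_continuous_at)
  then obtain \<delta> where \<delta>: "\<delta> > 0" "\<forall>u. dist u v < \<delta> \<longrightarrow> dist (Q u) (Q v) < norm (Q v)"
    using Q(2) unfolding continuous_at_eps_delta by (metis zero_less_norm_iff)
  have v0: "norm v > 0" using Q(3) by auto
  \<comment> \<open>The bound \<open>1 / 2\<close> makes the component along \<open>v\<close>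
    control \<open>norm d\<close>; the other bound makes the final distance to \<open>v\<close> less
    than \<open>\<delta>\<close>.\<close>
  define c where "c = min (1 / 2) (\<delta> / (2 * norm v))"
  have c: "c > 0" "c \<le> 1 / 2" "2 * c * norm v \<le> \<delta>" using \<delta> v0 by (auto simp: c_def min_def field_simps)
  have "c * norm d \<le> norm (proj_along j v d)" if d: "\<forall>t. Q (t *s d) = 0" for d
  proof (rule ccontr)
    assume "\<not> ?thesis"
    then have less: "norm (proj_along j v d) < c * norm d" by simp
    define \<mu> where "\<mu> = d $ j / v $ j"
    have dec: "d = proj_along j v d + \<mu> *s v" unfolding \<mu>_def by (rule proj_along_eq)
    have "norm d \<le> norm (proj_along j v d) + norm \<mu> * norm v"
      by (subst dec) (metis norm_triangle_ineq norm_vector_scalar)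
    moreover have "c * norm d \<le> 1 / 2 * norm d" using c by (intro mult_right_mono) auto
    ultimately have d2: "norm d < 2 * norm \<mu> * norm v" using less by simp
    then have \<mu>0: "\<mu> \<noteq> 0" by auto
    have "(1 / \<mu>) *s d - v = (1 / \<mu>) *s proj_along j v d"
      by (subst (1) dec) (use \<mu>0 in \<open>simp add: vec_eq_iff field_simps\<close>)
    then have "norm ((1 / \<mu>) *s d - v) = norm (proj_along j v d) / norm \<mu>"
      by (simp add: norm_vector_scalar norm_divide)
    also have "\<dots> < c * norm d / norm \<mu>" using less \<mu>0 by (intro divide_strict_right_mono) auto
    also have "\<dots> \<le> c * (2 * norm \<mu> * norm v) / norm \<mu>"
      using d2 c by (intro divide_right_mono mult_left_mono) auto
    also have "\<dots> = 2 * c * norm v" using \<mu>0 by simp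
    also have "\<dots> \<le> \<delta>" by (rule c(3))
    finally have "dist (Q ((1 / \<mu>) *s d)) (Q v) < norm (Q v)" using \<delta> by (simp add: dist_norm)
    then show False using d by (simp add: dist_norm)
  qed
  then show ?thesis using sec c(1) by (auto simp: proj_along_diff)
qed

lemma proj_along_upper_bound:
  "norm (proj_along j v x - proj_along j v y) \<le> (1 + norm v / norm (v $ j)) * norm (x - y :: complex ^ 'n)"
proof -
  have "norm (proj_along j v (x - y)) \<le> norm (x - y) + norm ((x - y) $ j) / norm (v $ j) * norm v"
    unfolding proj_along_def by (metis norm_triangle_ineq4 norm_vector_scalar norm_divide)
  also have "\<dots> \<le> norm (x - y) + norm (x - y) / norm (v $ j) * norm v"
    using Finite_Cartesian_Product.norm_nth_le[of "x - y" j]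
    by (intro add_left_mono mult_right_mono divide_right_mono) auto
  also have "\<dots> = (1 + norm v / norm (v $ j)) * norm (x - y)" by (simp add: algebra_simps)
  finally show ?thesis by (simp add: proj_along_diff)
qed

text \<open>While \<open>card J\<close> exceeds \<open>2 * k + 1\<close>, one polynomial
  \<open>Q\<close> vanishing on the secant cone serves twice: \<open>Q v \<noteq> 0\<close> gives
  the Lipschitz lower bound, and the translate \<open>Q (x - y0)\<close> is a nontrivial equation
  for \<open>Y\<close> from which integrality follows.\<close>

lemma exists_projection_to_coord_space:
  fixes Y :: "(complex ^ 'n) set"
  assumes "algebraic_set Y" "Y \<subseteq> coord_space J" "growth Y k" "Y \<noteq> {}"
  shows "\<exists>(p :: complex ^ 'n \<Rightarrow> complex ^ 'n) J'. card J' \<le> 2 * k + 1 \<and> (\<forall>i. pdeg 1 (\<lambda>x. p x $ i)) \<and> p ` Y \<subseteq> coord_space J' \<and>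
    algebraic_set (p ` Y) \<and> (\<exists>c>0. \<forall>x\<in>Y. \<forall>y\<in>Y. c * norm (x - y) \<le> norm (p x - p y)) \<and>
    (\<exists>L\<ge>0. \<forall>x\<in>Y. \<forall>y\<in>Y. norm (p x - p y) \<le> L * norm (x - y))"
  using assms
proof (induction "card J" arbitrary: Y J rule: less_induct)
  case less
  show ?case
  proof (cases "card J \<le> 2 * k + 1")
    case True
    show ?thesis
      by (rule exI[of _ "\<lambda>x. x"], rule exI[of _ J], intro conjI)
         (use True less.prems pdeg.coord[of 0] in \<open>auto intro!: exI[of _ 1]\<close>)
  next
    case False
    then obtain Q b where Q: "complex_polynomial_function Q" "b \<in> coord_space J" "Q b \<noteq> 0"
      "\<forall>x\<in>Y. \<forall>y\<in>Y. \<forall>t. x - y \<in> coord_space J \<longrightarrow> Q (t *s (x - y)) = 0"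
      using secants_in_hypersurface[OF less.prems(3), of J] by auto
    have diff: "x - y \<in> coord_space J" if "x \<in> coord_space J" "y \<in> coord_space J" for x y :: "complex ^ 'n"
      using that by (auto simp: coord_space_def)
    obtain y0 where y0: "y0 \<in> Y" using less.prems(4) by blast
    define R where "R x = Q (x - y0)" for x
    have R: "complex_polynomial_function R"
      unfolding R_def[abs_def] by (rule cpf_compose[OF Q(1)]) (simp add: cpf_diff cpf_coord cpf_const)
    have RY: "\<forall>x\<in>Y. R x = 0"
    proof
      fix x assume "x \<in> Y"
      then have "Q (1 *s (x - y0)) = 0" using Q(4) y0 diff less.prems(2) by blast
      then show "R x = 0" by (simp add: R_def)
    qed
    have b: "b + y0 \<in> coord_space J" "R (b + y0) \<noteq> 0"
      using Q y0 less.prems(2) by (auto simp: R_def coord_space_def)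
    obtain j where j: "j \<in> J" using False by fastforce
    obtain v D B where v: "v \<in> coord_space J" "v $ j \<noteq> 0" "Q v \<noteq> 0" "integral_along Y v D B"
      using exists_integral_direction[OF less.prems(2) R RY b Q(1-3) j] by blast
    define q where "q = proj_along j v"
    have im: "q ` Y \<subseteq> coord_space (J - {j})"
      unfolding q_def using proj_along_image[OF less.prems(2) v(1,2)] by blast
    have alg: "algebraic_set (q ` Y)"
      unfolding q_def by (rule algebraic_proj_along[OF less.prems(1,2) v(1,2,4)])
    have gr: "growth (q ` Y) k"
      unfolding q_def by (rule growth_image[OF less.prems(3) pdeg_proj_along])
    have sec: "\<forall>x\<in>Y. \<forall>y\<in>Y. \<forall>t. Q (t *s (x - y)) = 0" using Q(4) diff less.prems(2) by blast
    obtain c where c: "c > 0" "\<forall>x\<in>Y. \<forall>y\<in>Y. c * norm (x - y) \<le> norm (q x - q y)"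
      unfolding q_def using proj_along_lower_bound[OF Q(1) v(3,2) sec] by blast
    define L where "L = 1 + norm v / norm (v $ j)"
    have L: "L \<ge> 0" "norm (q x - q y) \<le> L * norm (x - y)" for x y
      unfolding q_def L_def by (auto simp: proj_along_upper_bound)
    have cl: "card (J - {j}) < card J" by (rule card_Diff1_less[OF finite j])
    have ne: "q ` Y \<noteq> {}" using less.prems(4) by simp
    obtain p :: "complex ^ 'n \<Rightarrow> complex ^ 'n" and J' where P: "card J' \<le> 2 * k + 1 \<and> (\<forall>i. pdeg 1 (\<lambda>x. p x $ i)) \<and>
      p ` q ` Y \<subseteq> coord_space J' \<and> algebraic_set (p ` q ` Y) \<and>
      (\<exists>c>0. \<forall>x\<in>q ` Y. \<forall>y\<in>q ` Y. c * norm (x - y) \<le> norm (p x - p y)) \<and>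
      (\<exists>L\<ge>0. \<forall>x\<in>q ` Y. \<forall>y\<in>q ` Y. norm (p x - p y) \<le> L * norm (x - y))"
      using less.hyps[OF cl alg im gr ne] by (elim exE)
    note p = P[THEN conjunct1] P[THEN conjunct2, THEN conjunct1] P[THEN conjunct2, THEN conjunct2, THEN conjunct1]
      P[THEN conjunct2, THEN conjunct2, THEN conjunct2, THEN conjunct1]
      P[THEN conjunct2, THEN conjunct2, THEN conjunct2, THEN conjunct2, THEN conjunct1]
      P[THEN conjunct2, THEN conjunct2, THEN conjunct2, THEN conjunct2, THEN conjunct2]
    obtain c' where c': "c' > 0" "\<forall>x\<in>Y. \<forall>y\<in>Y. c' * norm (q x - q y) \<le> norm (p (q x) - p (q y))"
      using p(5) by auto
    obtain L' where L': "L' \<ge> 0" "\<forall>x\<in>Y. \<forall>y\<in>Y. norm (p (q x) - p (q y)) \<le> L' * norm (q x - q y)"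
      using p(6) by auto
    have "pdeg (1 * 1) (\<lambda>x. p (q x) $ i)" for i
      unfolding q_def by (rule pdeg_compose[OF p(2)[rule_format] pdeg_proj_along])
    moreover have "c' * c * norm (x - y) \<le> norm (p (q x) - p (q y))" if "x \<in> Y" "y \<in> Y" for x y
    proof -
      have "c' * (c * norm (x - y)) \<le> c' * norm (q x - q y)" using c(2) c'(1) that by (intro mult_left_mono) auto
      also have "\<dots> \<le> norm (p (q x) - p (q y))" using c'(2) that by blast
      finally show ?thesis by (simp add: mult.assoc)
    qed
    moreover have "norm (p (q x) - p (q y)) \<le> L' * L * norm (x - y)" if "x \<in> Y" "y \<in> Y" for x y
    proof -
      have "norm (p (q x) - p (q y)) \<le> L' * norm (q x - q y)" using L'(2) that by blast
      also have "\<dots> \<le> L' * (L * norm (x - y))" by (rule mult_left_mono[OF L(2) L'(1)])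
      finally show ?thesis by (simp add: mult.assoc)
    qed
    ultimately have "(\<forall>i. pdeg 1 (\<lambda>x. p (q x) $ i)) \<and> (\<exists>c>0. \<forall>x\<in>Y. \<forall>y\<in>Y. c * norm (x - y) \<le> norm (p (q x) - p (q y))) \<and>
      (\<exists>L\<ge>0. \<forall>x\<in>Y. \<forall>y\<in>Y. norm (p (q x) - p (q y)) \<le> L * norm (x - y))"
      using c(1) c'(1) L(1) L'(1)
      by (intro conjI exI[of _ "c' * c"] exI[of _ "L' * L"] allI ballI) simp_all
    then show ?thesis using p(1,3,4) unfolding image_image
      by (intro exI[of _ "\<lambda>x. p (q x)"] exI[of _ J'] conjI) (elim conjE, assumption)+
  qed
qed

lemma regular_bi_lipschitz_embeddingI:
  assumes "regular_on X f" "algebraic_set (f ` X)"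
    and c: "c > 0" "\<forall>x\<in>X. \<forall>y\<in>X. c * norm (x - y) \<le> norm (f x - f y)"
    and L: "L \<ge> 0" "\<forall>x\<in>X. \<forall>y\<in>X. norm (f x - f y) \<le> L * norm (x - y)"
  shows "regular_bi_lipschitz_embedding X f"
proof -
  have inj: "inj_on f X"
  proof (rule inj_onI)
    fix x y assume "x \<in> X" "y \<in> X" "f x = f y"
    then have "c * norm (x - y) \<le> 0" using c(2) by fastforce
    then show "x = y" using c(1) by (simp add: mult_le_0_iff)
  qed
  have "L-lipschitz_on X f" using L by (intro lipschitz_onI) (auto simp: dist_norm)
  moreover have "(1 / c)-lipschitz_on (f ` X) (inv_into X f)"
  proof (rule lipschitz_onI)
    fix u v assume "u \<in> f ` X" "v \<in> f ` X"
    then obtain x y where "x \<in> X" "y \<in> X" "u = f x" "v = f y" by blast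
    then show "dist (inv_into X f u) (inv_into X f v) \<le> 1 / c * dist u v"
      using c inj by (simp add: dist_norm field_simps inv_into_f_f)
  qed (use c in simp)
  ultimately show ?thesis
    using assms(1,2) inj algebraic_set_closed[OF assms(2)]
    unfolding regular_bi_lipschitz_embedding_def bi_lipschitz_embedding_def by blast
qed

theorem exists_regular_bi_lipschitz_embedding:
  fixes X :: "(complex ^ 'n) set"
  assumes "algebraic_set X" "has_algebraic_dim X k" "2 * k + 1 \<le> CARD('m::finite)"
  shows "\<exists>f :: complex ^ 'n \<Rightarrow> complex ^ 'm. regular_bi_lipschitz_embedding X f"
proof -
  have "X \<subseteq> coord_space UNIV" by (simp add: coord_space_def)
  then obtain p :: "complex ^ 'n \<Rightarrow> complex ^ 'n" and J c L where
    p: "card J \<le> 2 * k + 1" "\<forall>i. pdeg 1 (\<lambda>x. p x $ i)" "p ` X \<subseteq> coord_space J" "algebraic_set (p ` X)"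
    and c: "c > 0" "\<forall>x\<in>X. \<forall>y\<in>X. c * norm (x - y) \<le> norm (p x - p y)"
    and L: "L \<ge> 0" "\<forall>x\<in>X. \<forall>y\<in>X. norm (p x - p y) \<le> L * norm (x - y)"
    using exists_projection_to_coord_space[OF assms(1) _ algebraic_dim_growth[OF assms(1,2)]] by blast
  have "card J \<le> card (UNIV :: 'm set)" using p(1) assms(3) by simp
  then obtain \<iota> :: "'n \<Rightarrow> 'm" where \<iota>: "inj_on \<iota> J" using card_le_inj[of J "UNIV :: 'm set"] by auto
  define f where "f x = (\<chi> i. if i \<in> \<iota> ` J then p x $ inv_into J \<iota> i else 0)" for x
  \<comment> \<open>\<open>h\<close> undoes the relabelling of coordinates by
    \<open>\<iota>\<close>; through it the image of \<open>f\<close> is described by equations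
    pulled back from the image of \<open>p\<close>.\<close>
  define h where "h w = (\<chi> j. if j \<in> J then w $ \<iota> j else 0)" for w :: "complex ^ 'm"
  have f\<iota>: "f x $ \<iota> j = p x $ j" if "j \<in> J" for x j using that \<iota> by (simp add: f_def inv_into_f_f)
  have f0: "f x $ i = 0" if "i \<notin> \<iota> ` J" for x i using that by (simp add: f_def)
  have p0: "p x $ j = 0" if "x \<in> X" "j \<notin> J" for x j using p(3) that by (auto simp: coord_space_def)
  have hf: "h (f x) = p x" if "x \<in> X" for x using f\<iota> p0[OF that] by (auto simp: h_def vec_eq_iff)
  have norm: "norm (f x - f y) = norm (p x - p y)" if "x \<in> X" "y \<in> X" for x y
  proof -
    have "(\<Sum>i\<in>UNIV. (norm ((f x - f y) $ i))\<^sup>2) = (\<Sum>i\<in>\<iota> ` J. (norm ((f x - f y) $ i))\<^sup>2)"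
      by (intro sum.mono_neutral_right) (auto simp: f0)
    also have "\<dots> = (\<Sum>j\<in>J. (norm ((p x - p y) $ j))\<^sup>2)"
      by (subst sum.reindex[OF \<iota>]) (auto simp: f\<iota>)
    also have "\<dots> = (\<Sum>j\<in>UNIV. (norm ((p x - p y) $ j))\<^sup>2)"
      by (intro sum.mono_neutral_left) (auto simp: p0 that)
    finally show ?thesis by (simp add: norm_vec_def L2_set_def)
  qed
  have cf: "complex_polynomial_function (\<lambda>x. f x $ i)" for i
    using p(2) pdeg_imp_cpf by (cases "i \<in> \<iota> ` J") (auto simp: f_def cpf_const)
  then have "regular_on X f" unfolding regular_on_def by blast
  moreover have "algebraic_set (f ` X)"
  proof -
    have "f ` X = coord_space (\<iota> ` J) \<inter> {w. h w \<in> p ` X}"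
    proof (intro equalityI subsetI)
      fix w assume "w \<in> f ` X"
      then show "w \<in> coord_space (\<iota> ` J) \<inter> {w. h w \<in> p ` X}" using hf f0 by (auto simp: coord_space_def)
    next
      fix w assume w: "w \<in> coord_space (\<iota> ` J) \<inter> {w. h w \<in> p ` X}"
      then obtain x where x: "x \<in> X" "h w = p x" by auto
      have "w $ i = f x $ i" for i
      proof (cases "i \<in> \<iota> ` J")
        case True
        then obtain j where j: "j \<in> J" "i = \<iota> j" by blast
        have "w $ \<iota> j = h w $ j" using j by (simp add: h_def)
        then show ?thesis using x j f\<iota> by simp
      next
        case False
        then show ?thesis using w f0 by (auto simp: coord_space_def)
      qed
      then show "w \<in> f ` X" using x by (auto simp: vec_eq_iff)
    qed
    moreover have "complex_polynomial_function (\<lambda>w. h w $ j)" for j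
      by (cases "j \<in> J") (auto simp: h_def cpf_coord cpf_const)
    ultimately show ?thesis
      by (simp add: algebraic_set_Int algebraic_coord_space algebraic_set_vimage p(4))
  qed
  ultimately show ?thesis
    using c L norm regular_bi_lipschitz_embeddingI[of X f c L] by auto
qed

section \<open>Hilbert basis theorem\<close>

text \<open>Restricting the variables to \<open>J\<close> lets the induction on their number take
  place inside one type.\<close>

inductive polys_in :: "'n set \<Rightarrow> (complex ^ 'n \<Rightarrow> complex) \<Rightarrow> bool" for J where
  const: "polys_in J (\<lambda>x. c)"
| coord: "i \<in> J \<Longrightarrow> polys_in J (\<lambda>x. x $ i)"
| add: "polys_in J p \<Longrightarrow> polys_in J q \<Longrightarrow> polys_in J (\<lambda>x. p x + q x)"
| mult: "polys_in J p \<Longrightarrow> polys_in J q \<Longrightarrow> polys_in J (\<lambda>x. p x * q x)"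

lemma polys_in_UNIV: "polys_in UNIV p \<longleftrightarrow> complex_polynomial_function p"
proof
  assume "polys_in UNIV p"
  then show "complex_polynomial_function p"
    by induction (auto intro: complex_polynomial_function.intros)
next
  assume "complex_polynomial_function p"
  then show "polys_in UNIV p"
    by induction (auto intro: polys_in.intros)
qed

lemma polys_in_mono: "polys_in J p \<Longrightarrow> J \<subseteq> K \<Longrightarrow> polys_in K p"
  by (induction rule: polys_in.induct) (auto intro: polys_in.intros)

lemma polys_in_sum: "(\<And>i. i \<in> I \<Longrightarrow> polys_in J (p i)) \<Longrightarrow> polys_in J (\<lambda>x. \<Sum>i\<in>I. p i x)"
  by (induction I rule: infinite_finite_induct) (auto intro: polys_in.intros)

lemma polys_in_power: "polys_in J p \<Longrightarrow> polys_in J (\<lambda>x. p x ^ n)"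
  by (induction n) (auto intro: polys_in.intros)

lemma polys_in_minus: "polys_in J p \<Longrightarrow> polys_in J (\<lambda>x. - p x)"
  using polys_in.mult[OF polys_in.const[of J "-1"]] by simp

lemma polys_in_diff: "polys_in J p \<Longrightarrow> polys_in J q \<Longrightarrow> polys_in J (\<lambda>x. p x - q x)"
  using polys_in.add[OF _ polys_in_minus] by simp

definition fun_ideal :: "'n::finite set \<Rightarrow> (nat \<Rightarrow> complex ^ 'n \<Rightarrow> complex) \<Rightarrow> nat \<Rightarrow> (complex ^ 'n \<Rightarrow> complex) set" where
  "fun_ideal J g N = {f. \<exists>r. (\<forall>i. polys_in J (r i)) \<and> f = (\<lambda>x. \<Sum>i<N. r i x * g i x)}"

text \<open>The ascending chain condition, phrased with sequences of generators instead of chains of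
  ideals.\<close>

definition noetherian_polys :: "'n::finite set \<Rightarrow> bool" where
  "noetherian_polys J \<longleftrightarrow> (\<forall>a. (\<forall>i. polys_in J (a i)) \<longrightarrow> (\<exists>N. a N \<in> fun_ideal J a N))"

lemma fun_idealI: "(\<And>i. polys_in J (r i)) \<Longrightarrow> f = (\<lambda>x. \<Sum>i<N. r i x * g i x) \<Longrightarrow> f \<in> fun_ideal J g N"
  by (auto simp: fun_ideal_def)

lemma fun_ideal_add:
  assumes "f \<in> fun_ideal J g N" "h \<in> fun_ideal J g N"
  shows "(\<lambda>x. f x + h x) \<in> fun_ideal J g N"
proof -
  obtain r s where "\<And>i. polys_in J (r i)" "f = (\<lambda>x. \<Sum>i<N. r i x * g i x)"
    "\<And>i. polys_in J (s i)" "h = (\<lambda>x. \<Sum>i<N. s i x * g i x)"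
    using assms by (auto simp: fun_ideal_def)
  then show ?thesis
    by (intro fun_idealI[of _ "\<lambda>i x. r i x + s i x"]) (auto intro: polys_in.add simp: sum.distrib distrib_right)
qed

lemma fun_ideal_mult:
  assumes "f \<in> fun_ideal J g N" "polys_in J p"
  shows "(\<lambda>x. p x * f x) \<in> fun_ideal J g N"
proof -
  obtain r where "\<And>i. polys_in J (r i)" "f = (\<lambda>x. \<Sum>i<N. r i x * g i x)"
    using assms by (auto simp: fun_ideal_def)
  then show ?thesis using assms(2)
    by (intro fun_idealI[of _ "\<lambda>i x. p x * r i x"]) (auto intro: polys_in.mult simp: sum_distrib_left mult.assoc)
qed

lemma fun_ideal_zero: "(\<lambda>x. 0) \<in> fun_ideal J g N"
  by (rule fun_idealI[of _ "\<lambda>i x. 0"]) (auto intro: polys_in.const)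

lemma fun_ideal_sum:
  "(\<And>i. i \<in> I \<Longrightarrow> f i \<in> fun_ideal J g N) \<Longrightarrow> (\<lambda>x. \<Sum>i\<in>I. f i x) \<in> fun_ideal J g N"
  by (induction I rule: infinite_finite_induct) (auto intro: fun_ideal_add fun_ideal_zero)

lemma fun_ideal_base: "i < N \<Longrightarrow> g i \<in> fun_ideal J g N"
proof (rule fun_idealI[of _ "\<lambda>k x. if k = i then 1 else 0"])
  assume "i < N"
  then show "g i = (\<lambda>x. \<Sum>k<N. (if k = i then 1 else 0) * g k x)"
    by (auto simp: fun_eq_iff if_distrib[of "\<lambda>c. c * _"] cong: if_cong)
qed (auto intro: polys_in.const)

lemma fun_ideal_trans:
  assumes "\<And>i. i < N \<Longrightarrow> g i \<in> fun_ideal J f M" "h \<in> fun_ideal J g N"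
  shows "h \<in> fun_ideal J f M"
proof -
  obtain r where r: "\<And>i. polys_in J (r i)" "h = (\<lambda>x. \<Sum>i<N. r i x * g i x)"
    using assms(2) by (auto simp: fun_ideal_def)
  show ?thesis unfolding r(2)
    by (intro fun_ideal_sum fun_ideal_mult r(1) assms(1)) auto
qed

lemma fun_ideal_mono: "h \<in> fun_ideal J g N \<Longrightarrow> N \<le> M \<Longrightarrow> h \<in> fun_ideal J g M"
  by (rule fun_ideal_trans[of N g J g M]) (auto intro: fun_ideal_base)

lemma fun_ideal_cong: "(\<And>i. i < N \<Longrightarrow> f i = g i) \<Longrightarrow> fun_ideal J f N = fun_ideal J g N"
  by (simp add: fun_ideal_def)

definition poly_rep :: "'n::finite set \<Rightarrow> 'n \<Rightarrow> nat \<Rightarrow> (complex ^ 'n \<Rightarrow> complex) \<Rightarrow> bool" where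
  "poly_rep J j d f \<longleftrightarrow> (\<exists>c. (\<forall>i. polys_in J (c i)) \<and> f = (\<lambda>x. \<Sum>i\<le>d. c i x * x $ j ^ i))"

lemma exists_poly_rep:
  assumes "polys_in (insert j J) f"
  shows "\<exists>d. poly_rep J j d f"
proof -
  have "\<exists>P d. (\<forall>i. polys_in J (\<lambda>x. coeff (P x) i)) \<and> (\<forall>x i. d < i \<longrightarrow> coeff (P x) i = (0::complex)) \<and>
    (\<forall>x. f x = poly (P x) (x $ j))"
    using assms
  proof induction
    case (const c)
    show ?case
      by (rule exI[of _ "\<lambda>x. [:c:]"], rule exI[of _ 0], intro conjI allI impI; (rule polys_in.const)?)
         (auto simp: coeff_pCons split: nat.split)
  next
    case (coord i)
    show ?case
    proof (cases "i = j")
      case True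
      show ?thesis
        by (rule exI[of _ "\<lambda>x. [:0, 1:]"], rule exI[of _ 1], intro conjI allI impI; (rule polys_in.const)?)
           (auto simp: True coeff_pCons split: nat.split)
    next
      case False
      have "polys_in J (\<lambda>x. coeff [:x $ i:] k)" for k
        using coord False by (cases k) (auto intro: polys_in.intros)
      moreover have "coeff [:x $ i:] k = 0" if "0 < k" for x k
        using that by (auto simp: coeff_pCons split: nat.split)
      ultimately show ?thesis by (intro exI[of _ "\<lambda>x. [:x $ i:]"] exI[of _ 0]) auto
    qed
  next
    case (add p q)
    then obtain P d Q e where "\<forall>i. polys_in J (\<lambda>x. coeff (P x) i)" "\<forall>x i. d < i \<longrightarrow> coeff (P x) i = 0"
      "\<forall>x. p x = poly (P x) (x $ j)" "\<forall>i. polys_in J (\<lambda>x. coeff (Q x) i)" "\<forall>x i. e < i \<longrightarrow> coeff (Q x) i = 0"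
      "\<forall>x. q x = poly (Q x) (x $ j)" by blast
    then show ?case
      by (intro exI[of _ "\<lambda>x. P x + Q x"] exI[of _ "max d e"]) (auto intro: polys_in.add)
  next
    case (mult p q)
    then obtain P d Q e where PQ: "\<forall>i. polys_in J (\<lambda>x. coeff (P x) i)" "\<forall>x i. d < i \<longrightarrow> coeff (P x) i = 0"
      "\<forall>x. p x = poly (P x) (x $ j)" "\<forall>i. polys_in J (\<lambda>x. coeff (Q x) i)" "\<forall>x i. e < i \<longrightarrow> coeff (Q x) i = 0"
      "\<forall>x. q x = poly (Q x) (x $ j)" by blast
    moreover have "\<forall>x i. d + e < i \<longrightarrow> coeff (P x * Q x) i = 0" by (rule coeff_mult_eq_0) (use PQ in auto)
    moreover have "polys_in J (\<lambda>x. coeff (P x * Q x) i)" for i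
      unfolding coeff_mult using PQ by (intro polys_in_sum polys_in.mult) auto
    ultimately show ?case
      by (intro exI[of _ "\<lambda>x. P x * Q x"] exI[of _ "d + e"]) auto
  qed
  then obtain P d where P: "\<forall>i. polys_in J (\<lambda>x. coeff (P x) i)" "\<forall>x i. d < i \<longrightarrow> coeff (P x) i = (0::complex)"
    "\<forall>x. f x = poly (P x) (x $ j)" by blast
  have "degree (P x) \<le> d" for x using P(2) by (auto intro: degree_le)
  then have "f = (\<lambda>x. \<Sum>i\<le>d. coeff (P x) i * x $ j ^ i)"
    using P(3) by (simp add: fun_eq_iff poly_sum_atMost)
  then show ?thesis unfolding poly_rep_def
    using P(1) by (intro exI[of _ d] exI[of _ "\<lambda>i x. coeff (P x) i"]) simp
qed

text \<open>Hilbert's argument: choose \<open>g N\<close> of minimal degree in \<open>x $ j\<close>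
  outside the ideal of its predecessors. The property for \<open>J\<close> expresses one leading
  coefficient by earlier ones; subtracting the corresponding combination of earlier terms leaves an
  element outside the same ideal but of smaller degree.\<close>

theorem hilbert_basis_step:
  fixes J :: "'n::finite set"
  assumes noeth: "noetherian_polys J"
  shows "noetherian_polys (insert j J)"
proof (rule ccontr)
  assume "\<not> ?thesis"
  then obtain f where f: "\<And>i. polys_in (insert j J) (f i)" "\<And>N. f N \<notin> fun_ideal (insert j J) f N"
    unfolding noetherian_polys_def by blast
  define I where "I = (\<Union>N. fun_ideal (insert j J) f N)"
  have I_poly: "polys_in (insert j J) h" if "h \<in> I" for h
    using that f(1) by (auto simp: I_def fun_ideal_def intro!: polys_in_sum polys_in.mult)
  \<comment> \<open>A representation may have a vanishing top coefficient, so the degree is defined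
    as the least admissible bound.\<close>
  define deg where "deg h = (LEAST d. poly_rep J j d h)" for h
  have deg_le: "deg h \<le> d" if "poly_rep J j d h" for h d
    unfolding deg_def using that by (rule Least_le)
  have deg: "poly_rep J j (deg h) h" if "h \<in> I" for h
    unfolding deg_def using LeastI_ex[OF exists_poly_rep[OF I_poly[OF that]]] .
  have f_I: "f i \<in> I" for i unfolding I_def using fun_ideal_base[of i "Suc i"] by blast
  have I_bound: "\<exists>M. \<forall>i<N. g i \<in> fun_ideal (insert j J) f M" if "\<And>i. i < N \<Longrightarrow> g i \<in> I" for g and N :: nat
    using that
  proof (induction N)
    case (Suc N)
    then obtain M where M: "\<forall>i<N. g i \<in> fun_ideal (insert j J) f M" by auto
    obtain M' where M': "g N \<in> fun_ideal (insert j J) f M'" using Suc.prems[of N] by (auto simp: I_def)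
    show ?case
      using M M' by (intro exI[of _ "max M M'"]) (auto simp: less_Suc_eq intro: fun_ideal_mono)
  qed simp
  define P where "P g N y \<longleftrightarrow> y \<in> I \<and> y \<notin> fun_ideal (insert j J) g N \<and>
    (\<forall>y'\<in>I. y' \<notin> fun_ideal (insert j J) g N \<longrightarrow> deg y \<le> deg y')" for g N y
  have "\<exists>g. \<forall>N. P g N (g N)"
  proof (rule dependent_wf_choice[OF wf_less_than])
    fix g h :: "nat \<Rightarrow> complex ^ 'n \<Rightarrow> complex" and N r
    assume "\<And>z. (z, N) \<in> less_than \<Longrightarrow> g z = h z"
    then have "fun_ideal (insert j J) g N = fun_ideal (insert j J) h N" by (intro fun_ideal_cong) auto
    then show "P g N r = P h N r" by (simp add: P_def)
  next
    fix N and g :: "nat \<Rightarrow> complex ^ 'n \<Rightarrow> complex"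
    assume "\<And>y. (y, N) \<in> less_than \<Longrightarrow> P g y (g y)"
    then have gI: "g i \<in> I" if "i < N" for i using that by (auto simp: P_def)
    obtain M where M: "\<forall>i<N. g i \<in> fun_ideal (insert j J) f M" using I_bound[of N g] gI by blast
    \<comment> \<open>The finitely many earlier \<open>g i\<close> lie in the ideal of the first
      \<open>M\<close> terms of \<open>f\<close>, which misses \<open>f M\<close>; so
      \<open>f M\<close> is a candidate for the next term.\<close>
    have fM: "f M \<in> I \<and> f M \<notin> fun_ideal (insert j J) g N"
      using fun_ideal_trans[of N g "insert j J" f M "f M"] M f(2) f_I by blast
    show "\<exists>r. P g N r"
      unfolding P_def
      using ex_has_least_nat[of "\<lambda>y. y \<in> I \<and> y \<notin> fun_ideal (insert j J) g N", OF fM, of deg] by blast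
  qed
  then obtain g where g: "\<And>N. P g N (g N)" by blast
  have gI: "g N \<in> I" and gN: "g N \<notin> fun_ideal (insert j J) g N" for N using g by (auto simp: P_def)
  have gmin: "deg (g N) \<le> deg y" if "y \<in> I" "y \<notin> fun_ideal (insert j J) g N" for y N
    using g that by (auto simp: P_def)
  define d where "d N = deg (g N)" for N
  have "\<forall>N. \<exists>c. (\<forall>i. polys_in J (c i)) \<and> g N = (\<lambda>x. \<Sum>i\<le>d N. c i x * x $ j ^ i)"
    using deg[OF gI] unfolding d_def poly_rep_def by blast
  then obtain c where c: "\<And>N i. polys_in J (c N i)" "\<And>N. g N = (\<lambda>x. \<Sum>i\<le>d N. c N i x * x $ j ^ i)" by metis
  have "\<exists>N. c N (d N) \<in> fun_ideal J (\<lambda>N. c N (d N)) N"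
    using noeth c(1) unfolding noetherian_polys_def by (elim allE[of _ "\<lambda>N. c N (d N)"]) blast
  then obtain N r where r: "\<And>i. polys_in J (r i)" "c N (d N) = (\<lambda>x. \<Sum>i<N. r i x * c i (d i) x)"
    unfolding fun_ideal_def by blast
  have dmono: "d i \<le> d N" if "i < N" for i
    unfolding d_def using gmin[OF gI[of N], of i] gN[of N] fun_ideal_mono[of "g N" "insert j J" g i N] that by force
  \<comment> \<open>The powers of \<open>x $ j\<close> lift the earlier terms to degree
    \<open>d N\<close>. The subtraction in the exponents is exact because the minimal degrees never
    decrease.\<close>
  define s where "s x = (\<Sum>i<N. r i x * x $ j ^ (d N - d i) * g i x)" for x
  have sI: "s \<in> fun_ideal (insert j J) g N"
    unfolding s_def[abs_def]
    by (rule fun_idealI[of _ "\<lambda>i x. r i x * x $ j ^ (d N - d i)"])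
       (auto intro!: polys_in.mult polys_in_power polys_in.coord intro: polys_in_mono[OF r(1)])
  define h where "h x = g N x - s x" for x
  have hg: "h \<notin> fun_ideal (insert j J) g N"
  proof
    assume "h \<in> fun_ideal (insert j J) g N"
    from fun_ideal_add[OF this sI] have "g N \<in> fun_ideal (insert j J) g N" by (simp add: h_def)
    then show False using gN by blast
  qed
  have hI: "h \<in> I"
  proof -
    obtain M where M: "\<forall>i<Suc N. g i \<in> fun_ideal (insert j J) f M" using I_bound[of "Suc N" g] gI by blast
    have "s \<in> fun_ideal (insert j J) f M" using fun_ideal_trans[OF _ sI] M by simp
    then have "(\<lambda>x. - 1 * s x) \<in> fun_ideal (insert j J) f M" by (intro fun_ideal_mult polys_in.const)
    then have "(\<lambda>x. g N x + - 1 * s x) \<in> fun_ideal (insert j J) f M" using M by (intro fun_ideal_add) auto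
    moreover have "(\<lambda>x. g N x + - 1 * s x) = h" by (simp add: h_def fun_eq_iff)
    ultimately show ?thesis by (auto simp: I_def)
  qed
  define e where "e k x = c N k x - (\<Sum>i<N. if d N - d i \<le> k then r i x * c i (k - (d N - d i)) x else 0)" for k x
  have e_poly: "polys_in J (e k)" for k
    unfolding e_def[abs_def]
  proof (intro polys_in_diff c(1) polys_in_sum)
    fix i show "polys_in J (\<lambda>x. if d N - d i \<le> k then r i x * c i (k - (d N - d i)) x else 0)"
      by (cases "d N - d i \<le> k") (auto intro: polys_in.mult r(1) c(1) polys_in.const)
  qed
  have h_eq: "h x = (\<Sum>k\<le>d N. e k x * x $ j ^ k)" for x
  proof -
    have shift: "x $ j ^ (d N - d i) * g i x =
      (\<Sum>k\<le>d N. if d N - d i \<le> k then c i (k - (d N - d i)) x * x $ j ^ k else 0)" if i: "i < N" for i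
    proof -
      have "(\<Sum>k\<le>d N. if d N - d i \<le> k then c i (k - (d N - d i)) x * x $ j ^ k else 0)
        = (\<Sum>k\<in>{d N - d i..d N}. c i (k - (d N - d i)) x * x $ j ^ k)"
        by (intro sum.mono_neutral_cong_right) auto
      also have "\<dots> = (\<Sum>l\<le>d i. c i l x * x $ j ^ (l + (d N - d i)))"
        by (rule sum.reindex_bij_witness[of _ "\<lambda>l. l + (d N - d i)" "\<lambda>k. k - (d N - d i)"])
           (use dmono[OF i] in auto)
      also have "\<dots> = x $ j ^ (d N - d i) * g i x"
        by (simp add: c(2)[of i] sum_distrib_left power_add mult_ac)
      finally show ?thesis by simp
    qed
    have "s x = (\<Sum>i<N. r i x * (x $ j ^ (d N - d i) * g i x))" by (simp add: s_def mult.assoc)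
    also have "\<dots> = (\<Sum>i<N. \<Sum>k\<le>d N. (if d N - d i \<le> k then r i x * c i (k - (d N - d i)) x else 0) * x $ j ^ k)"
      by (intro sum.cong refl) (simp add: shift sum_distrib_left mult.assoc if_distrib[of "\<lambda>y. _ * y"] if_distrib[of "\<lambda>y. y * _"] cong: if_cong)
    also have "\<dots> = (\<Sum>k\<le>d N. (\<Sum>i<N. if d N - d i \<le> k then r i x * c i (k - (d N - d i)) x else 0) * x $ j ^ k)"
      by (subst sum.swap) (simp add: sum_distrib_right)
    finally show ?thesis
      unfolding h_def e_def c(2)[of N] by (simp add: left_diff_distrib sum_subtractf)
  qed
  have top: "e (d N) x = 0" for x
  proof -
    have "(\<Sum>i<N. if d N - d i \<le> d N then r i x * c i (d N - (d N - d i)) x else 0) = (\<Sum>i<N. r i x * c i (d i) x)"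
      using dmono by (intro sum.cong) auto
    then show ?thesis using r(2) by (simp add: e_def fun_eq_iff)
  qed
  show False
  proof (cases "d N")
    \<comment> \<open>In degree 0 the vanishing of the top coefficient already gives
      \<open>h = 0\<close>, which lies in every ideal.\<close>
    case 0
    then have "h = (\<lambda>x. 0)" using h_eq top by (simp add: fun_eq_iff)
    then show False using hg fun_ideal_zero by metis
  next
    case (Suc m)
    then have "h = (\<lambda>x. \<Sum>k\<le>m. e k x * x $ j ^ k)" using h_eq top by (simp add: fun_eq_iff)
    then have "deg h \<le> m" using e_poly by (intro deg_le) (auto simp: poly_rep_def)
    then show False using gmin[OF hI hg] Suc by (simp add: d_def)
  qed
qed

lemma noetherian_polys_empty: "noetherian_polys {}"
  unfolding noetherian_polys_def
proof (intro allI impI)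
  fix a :: "nat \<Rightarrow> complex ^ 'n \<Rightarrow> complex" assume "\<forall>i. polys_in {} (a i)"
  then have "\<forall>i. \<exists>c. a i = (\<lambda>_. c)"
  proof (intro allI)
    fix i
    have "polys_in {} (a i)" using \<open>\<forall>i. polys_in {} (a i)\<close> by blast
    then show "\<exists>c. a i = (\<lambda>_. c)" by induction auto
  qed
  then obtain c where c: "\<And>i. a i = (\<lambda>_. c i)" by metis
  show "\<exists>N. a N \<in> fun_ideal {} a N"
  proof (cases "c 0 = 0")
    case True
    then show ?thesis by (intro exI[of _ 0]) (simp add: c fun_ideal_zero)
  next
    case False
    then show ?thesis
      by (intro exI[of _ 1] fun_idealI[of _ "\<lambda>_ _. c 1 / c 0"]) (auto simp: c intro: polys_in.const)
  qed
qed

theorem noetherian_polys: "noetherian_polys (J :: 'n::finite set)"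
  using finite[of J] by (induction J rule: finite_induct) (auto intro: noetherian_polys_empty hilbert_basis_step)

text \<open>Otherwise equations could be chosen one after another, each nonzero at some common zero
  of its predecessors. No term of such a sequence lies in the ideal of the preceding ones.\<close>

theorem algebraic_set_finite:
  assumes "algebraic_set X"
  shows "\<exists>P. finite P \<and> (\<forall>p\<in>P. complex_polynomial_function p) \<and> X = {x. \<forall>p\<in>P. p x = 0}"
proof (rule ccontr)
  assume no: "\<not> ?thesis"
  obtain P where P: "\<forall>p\<in>P. complex_polynomial_function p" "X = {x. \<forall>p\<in>P. p x = 0}"
    using assms by (auto simp: algebraic_set_def)
  define R where "R a N y \<longleftrightarrow> y \<in> P \<and> (\<exists>x. (\<forall>i<N. a i x = 0) \<and> y x \<noteq> 0)" for a :: "nat \<Rightarrow> complex ^ 'a \<Rightarrow> complex" and N :: nat and y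
  have "\<exists>a. \<forall>N. R a N (a N)"
  proof (rule dependent_wf_choice[OF wf_less_than])
    fix a b :: "nat \<Rightarrow> complex ^ 'a \<Rightarrow> complex" and N y
    assume "\<And>z. (z, N) \<in> less_than \<Longrightarrow> a z = b z"
    then show "R a N y = R b N y" by (auto simp: R_def)
  next
    fix N and a :: "nat \<Rightarrow> complex ^ 'a \<Rightarrow> complex"
    assume "\<And>i. (i, N) \<in> less_than \<Longrightarrow> R a i (a i)"
    then have aP: "a ` {..<N} \<subseteq> P" by (auto simp: R_def)
    then have "X \<noteq> {x. \<forall>p\<in>a ` {..<N}. p x = 0}" using no P(1) by blast
    then obtain x where "x \<notin> X" "\<forall>i<N. a i x = 0" using aP P(2) by blast
    then show "\<exists>y. R a N y" using P(2) by (auto simp: R_def)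
  qed
  then obtain a where a: "\<And>N. R a N (a N)" by blast
  then have "\<forall>i. polys_in UNIV (a i)" using P(1) by (auto simp: R_def polys_in_UNIV)
  then obtain N r where "a N = (\<lambda>x. \<Sum>i<N. r i x * a i x)"
    using noetherian_polys[of UNIV] unfolding noetherian_polys_def fun_ideal_def by blast
  then show False using a[of N] by (auto simp: R_def)
qed

section \<open>Algebraic sets are semialgebraic\<close>

lemma bounded_linear_Re_nth: "bounded_linear (\<lambda>x :: complex ^ 'n. Re (x $ i))"
  by (intro bounded_linear_compose[OF bounded_linear_Re] bounded_linear_vec_nth)

lemma bounded_linear_Im_nth: "bounded_linear (\<lambda>x :: complex ^ 'n. Im (x $ i))"
  by (intro bounded_linear_compose[OF bounded_linear_Im] bounded_linear_vec_nth)

lemma cpf_real_parts: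
  assumes "complex_polynomial_function p"
  shows "real_polynomial_function (\<lambda>x. Re (p x)) \<and> real_polynomial_function (\<lambda>x. Im (p x))"
  using assms
proof induction
  case (coord i)
  then show ?case using bounded_linear_Re_nth bounded_linear_Im_nth real_polynomial_function.intros(1) by blast
next
  case (const c)
  then show ?case by (simp add: rpf_const)
next
  case (add p q)
  then show ?case by (simp add: rpf_add)
next
  case (mult p q)
  then show ?case by (auto intro!: rpf_add real_polynomial_function_diff rpf_mult)
qed

theorem algebraic_imp_semialgebraic:
  assumes "algebraic_set X"
  shows "semialgebraic_set X"
proof -
  obtain P where P: "finite P" "\<forall>p\<in>P. complex_polynomial_function p" "X = {x. \<forall>p\<in>P. p x = 0}"
    using algebraic_set_finite[OF assms] by blast
  have "X = (\<Inter>p\<in>P. {x. Re (p x) = 0} \<inter> {x. Im (p x) = 0})" using P(3) by (auto simp: complex_eq_iff)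
  also have "semialgebraic_set \<dots>"
    using P cpf_real_parts by (intro semialgebraic_Inter semialgebraic_set.Int semialgebraic_set.eq) auto
  finally show ?thesis .
qed

lemma cpf_map_polynomial_function:
  fixes \<phi> :: "complex ^ 'n \<Rightarrow> complex ^ 'm"
  assumes "\<And>i. complex_polynomial_function (\<lambda>x. \<phi> x $ i)"
  shows "polynomial_function \<phi>"
  unfolding polynomial_function_iff_Basis_inner
proof
  fix b :: "complex ^ 'm" assume "b \<in> Basis"
  then obtain i where "b = axis i 1 \<or> b = axis i \<i>" by (auto simp: Basis_vec_def Basis_complex_def)
  then have "(\<lambda>x. \<phi> x \<bullet> b) = (\<lambda>x. Re (\<phi> x $ i)) \<or> (\<lambda>x. \<phi> x \<bullet> b) = (\<lambda>x. Im (\<phi> x $ i))"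
    by (auto simp: inner_axis fun_eq_iff)
  then show "real_polynomial_function (\<lambda>x. \<phi> x \<bullet> b)" using cpf_real_parts[OF assms] by auto
qed

section \<open>Semialgebraic extension of small displacements\<close>

lemma polynomial_function_linear: "bounded_linear f \<Longrightarrow> polynomial_function f"
  by (rule polynomial_function_bounded_linear)

lemma semialgebraic_singleton_0: "semialgebraic_set {0 :: 'a::euclidean_space}"
proof -
  have "{0 :: 'a} = (\<Inter>b\<in>Basis. {x. x \<bullet> b = 0})" by (auto simp: euclidean_all_zero_iff)
  also have "semialgebraic_set \<dots>"
    by (intro semialgebraic_Inter semialgebraic_set.eq real_polynomial_function.intros(1) bounded_linear_inner_left) auto
  finally show ?thesis .
qed

lemma semialgebraic_map_linear:
  fixes f :: "'a::euclidean_space \<Rightarrow> 'b::euclidean_space"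
  assumes "bounded_linear f"
  shows "semialgebraic_map f"
proof -
  have "bounded_linear (\<lambda>z :: 'a \<times> 'b. snd z - f (fst z))"
    by (intro bounded_linear_sub bounded_linear_snd bounded_linear_compose[OF assms] bounded_linear_fst)
  from semialgebraic_vimage[OF semialgebraic_singleton_0 polynomial_function_linear[OF this]]
  have "semialgebraic_set {z :: 'a \<times> 'b. snd z - f (fst z) \<in> {0}}" .
  moreover have "{z :: 'a \<times> 'b. snd z - f (fst z) \<in> {0}} = {(x, y). y = f x}" by auto
  ultimately show ?thesis by (simp add: semialgebraic_map_def)
qed

lemma semialgebraic_map_compose:
  fixes f :: "'a::euclidean_space \<Rightarrow> 'b::euclidean_space" and g :: "'b \<Rightarrow> 'c::euclidean_space"
  assumes "semialgebraic_map f" "semialgebraic_map g"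
  shows "semialgebraic_map (\<lambda>x. g (f x))"
proof -
  have 1: "bounded_linear (\<lambda>w :: ('a \<times> 'c) \<times> 'b. (fst (fst w), snd w))"
    by (intro bounded_linear_Pair bounded_linear_snd bounded_linear_compose[OF bounded_linear_fst bounded_linear_fst])
  have 2: "bounded_linear (\<lambda>w :: ('a \<times> 'c) \<times> 'b. (snd w, snd (fst w)))"
    by (intro bounded_linear_Pair bounded_linear_snd bounded_linear_compose[OF bounded_linear_snd bounded_linear_fst])
  let ?S = "{w :: ('a \<times> 'c) \<times> 'b. (fst (fst w), snd w) \<in> {(x, y). y = f x}} \<inter>
    {w. (snd w, snd (fst w)) \<in> {(x, y). y = g x}}"
  have "semialgebraic_set ?S"
    using assms unfolding semialgebraic_map_def
    by (intro semialgebraic_set.Int semialgebraic_vimage polynomial_function_linear 1 2)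
  from semialgebraic_Ex[OF this]
  have "semialgebraic_set {z. \<exists>y. (z, y) \<in> ?S}" .
  moreover have "{z. \<exists>y. (z, y) \<in> ?S} = {(x, z). z = g (f x)}" by auto
  ultimately show ?thesis by (simp add: semialgebraic_map_def)
qed

lemma semialgebraic_map_inverse:
  fixes f :: "'a::euclidean_space \<Rightarrow> 'b::euclidean_space"
  assumes "semialgebraic_map f" "\<And>x. h (f x) = x" "\<And>y. f (h y) = y"
  shows "semialgebraic_map h"
proof -
  have "bounded_linear (\<lambda>w :: 'b \<times> 'a. (snd w, fst w))"
    by (intro bounded_linear_Pair bounded_linear_snd bounded_linear_fst)
  from semialgebraic_vimage[OF _ polynomial_function_linear[OF this]]
  have "semialgebraic_set {w :: 'b \<times> 'a. (snd w, fst w) \<in> {(x, y). y = f x}}"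
    using assms(1) by (simp only: semialgebraic_map_def)
  moreover have "{w :: 'b \<times> 'a. (snd w, fst w) \<in> {(x, y). y = f x}} = {(x, y). y = h x}"
    using assms(2,3) by auto
  ultimately show ?thesis by (simp add: semialgebraic_map_def)
qed

lemma bi_lipschitz_semialgebraic_homeomorphismI:
  assumes "\<And>x. \<Psi> (\<Phi> x) = x" "\<And>y. \<Phi> (\<Psi> y) = y" "L-lipschitz_on UNIV \<Phi>" "M-lipschitz_on UNIV \<Psi>"
    "semialgebraic_map \<Phi>"
  shows "bi_lipschitz_semialgebraic_homeomorphism \<Phi>"
proof -
  have "homeomorphism UNIV UNIV \<Phi> \<Psi>"
    using assms(1-4) by (intro homeomorphismI lipschitz_on_continuous_on) auto
  then show ?thesis using assms(3-5) unfolding bi_lipschitz_semialgebraic_homeomorphism_def by blast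
qed

lemma bi_lipschitz_semialgebraic_homeomorphismE:
  assumes "bi_lipschitz_semialgebraic_homeomorphism \<Phi>"
  obtains \<Psi> L M where "\<And>x. \<Psi> (\<Phi> x) = x" "\<And>y. \<Phi> (\<Psi> y) = y" "L-lipschitz_on UNIV \<Phi>" "M-lipschitz_on UNIV \<Psi>"
    "semialgebraic_map \<Phi>"
  using assms unfolding bi_lipschitz_semialgebraic_homeomorphism_def homeomorphism_def by blast

lemma bi_lipschitz_semialgebraic_homeomorphism_compose:
  assumes "bi_lipschitz_semialgebraic_homeomorphism \<Phi>" "bi_lipschitz_semialgebraic_homeomorphism \<Phi>'"
  shows "bi_lipschitz_semialgebraic_homeomorphism (\<lambda>x. \<Phi>' (\<Phi> x))"
proof -
  obtain \<Psi> L M where 1: "\<And>x. \<Psi> (\<Phi> x) = x" "\<And>y. \<Phi> (\<Psi> y) = y" "L-lipschitz_on UNIV \<Phi>" "M-lipschitz_on UNIV \<Psi>"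
    "semialgebraic_map \<Phi>" using bi_lipschitz_semialgebraic_homeomorphismE[OF assms(1)] by blast
  obtain \<Psi>' L' M' where 2: "\<And>x. \<Psi>' (\<Phi>' x) = x" "\<And>y. \<Phi>' (\<Psi>' y) = y" "L'-lipschitz_on UNIV \<Phi>'" "M'-lipschitz_on UNIV \<Psi>'"
    "semialgebraic_map \<Phi>'" using bi_lipschitz_semialgebraic_homeomorphismE[OF assms(2)] by blast
  have "(L' * L)-lipschitz_on UNIV (\<lambda>x. \<Phi>' (\<Phi> x))" "(M * M')-lipschitz_on UNIV (\<lambda>x. \<Psi> (\<Psi>' x))"
    by (rule lipschitz_on_compose2[OF 1(3) lipschitz_on_subset[OF 2(3) subset_UNIV]]
        lipschitz_on_compose2[OF 2(4) lipschitz_on_subset[OF 1(4) subset_UNIV]])+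
  then show ?thesis
    using 1 2 semialgebraic_map_compose[OF 1(5) 2(5)]
    by (intro bi_lipschitz_semialgebraic_homeomorphismI[of "\<lambda>x. \<Psi> (\<Psi>' x)"]) auto
qed

lemma bi_lipschitz_semialgebraic_homeomorphism_inverse:
  assumes "bi_lipschitz_semialgebraic_homeomorphism \<Phi>"
  shows "\<exists>\<Psi>. bi_lipschitz_semialgebraic_homeomorphism \<Psi> \<and> (\<forall>x. \<Psi> (\<Phi> x) = x)"
proof -
  obtain \<Psi> L M where 1: "\<And>x. \<Psi> (\<Phi> x) = x" "\<And>y. \<Phi> (\<Psi> y) = y" "L-lipschitz_on UNIV \<Phi>" "M-lipschitz_on UNIV \<Psi>"
    "semialgebraic_map \<Phi>" using bi_lipschitz_semialgebraic_homeomorphismE[OF assms] by blast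
  then have "bi_lipschitz_semialgebraic_homeomorphism \<Psi>"
    using semialgebraic_map_inverse[OF 1(5), of \<Psi>] by (intro bi_lipschitz_semialgebraic_homeomorphismI[of \<Phi>]) auto
  then show ?thesis using 1 by blast
qed

lemma bi_lipschitz_semialgebraic_homeomorphism_linear:
  assumes "bounded_linear \<Phi>" "bounded_linear \<Psi>" "\<And>x. \<Psi> (\<Phi> x) = x" "\<And>y. \<Phi> (\<Psi> y) = y"
  shows "bi_lipschitz_semialgebraic_homeomorphism \<Phi>"
proof -
  obtain L M where "L-lipschitz_on UNIV \<Phi>" "M-lipschitz_on UNIV \<Psi>"
    using bounded_linear.lipschitz_boundE[OF assms(1)] bounded_linear.lipschitz_boundE[OF assms(2)] by metis
  then show ?thesis
    using assms semialgebraic_map_linear by (intro bi_lipschitz_semialgebraic_homeomorphismI[of \<Psi> \<Phi> L M]) auto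
qed

text \<open>The function being extended lives on the image of \<open>F\<close>, but both the points
  and the values are parametrized by \<open>X\<close>. No inverse of \<open>F\<close> occurs, so for
  polynomial \<open>F\<close> and \<open>G\<close> the formula remains first order over polynomial
  data.\<close>

definition mcshane_extension ::
    "'c set \<Rightarrow> real \<Rightarrow> ('c \<Rightarrow> 'a::metric_space) \<Rightarrow> ('c \<Rightarrow> real) \<Rightarrow> 'a \<Rightarrow> real" where
  "mcshane_extension X l F G u = (INF x\<in>X. G x + l * dist u (F x))"

context
  fixes X :: "'c set" and l :: real and F :: "'c \<Rightarrow> 'a::metric_space" and G :: "'c \<Rightarrow> real"
  assumes ne: "X \<noteq> {}" and l: "l \<ge> 0"
    and lip: "\<And>x y. x \<in> X \<Longrightarrow> y \<in> X \<Longrightarrow> \<bar>G x - G y\<bar> \<le> l * dist (F x) (F y)"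
begin

lemma mcshane_bdd: "bdd_below ((\<lambda>x. G x + l * dist u (F x)) ` X)"
proof -
  obtain x0 where x0: "x0 \<in> X" using ne by blast
  have "G x0 - l * dist u (F x0) \<le> G x + l * dist u (F x)" if "x \<in> X" for x
  proof -
    have "l * dist (F x0) (F x) \<le> l * (dist u (F x0) + dist u (F x))"
      using dist_triangle3[of "F x0" "F x" u] by (intro mult_left_mono l) auto
    then show ?thesis using lip[OF x0 that] by (simp add: distrib_left)
  qed
  then show ?thesis by (auto intro!: bdd_belowI)
qed

lemma mcshane_less_iff: "mcshane_extension X l F G u < y \<longleftrightarrow> (\<exists>x\<in>X. G x + l * dist u (F x) < y)"
  unfolding mcshane_extension_def by (rule cINF_less_iff[OF ne mcshane_bdd])

lemma mcshane_le: "x \<in> X \<Longrightarrow> mcshane_extension X l F G u \<le> G x + l * dist u (F x)"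
  unfolding mcshane_extension_def by (rule cINF_lower[OF mcshane_bdd])

lemma mcshane_ge: "(\<And>x. x \<in> X \<Longrightarrow> y \<le> G x + l * dist u (F x)) \<Longrightarrow> y \<le> mcshane_extension X l F G u"
  unfolding mcshane_extension_def by (rule cINF_greatest[OF ne])

lemma mcshane_extends:
  assumes "x \<in> X"
  shows "mcshane_extension X l F G (F x) = G x"
proof (rule antisym)
  show "mcshane_extension X l F G (F x) \<le> G x" using mcshane_le[OF assms, of "F x"] by simp
  show "G x \<le> mcshane_extension X l F G (F x)"
  proof (rule mcshane_ge)
    fix y assume "y \<in> X"
    then show "G x \<le> G y + l * dist (F x) (F y)" using lip[OF assms] by (smt (verit))
  qed
qed

lemma mcshane_lipschitz: "\<bar>mcshane_extension X l F G u - mcshane_extension X l F G v\<bar> \<le> l * dist u v"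
proof -
  have "mcshane_extension X l F G u - l * dist u v \<le> mcshane_extension X l F G v" for u v
  proof (rule mcshane_ge)
    fix x assume x: "x \<in> X"
    have "l * dist u (F x) \<le> l * (dist u v + dist v (F x))"
      by (intro mult_left_mono l dist_triangle)
    then show "mcshane_extension X l F G u - l * dist u v \<le> G x + l * dist v (F x)"
      using mcshane_le[OF x, of u] by (simp add: distrib_left)
  qed
  from this[of u v] this[of v u] show ?thesis by (simp add: dist_commute abs_le_iff)
qed

end

text \<open>The infimum itself is not a polynomial condition, but the strict sublevel set
  \<open>H u < y\<close> is a projection of one. The graph is recovered from it with one universal
  quantifier.\<close>

lemma mcshane_semialgebraic:
  fixes X :: "'c::euclidean_space set" and F :: "'c \<Rightarrow> 'a::euclidean_space"
  assumes ne: "X \<noteq> {}" and l: "l \<ge> 0"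
    and lip: "\<And>x y. x \<in> X \<Longrightarrow> y \<in> X \<Longrightarrow> \<bar>G x - G y\<bar> \<le> l * dist (F x) (F y)"
    and X: "semialgebraic_set X" and F: "polynomial_function F" and G: "real_polynomial_function G"
  shows "semialgebraic_map (mcshane_extension X l F G)"
proof -
  define H where "H = mcshane_extension X l F G"
  have less: "H u < y \<longleftrightarrow> (\<exists>x\<in>X. G x + l * dist u (F x) < y)" for u y
    unfolding H_def by (rule mcshane_less_iff[OF ne l lip])
  \<comment> \<open>The variable \<open>snd w\<close> stands for the distance, which is not
    polynomial but is determined by its square and by being nonnegative.\<close>
  define A where "A = {w :: (('a \<times> real) \<times> 'c) \<times> real. snd (fst w) \<in> X} \<inter> - {w. - snd w > 0} \<inter>
    {w. (snd w)\<^sup>2 - (\<Sum>b\<in>Basis. ((fst (fst (fst w)) - F (snd (fst w))) \<bullet> b)\<^sup>2) = 0} \<inter>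
    {w. snd (fst (fst w)) - (G (snd (fst w)) + l * snd w) > 0}"
  have lin: "bounded_linear (\<lambda>w :: (('a \<times> real) \<times> 'c) \<times> real. snd (fst w))"
    "bounded_linear (\<lambda>w :: (('a \<times> real) \<times> 'c) \<times> real. fst (fst (fst w)))"
    "bounded_linear (\<lambda>w :: (('a \<times> real) \<times> 'c) \<times> real. snd (fst (fst w)))"
    "bounded_linear (\<lambda>w :: (('a \<times> real) \<times> 'c) \<times> real. snd w)"
    by (intro bounded_linear_snd bounded_linear_compose[OF bounded_linear_snd] bounded_linear_compose[OF bounded_linear_fst] bounded_linear_fst)+
  have "semialgebraic_set A"
    unfolding A_def
  proof (intro semialgebraic_set.Int semialgebraic_set.Compl semialgebraic_set.eq semialgebraic_set.gt
      semialgebraic_vimage[OF X] polynomial_function_linear lin(1))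
    show "real_polynomial_function (\<lambda>w :: (('a \<times> real) \<times> 'c) \<times> real. - snd w)"
      by (intro real_polynomial_function_minus real_polynomial_function.intros(1) lin)
    have "polynomial_function (F \<circ> (\<lambda>w :: (('a \<times> real) \<times> 'c) \<times> real. snd (fst w)))"
      by (rule polynomial_function_compose[OF polynomial_function_linear[OF lin(1)] F])
    then have pF: "polynomial_function (\<lambda>w :: (('a \<times> real) \<times> 'c) \<times> real. F (snd (fst w)))" by (simp add: o_def)
    have pb: "real_polynomial_function (\<lambda>w :: (('a \<times> real) \<times> 'c) \<times> real. (fst (fst (fst w)) - F (snd (fst w))) \<bullet> b)" for b
      unfolding real_polynomial_function_eq
      by (intro polynomial_function_inner polynomial_function_diff pF polynomial_function_linear lin)
    show "real_polynomial_function (\<lambda>w :: (('a \<times> real) \<times> 'c) \<times> real.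
        (snd w)\<^sup>2 - (\<Sum>b\<in>Basis. ((fst (fst (fst w)) - F (snd (fst w))) \<bullet> b)\<^sup>2))"
      by (intro real_polynomial_function_diff real_polynomial_function_power real_polynomial_function_sum pb
          finite_Basis real_polynomial_function.intros(1) lin)
    have "real_polynomial_function (G \<circ> (\<lambda>w :: (('a \<times> real) \<times> 'c) \<times> real. snd (fst w)))"
      by (rule real_polynomial_function_compose[OF polynomial_function_linear[OF lin(1)] G])
    then have pG: "real_polynomial_function (\<lambda>w :: (('a \<times> real) \<times> 'c) \<times> real. G (snd (fst w)))" by (simp add: o_def)
    show "real_polynomial_function (\<lambda>w :: (('a \<times> real) \<times> 'c) \<times> real.
        snd (fst (fst w)) - (G (snd (fst w)) + l * snd w))"
      by (intro real_polynomial_function_diff rpf_add pG rpf_mult rpf_const real_polynomial_function.intros(1) lin)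
  qed
  from semialgebraic_Ex[OF semialgebraic_Ex[OF this]]
  have "semialgebraic_set {z. \<exists>x. (z, x) \<in> {y. \<exists>r. (y, r) \<in> A}}" .
  moreover have "{z. \<exists>x. (z, x) \<in> {y. \<exists>r. (y, r) \<in> A}} = {(u, y). H u < y}"
  proof -
    have sq: "(\<Sum>b\<in>Basis. ((u - F x) \<bullet> b)\<^sup>2) = (dist u (F x))\<^sup>2" for u x
    proof -
      have "(dist u (F x))\<^sup>2 = (u - F x) \<bullet> (u - F x)" by (simp add: dist_norm power2_norm_eq_inner)
      also have "\<dots> = (\<Sum>b\<in>Basis. ((u - F x) \<bullet> b) * ((u - F x) \<bullet> b))" by (rule euclidean_inner)
      finally show ?thesis by (simp add: power2_eq_square)
    qed
    have "(\<exists>r. (((u, y), x), r) \<in> A) \<longleftrightarrow> x \<in> X \<and> G x + l * dist u (F x) < y" for u y x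
    proof -
      have "r = dist u (F x)" if "0 \<le> r" "r\<^sup>2 = (dist u (F x))\<^sup>2" for r
        using that by (simp add: power2_eq_iff_nonneg)
      then show ?thesis unfolding A_def
        by (auto simp: sq not_less intro!: exI[of _ "dist u (F x)"])
    qed
    then have "(\<exists>x. ((u, y), x) \<in> {y. \<exists>r. (y, r) \<in> A}) \<longleftrightarrow> H u < y" for u y
      unfolding less by (simp add: Bex_def)
    then show ?thesis by auto
  qed
  ultimately have V: "semialgebraic_set {(u, y). H u < y}" by simp
  have l1: "bounded_linear (\<lambda>w :: ('a \<times> real) \<times> real. (fst (fst w), snd w))"
    by (intro bounded_linear_Pair bounded_linear_snd bounded_linear_compose[OF bounded_linear_fst bounded_linear_fst])
  have l2: "bounded_linear (\<lambda>w :: ('a \<times> real) \<times> real. snd w - snd (fst w))"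
    by (intro bounded_linear_sub bounded_linear_snd bounded_linear_compose[OF bounded_linear_snd bounded_linear_fst])
  \<comment> \<open>\<open>?W\<close> says that every \<open>t > y\<close> exceeds
    \<open>H u\<close>; together with \<open>\<not> H u < y\<close> this pins down
    \<open>y = H u\<close>.\<close>
  let ?W = "- {w :: ('a \<times> real) \<times> real. snd w - snd (fst w) > 0} \<union> {w. (fst (fst w), snd w) \<in> {(u, y). H u < y}}"
  have "semialgebraic_set ?W"
    by (intro semialgebraic_set.Un semialgebraic_set.Compl semialgebraic_set.gt real_polynomial_function.intros(1)
        l2 semialgebraic_vimage[OF V] polynomial_function_linear l1)
  from semialgebraic_set.Int[OF semialgebraic_set.Compl[OF V] semialgebraic_All[OF this]]
  have "semialgebraic_set (- {(u, y). H u < y} \<inter> {z. \<forall>t. (z, t) \<in> ?W})" .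
  moreover have "- {(u, y). H u < y} \<inter> {z. \<forall>t. (z, t) \<in> ?W} = {(u, y). y = H u}"
  proof -
    have "y = H u" if "\<not> H u < y" "\<forall>t. y < t \<longrightarrow> H u < t" for u y
      using that by (metis less_irrefl linorder_neqE_linordered_idom)
    then show ?thesis by auto
  qed
  ultimately show ?thesis by (simp add: semialgebraic_map_def H_def)
qed

text \<open>Solving \<open>x + H x = y\<close> amounts to finding the fixed point of the contraction
  that sends \<open>x\<close> to \<open>y - H x\<close>. The contraction constant
  \<open>1 / 2\<close> gives the inverse the Lipschitz constant 2.\<close>

lemma perturbation_homeomorphism:
  fixes H :: "'a::euclidean_space \<Rightarrow> 'a"
  assumes H: "\<And>x y. norm (H x - H y) \<le> 1 / 2 * norm (x - y)" and S: "semialgebraic_map (\<lambda>x. x + H x)"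
  shows "bi_lipschitz_semialgebraic_homeomorphism (\<lambda>x. x + H x)"
proof -
  have "\<exists>!x. y - H x = x" for y
    using H by (intro banach_fix_type[of "1 / 2"]) (auto simp: dist_norm norm_minus_commute)
  then have ex: "\<exists>!x. x + H x = y" for y by (simp add: algebra_simps) (metis diff_add_cancel add.commute)
  define \<Psi> where "\<Psi> y = (THE x. x + H x = y)" for y
  have \<Psi>: "\<Psi> y + H (\<Psi> y) = y" for y unfolding \<Psi>_def by (rule theI'[OF ex])
  have inv: "\<Psi> (x + H x) = x" for x using ex[of "x + H x"] \<Psi>[of "x + H x"] by blast
  have "(3 / 2)-lipschitz_on UNIV (\<lambda>x. x + H x)"
  proof (rule lipschitz_onI)
    fix x y
    have "norm ((x - y) + (H x - H y)) \<le> norm (x - y) + norm (H x - H y)" by (rule norm_triangle_ineq)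
    also have "\<dots> \<le> 3 / 2 * norm (x - y)" using H[of x y] by simp
    finally show "dist (x + H x) (y + H y) \<le> 3 / 2 * dist x y" by (simp add: dist_norm algebra_simps)
  qed simp
  moreover have "2-lipschitz_on UNIV \<Psi>"
  proof (rule lipschitz_onI)
    fix u v
    have "norm (\<Psi> u - \<Psi> v) = norm ((u - v) - (H (\<Psi> u) - H (\<Psi> v)))"
      by (metis (no_types, lifting) \<Psi> add_diff_add add_diff_cancel_right')
    also have "\<dots> \<le> norm (u - v) + norm (H (\<Psi> u) - H (\<Psi> v))" by (rule norm_triangle_ineq4)
    finally show "dist (\<Psi> u) (\<Psi> v) \<le> 2 * dist u v" using H[of "\<Psi> u" "\<Psi> v"] by (simp add: dist_norm)
  qed simp
  ultimately show ?thesis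
    using inv \<Psi> S by (intro bi_lipschitz_semialgebraic_homeomorphismI[of \<Psi>]) auto
qed

text \<open>Close embeddings are ambient equivalent: the displacement extends to a contraction.\<close>

theorem small_displacement_homeomorphism:
  fixes X :: "'c::euclidean_space set" and F G :: "'c \<Rightarrow> 'a::euclidean_space"
  assumes X: "semialgebraic_set X" "X \<noteq> {}" and F: "polynomial_function F" and G: "polynomial_function G"
    and close: "\<And>x y. x \<in> X \<Longrightarrow> y \<in> X \<Longrightarrow> norm ((G x - F x) - (G y - F y)) \<le> e * norm (F x - F y)"
    and e: "e \<ge> 0" "e * real DIM('a) \<le> 1 / 2"
  shows "\<exists>\<Phi>. bi_lipschitz_semialgebraic_homeomorphism \<Phi> \<and> (\<forall>x\<in>X. G x = \<Phi> (F x))"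
proof -
  \<comment> \<open>Each real coordinate of the displacement is extended separately. Summing over
    the coordinates costs the factor \<open>DIM('a)\<close> in the smallness assumption.\<close>
  define h where "h b = mcshane_extension X e F (\<lambda>x. (G x - F x) \<bullet> b)" for b
  have lip: "\<bar>(G x - F x) \<bullet> b - (G y - F y) \<bullet> b\<bar> \<le> e * dist (F x) (F y)"
    if "x \<in> X" "y \<in> X" "b \<in> Basis" for x y b
    using Basis_le_norm[OF that(3), of "(G x - F x) - (G y - F y)"] close[OF that(1,2)]
    by (simp add: inner_diff_left dist_norm)
  have hlip: "\<bar>h b u - h b v\<bar> \<le> e * dist u v" if "b \<in> Basis" for b u v
    unfolding h_def by (rule mcshane_lipschitz[OF X(2) e(1) lip[OF _ _ that]])
  have hF: "h b (F x) = (G x - F x) \<bullet> b" if "b \<in> Basis" "x \<in> X" for b x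
    unfolding h_def by (rule mcshane_extends[OF X(2) e(1) lip[OF _ _ that(1)] that(2)])
  have hs: "semialgebraic_map (h b)" if "b \<in> Basis" for b
    unfolding h_def
  proof (rule mcshane_semialgebraic[OF X(2) e(1) lip[OF _ _ that] X(1) F])
    show "real_polynomial_function (\<lambda>x. (G x - F x) \<bullet> b)"
      unfolding real_polynomial_function_eq by (intro polynomial_function_inner polynomial_function_diff F G)
  qed
  define H where "H u = (\<Sum>b\<in>Basis. h b u *\<^sub>R b)" for u
  have Hb: "H u \<bullet> b = h b u" if "b \<in> Basis" for u b using that by (simp add: H_def)
  have "norm (H u - H v) \<le> 1 / 2 * norm (u - v)" for u v
  proof -
    have "norm (H u - H v) \<le> (\<Sum>b\<in>Basis. \<bar>(H u - H v) \<bullet> b\<bar>)" by (rule norm_le_l1)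
    also have "\<dots> \<le> (\<Sum>b\<in>(Basis :: 'a set). e * norm (u - v))"
      using hlip by (intro sum_mono) (auto simp: inner_diff_left Hb dist_norm)
    also have "\<dots> = e * real DIM('a) * norm (u - v)" by simp
    also have "\<dots> \<le> 1 / 2 * norm (u - v)" by (intro mult_right_mono e) auto
    finally show ?thesis .
  qed
  moreover have "semialgebraic_map (\<lambda>u. u + H u)"
  proof -
    have lin: "bounded_linear (\<lambda>w :: 'a \<times> 'a. (fst w, (snd w - fst w) \<bullet> b))" for b
      by (intro bounded_linear_Pair bounded_linear_fst bounded_linear_inner_left_comp bounded_linear_sub bounded_linear_snd)
    have "semialgebraic_set (\<Inter>b\<in>Basis. {w :: 'a \<times> 'a. (fst w, (snd w - fst w) \<bullet> b) \<in> {(u, y). y = h b u}})"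
      using hs unfolding semialgebraic_map_def
      by (intro semialgebraic_Inter semialgebraic_vimage polynomial_function_linear lin) auto
    moreover have "(\<Inter>b\<in>Basis. {w :: 'a \<times> 'a. (fst w, (snd w - fst w) \<bullet> b) \<in> {(u, y). y = h b u}}) = {(u, v). v = u + H u}"
    proof -
      have "v = u + H u \<longleftrightarrow> (\<forall>b\<in>Basis. (v - u) \<bullet> b = h b u)" for u v
        by (subst euclidean_eq_iff) (auto simp: inner_add_left inner_diff_left Hb algebra_simps)
      then show ?thesis by auto
    qed
    ultimately show ?thesis by (simp add: semialgebraic_map_def)
  qed
  ultimately have "bi_lipschitz_semialgebraic_homeomorphism (\<lambda>u. u + H u)"
    by (rule perturbation_homeomorphism)
  moreover have "G x = F x + H (F x)" if "x \<in> X" for x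
    by (subst euclidean_eq_iff) (simp add: inner_add_left Hb hF that inner_diff_left)
  ultimately show ?thesis by blast
qed

section \<open>Uniqueness of embeddings\<close>

text \<open>Matrices are stored as vectors indexed by pairs, so that polynomial functions and growth
  apply to spaces of matrices.\<close>

definition index_matrix :: "complex ^ ('m \<times> 'm) \<Rightarrow> complex ^ 'm ^ 'm" where
  "index_matrix A = (\<chi> i l. A $ (i, l))"

lemma index_matrix_mult_nth: "(index_matrix A *v y) $ i = (\<Sum>l\<in>UNIV. A $ (i, l) * y $ l)"
  by (simp add: index_matrix_def matrix_vector_mult_def)

lemma index_matrix_scale: "index_matrix (t *s A) *v y = t *s (index_matrix A *v y)"
  by (simp add: vec_eq_iff index_matrix_mult_nth sum_distrib_left mult.assoc)

lemma cpf_nonzero_common_family: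
  fixes Q :: "'j \<Rightarrow> complex ^ 'n \<Rightarrow> complex"
  assumes "finite S" "\<And>j. j \<in> S \<Longrightarrow> complex_polynomial_function (Q j)" "\<And>j. j \<in> S \<Longrightarrow> \<exists>a. Q j a \<noteq> 0"
  shows "\<exists>a. (\<Prod>j\<in>S. Q j a) \<noteq> 0"
  using assms
proof (induction S rule: finite_induct)
  case (insert j S)
  then obtain a b where "(\<Prod>j\<in>S. Q j a) \<noteq> 0" "Q j b \<noteq> 0" by blast
  moreover have "complex_polynomial_function (\<lambda>x. \<Prod>j\<in>S. Q j x)" using insert.prems by (intro cpf_prod) auto
  moreover have "x \<in> coord_space UNIV" for x :: "complex ^ 'n" by (simp add: coord_space_def)
  ultimately obtain c where "Q j c \<noteq> 0" "(\<Prod>j\<in>S. Q j c) \<noteq> 0"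
    using cpf_nonzero_common[of "Q j" "\<lambda>x. \<Prod>j\<in>S. Q j x" b UNIV a] insert.prems by auto
  then show ?case using insert.hyps by (intro exI[of _ c]) simp
qed simp

lemma pdeg_uniform:
  fixes f :: "complex ^ 'n \<Rightarrow> complex ^ 'm"
  assumes "\<And>i. complex_polynomial_function (\<lambda>x. f x $ i)"
  shows "\<exists>e. \<forall>i. pdeg e (\<lambda>x. f x $ i)"
proof -
  have "\<forall>i. \<exists>e. pdeg e (\<lambda>x. f x $ i)" using cpf_imp_pdeg assms by blast
  then obtain e where e: "\<And>i. pdeg (e i) (\<lambda>x. f x $ i)" by metis
  have "e i \<le> Max (range e)" for i by (rule Max_ge) auto
  then show ?thesis using e pdeg_mono by blast
qed

text \<open>Matrices carrying a secant of \<open>g\<close> to the corresponding secant of \<open>f\<close>: where the \<open>j\<close>-th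
  coordinate of the secant of \<open>g\<close> does not vanish, the \<open>j\<close>-th column is determined by the secant
  and the other columns, which leaves a family of codimension \<open>m - 2k\<close>.\<close>

lemma matrix_secant_hypersurface:
  fixes f g :: "complex ^ 'n \<Rightarrow> complex ^ 'm" and j :: 'm
  assumes gr: "growth X k" and m: "2 * k < CARD('m)"
    and f: "\<And>i. complex_polynomial_function (\<lambda>x. f x $ i)"
    and g: "\<And>i. complex_polynomial_function (\<lambda>x. g x $ i)"
  shows "\<exists>Q. complex_polynomial_function Q \<and> (\<exists>A. Q A \<noteq> 0) \<and>
    (\<forall>x\<in>X. \<forall>y\<in>X. \<forall>A. g x $ j \<noteq> g y $ j \<and> index_matrix A *v (g x - g y) = f x - f y \<longrightarrow> Q A = 0)"
proof -
  obtain e1 e2 where e12: "\<And>i. pdeg e1 (\<lambda>x. f x $ i)" "\<And>i. pdeg e2 (\<lambda>x. g x $ i)"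
    using pdeg_uniform[of f] pdeg_uniform[of g] f g by metis
  define e where "e = max e1 e2"
  have e: "pdeg e (\<lambda>x. f x $ i)" "pdeg e (\<lambda>x. g x $ i)" for i
    using pdeg_mono[OF e12(1), of e] pdeg_mono[OF e12(2), of e] by (simp_all add: e_def)
  define J where "J = {p :: 'm \<times> 'm. snd p \<noteq> j}"
  \<comment> \<open>Two points of \<open>X\<close> and all columns except the \<open>j\<close>-th.
    With \<open>m\<close> rows the growth exponent is \<open>2 * k + m * (m - 1)\<close>, which is
    below \<open>m * m\<close> because \<open>2 * k < m\<close>.\<close>
  define Z where "Z = vec_Times X (vec_Times X (coord_space J))"
  have Z: "growth Z (k + (k + card J))"
    unfolding Z_def by (intro growth_vec_Times gr growth_coord_space)
  have J: "J = UNIV \<times> (UNIV - {j})" by (auto simp: J_def)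
  have cJ: "card J = CARD('m) * (CARD('m) - 1)" unfolding J by (simp add: card_cartesian_product)
  have "CARD('m) * (CARD('m) - 1) + CARD('m) = CARD('m) * CARD('m)"
    using m by (cases "CARD('m)") auto
  then have lt: "k + (k + card J) < card (UNIV :: ('m \<times> 'm) set)"
    using cJ m by (simp add: card_prod)
  define px py and pA where
    "px = (vec_Inl :: complex ^ ('n + ('n + 'm \<times> 'm)) \<Rightarrow> _)"
    and "py z = vec_Inl (vec_Inr z)" and "pA z = vec_Inr (vec_Inr z)"
    for z :: "complex ^ ('n + ('n + 'm \<times> 'm))"
  define d where "d l z = g (px z) $ l - g (py z) $ l" for l z
  \<comment> \<open>Numerators over the common denominator \<open>d j\<close>: entries of column
    \<open>j\<close> are solved from the linear equations, and the free entries are multiplied by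
    \<open>d j\<close>.\<close>
  define p where "p q z = (if snd q = j
    then f (px z) $ fst q - f (py z) $ fst q - (\<Sum>l\<in>UNIV - {j}. pA z $ (fst q, l) * d l z)
    else pA z $ q * d j z)" for q z
  have dd: "pdeg e (d l)" for l
    unfolding d_def[abs_def] px_def py_def
    by (intro pdeg_diff pdeg_vec_Inl[OF e(2)] pdeg_vec_Inr[OF pdeg_vec_Inl[OF e(2)]])
  have pA: "pdeg 1 (\<lambda>z. pA z $ q)" for q
    unfolding pA_def One_nat_def by (rule pdeg_vec_Inr[OF pdeg_vec_Inr[OF pdeg.coord]])
  have "pdeg (1 + e) (p q)" for q
  proof (cases "snd q = j")
    case True
    have 0: "pdeg e (\<lambda>z. f (px z) $ fst q)" "pdeg e (\<lambda>z. f (py z) $ fst q)"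
      unfolding px_def py_def by (intro pdeg_vec_Inl[OF e(1)] pdeg_vec_Inr[OF pdeg_vec_Inl[OF e(1)]])+
    have 1: "pdeg (1 + e) (\<lambda>z. f (px z) $ fst q - f (py z) $ fst q)"
      by (rule pdeg_mono[OF pdeg_diff[OF 0]]) simp
    show ?thesis unfolding p_def[abs_def] if_P[OF True]
      by (intro pdeg_diff[OF 1] pdeg_sum pdeg.mult pA dd)
  next
    case False
    show ?thesis unfolding p_def[abs_def] if_not_P[OF False] by (intro pdeg.mult pA dd)
  qed
  moreover have "pdeg (1 + e) (d j)" by (rule pdeg_mono[OF dd]) simp
  ultimately obtain Q where Q: "complex_polynomial_function Q" "\<exists>a\<in>coord_space UNIV. Q a \<noteq> 0"
    "\<forall>z\<in>Z. d j z \<noteq> 0 \<longrightarrow> (\<forall>A. (\<forall>q\<in>UNIV. A $ q = p q z / d j z) \<longrightarrow> Q A = 0)"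
    using rational_image_in_hypersurface[OF Z _ _ lt, of "1 + e" p "d j"] by blast
  have "Q A = 0" if x: "x \<in> X" "y \<in> X" and ne: "g x $ j \<noteq> g y $ j"
    and A: "index_matrix A *v (g x - g y) = f x - f y" for x y A
  proof -
    define A0 where "A0 = (\<chi> q. if snd q = j then 0 else A $ q)"
    define z where "z = vec_pair x (vec_pair y A0)"
    have z: "px z = x" "py z = y" "pA z = A0" by (simp_all add: px_def py_def pA_def z_def)
    have "z \<in> Z" using x by (auto simp: z_def Z_def vec_Times_def coord_space_def A0_def J_def)
    moreover have dj: "d j z \<noteq> 0" using ne by (simp add: d_def z)
    moreover have "A $ q = p q z / d j z" for q
    proof (cases "snd q = j")
      case False
      then show ?thesis using dj by (simp add: p_def z A0_def)
    next
      case True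
      have "f x $ fst q - f y $ fst q = (\<Sum>l\<in>UNIV. A $ (fst q, l) * d l z)"
        using arg_cong[OF A, of "\<lambda>v. v $ fst q"] by (simp add: index_matrix_mult_nth d_def z)
      also have "\<dots> = A $ (fst q, j) * d j z + (\<Sum>l\<in>UNIV - {j}. A $ (fst q, l) * d l z)"
        by (rule sum.remove) auto
      also have "(\<Sum>l\<in>UNIV - {j}. A $ (fst q, l) * d l z) = (\<Sum>l\<in>UNIV - {j}. A0 $ (fst q, l) * d l z)"
        by (intro sum.cong) (auto simp: A0_def)
      finally have "p q z = A $ (fst q, j) * d j z" using True by (simp add: p_def z)
      moreover have "(fst q, j) = q" using True by auto
      ultimately show ?thesis using dj by simp
    qed
    ultimately show ?thesis using Q(3) by blast
  qed
  then show ?thesis using Q(1,2) by blast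
qed

lemma norm_vec_le_sum: "norm (x :: complex ^ 'n) \<le> (\<Sum>i\<in>UNIV. norm (x $ i))"
  by (simp add: norm_vec_def L2_set_le_sum)

lemma exists_large_component: "\<exists>j. norm (x :: complex ^ 'n) \<le> real CARD('n) * norm (x $ j)"
proof (rule ccontr)
  assume no: "\<not> ?thesis"
  have "(\<Sum>i\<in>UNIV. norm (x $ i)) < (\<Sum>i\<in>(UNIV :: 'n set). norm x / real CARD('n))"
    using no by (intro sum_strict_mono) (auto simp: field_simps not_le)
  also have "\<dots> = norm x" by simp
  finally show False using norm_vec_le_sum[of x] by simp
qed

text \<open>If \<open>A\<close> nearly carried a secant \<open>w\<close> of \<open>g\<close> to the
  secant \<open>v\<close> of \<open>f\<close>, a small change of one column would make it do so
  exactly, and \<open>Q\<close> would vanish too close to \<open>A\<close>. The change stays small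
  when the column belongs to a coordinate of \<open>w\<close> comparable to its norm.\<close>

lemma generic_matrix_lower_bound:
  fixes f g :: "complex ^ 'n \<Rightarrow> complex ^ 'm"
  assumes Q: "complex_polynomial_function Q" "Q A \<noteq> 0"
    and sec: "\<And>x y j B. x \<in> X \<Longrightarrow> y \<in> X \<Longrightarrow> g x $ j \<noteq> g y $ j \<Longrightarrow>
      index_matrix B *v (g x - g y) = f x - f y \<Longrightarrow> Q B = 0"
    and a: "a > 0" "\<And>x y. x \<in> X \<Longrightarrow> y \<in> X \<Longrightarrow> a * norm (f x - f y) \<le> norm (g x - g y)"
  shows "\<exists>c>0. \<forall>x\<in>X. \<forall>y\<in>X. c * norm (f x - f y) \<le> norm ((f x - f y) - index_matrix A *v (g x - g y))"
proof -
  have "isCont Q A" using cpf_continuous[OF Q(1)] by (simp add: continuous_on_eq_continuous_at)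
  then obtain \<delta> where \<delta>: "\<delta> > 0" "\<forall>u. dist u A < \<delta> \<longrightarrow> dist (Q u) (Q A) < norm (Q A)"
    using Q(2) unfolding continuous_at_eps_delta by (metis zero_less_norm_iff)
  define m where "m = real CARD('m)"
  have m: "m > 0" by (simp add: m_def)
  \<comment> \<open>One factor \<open>m\<close> is lost in passing from \<open>norm w\<close> to a
    large coordinate, the other in bounding the norm of the correction \<open>E\<close> by its
    entries.\<close>
  define c where "c = \<delta> * a / (m * m)"
  have c: "c > 0" using \<delta> a m by (simp add: c_def)
  have "c * norm (f x - f y) \<le> norm ((f x - f y) - index_matrix A *v (g x - g y))"
    if x: "x \<in> X" "y \<in> X" for x y
  proof (rule ccontr)
    assume neg: "\<not> ?thesis"
    define v where "v = f x - f y"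
    define w where "w = g x - g y"
    define u where "u = v - index_matrix A *v w"
    have less: "norm u < c * norm v" using neg by (simp add: u_def v_def w_def)
    then have v0: "norm v > 0" using c by (metis mult_zero_right norm_ge_zero not_less zero_less_norm_iff norm_zero)
    have aw: "a * norm v \<le> norm w" using a(2)[OF x] by (simp add: v_def w_def)
    obtain j where j: "norm w \<le> m * norm (w $ j)" using exists_large_component[of w] by (auto simp: m_def)
    have av: "a * norm v \<le> m * norm (w $ j)" using aw j by simp
    moreover have "a * norm v > 0" using a v0 by simp
    ultimately have wj: "norm (w $ j) > 0" using m by (metis less_le_trans zero_less_mult_pos)
    define E where "E = (\<chi> q. if snd q = j then u $ fst q / w $ j else 0)"
    have "index_matrix (A + E) *v w = v"
    proof -
      have "(\<Sum>l\<in>UNIV. E $ (i, l) * w $ l) = u $ i" for i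
      proof -
        have "(\<Sum>l\<in>UNIV. E $ (i, l) * w $ l) = (\<Sum>l\<in>UNIV. if l = j then u $ i else 0)"
          using wj by (intro sum.cong) (auto simp: E_def)
        then show ?thesis by simp
      qed
      then have "(index_matrix (A + E) *v w) $ i = (index_matrix A *v w) $ i + u $ i" for i
        by (simp add: index_matrix_mult_nth distrib_right sum.distrib)
      then show ?thesis by (simp add: vec_eq_iff u_def)
    qed
    moreover have "g x $ j \<noteq> g y $ j" using wj by (auto simp: w_def)
    ultimately have Q0: "Q (A + E) = 0" using sec[OF x, of j "A + E"] by (simp add: v_def w_def)
    have "norm E \<le> (\<Sum>q\<in>UNIV. norm (E $ q))" by (rule norm_vec_le_sum)
    also have "\<dots> = (\<Sum>i\<in>UNIV. \<Sum>l\<in>UNIV. norm (E $ (i, l)))"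
      by (simp add: UNIV_Times_UNIV[symmetric] sum.cartesian_product del: UNIV_Times_UNIV)
    also have "\<dots> = (\<Sum>i\<in>UNIV. norm (u $ i) / norm (w $ j))"
    proof (intro sum.cong refl)
      fix i :: 'm
      have "(\<Sum>l\<in>UNIV. norm (E $ (i, l))) = (\<Sum>l\<in>UNIV. if l = j then norm (u $ i) / norm (w $ j) else 0)"
        by (intro sum.cong) (auto simp: E_def norm_divide)
      then show "(\<Sum>l\<in>UNIV. norm (E $ (i, l))) = norm (u $ i) / norm (w $ j)" by simp
    qed
    also have "\<dots> \<le> (\<Sum>i\<in>(UNIV :: 'm set). norm u / norm (w $ j))"
      by (intro sum_mono divide_right_mono Finite_Cartesian_Product.norm_nth_le) auto
    also have "\<dots> = m * norm u / norm (w $ j)" by (simp add: m_def)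
    also have "\<dots> < m * (c * norm v) / norm (w $ j)"
      using less wj m by (intro divide_strict_right_mono mult_strict_left_mono) auto
    also have "\<dots> = \<delta> * (a * norm v) / (m * norm (w $ j))" using m by (simp add: c_def field_simps)
    also have "\<dots> \<le> \<delta> * (m * norm (w $ j)) / (m * norm (w $ j))"
      using av wj m \<delta> by (intro divide_right_mono mult_left_mono) auto
    also have "\<dots> = \<delta>" using wj m by simp
    finally have "dist (Q (A + E)) (Q A) < norm (Q A)" using \<delta> by (simp add: dist_norm)
    then show False using Q0 by (simp add: dist_norm)
  qed
  then show ?thesis using c by blast
qed

text \<open>Multiplying the polynomials for the separate columns gives one polynomial for all
  secants. A point where neither it nor the determinant vanishes exists; invertibility is what lets
  the pencil end at a map equivalent to \<open>g\<close>.\<close>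

lemma exists_generic_matrix:
  fixes f g :: "complex ^ 'n \<Rightarrow> complex ^ 'm"
  assumes gr: "growth X k" and m: "2 * k < CARD('m)"
    and f: "\<And>i. complex_polynomial_function (\<lambda>x. f x $ i)"
    and g: "\<And>i. complex_polynomial_function (\<lambda>x. g x $ i)"
  shows "\<exists>Q A. complex_polynomial_function Q \<and> Q A \<noteq> 0 \<and> invertible (index_matrix A) \<and>
    (\<forall>x\<in>X. \<forall>y\<in>X. \<forall>j B. g x $ j \<noteq> g y $ j \<and> index_matrix B *v (g x - g y) = f x - f y \<longrightarrow> Q B = 0)"
proof -
  have "\<forall>j. \<exists>Q. complex_polynomial_function Q \<and> (\<exists>A. Q A \<noteq> 0) \<and>
    (\<forall>x\<in>X. \<forall>y\<in>X. \<forall>A. g x $ j \<noteq> g y $ j \<and> index_matrix A *v (g x - g y) = f x - f y \<longrightarrow> Q A = 0)"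
    using matrix_secant_hypersurface[OF gr m f g] by blast
  then obtain Q where Q: "\<And>j. complex_polynomial_function (Q j)" "\<And>j. \<exists>A. Q j A \<noteq> 0"
    "\<And>j x y A. x \<in> X \<Longrightarrow> y \<in> X \<Longrightarrow> g x $ j \<noteq> g y $ j \<Longrightarrow> index_matrix A *v (g x - g y) = f x - f y \<Longrightarrow> Q j A = 0"
    by metis
  define P where "P A = (\<Prod>j\<in>UNIV. Q j A)" for A
  have P: "complex_polynomial_function P" unfolding P_def[abs_def] by (intro cpf_prod Q)
  obtain A1 where A1: "P A1 \<noteq> 0"
    using cpf_nonzero_common_family[of UNIV Q] Q by (auto simp: P_def)
  have D: "complex_polynomial_function (\<lambda>A. det (index_matrix A))"
    unfolding det_def index_matrix_def
    by (simp, intro cpf_sum cpf_mult cpf_prod cpf_const cpf_coord)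
  define A2 :: "complex ^ ('m \<times> 'm)" where "A2 = (\<chi> q. if fst q = snd q then 1 else 0)"
  have "index_matrix A2 = mat 1" by (simp add: index_matrix_def A2_def mat_def vec_eq_iff)
  then have A2: "det (index_matrix A2) \<noteq> 0" by simp
  have U: "A \<in> coord_space UNIV" for A :: "complex ^ ('m \<times> 'm)" by (simp add: coord_space_def)
  obtain A where A: "P A \<noteq> 0" "det (index_matrix A) \<noteq> 0"
    using cpf_nonzero_common[OF P D U A1 U A2] by blast
  have "\<forall>x\<in>X. \<forall>y\<in>X. \<forall>j B. g x $ j \<noteq> g y $ j \<and> index_matrix B *v (g x - g y) = f x - f y \<longrightarrow> P B = 0"
  proof (intro ballI allI impI)
    fix x y j B
    assume "x \<in> X" "y \<in> X" "g x $ j \<noteq> g y $ j \<and> index_matrix B *v (g x - g y) = f x - f y"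
    then have "Q j B = 0" using Q(3) by blast
    then show "P B = 0" unfolding P_def by (intro prod_zero) auto
  qed
  then show ?thesis using P A by (intro exI[of _ P] exI[of _ A] conjI) (simp_all add: invertible_det_nz)
qed

text \<open>The pencil \<open>(1 - t) f - t A g\<close> joins \<open>f\<close> to \<open>- A g\<close>; for generic \<open>A\<close> all but finitely many
  complex \<open>t\<close> give embeddings, and these \<open>t\<close> form a connected set.\<close>

theorem embeddings_ambient_equivalent:
  fixes X :: "(complex ^ 'n) set" and f g :: "complex ^ 'n \<Rightarrow> complex ^ 'm"
  assumes X: "algebraic_set X" "X \<noteq> {}" "growth X k" and m: "2 * k < CARD('m)"
    and f: "\<And>i. complex_polynomial_function (\<lambda>x. f x $ i)"
    and g: "\<And>i. complex_polynomial_function (\<lambda>x. g x $ i)"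
    and a: "a > 0" "\<And>x y. x \<in> X \<Longrightarrow> y \<in> X \<Longrightarrow> a * norm (f x - f y) \<le> norm (g x - g y)"
    and b: "b \<ge> 0" "\<And>x y. x \<in> X \<Longrightarrow> y \<in> X \<Longrightarrow> norm (g x - g y) \<le> b * norm (f x - f y)"
  shows "\<exists>\<Phi>. bi_lipschitz_semialgebraic_homeomorphism \<Phi> \<and> (\<forall>x\<in>X. g x = \<Phi> (f x))"
proof -
  obtain Q A where QA: "complex_polynomial_function Q" "Q A \<noteq> 0" "invertible (index_matrix A)"
    "\<forall>x\<in>X. \<forall>y\<in>X. \<forall>j B. g x $ j \<noteq> g y $ j \<and> index_matrix B *v (g x - g y) = f x - f y \<longrightarrow> Q B = 0"
    using exists_generic_matrix[OF X(3) m f g] by blast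
  have sec: "Q B = 0" if "x \<in> X" "y \<in> X" "g x $ j \<noteq> g y $ j" "index_matrix B *v (g x - g y) = f x - f y" for x y j B
    using QA(4) that by blast
  define M where "M = index_matrix A"
  obtain N where N: "N ** M = mat 1" "M ** N = mat 1" using QA(3) by (auto simp: invertible_def M_def)
  have NM: "N *v (M *v y) = y" "M *v (N *v y) = y" for y
    using N by (simp_all add: matrix_vector_mul_assoc)
  define F where "F t x = (1 - t) *s f x - t *s (M *v g x)" for t x
  have Fdiff: "F t x - F t y = (1 - t) *s (f x - f y) - t *s (M *v (g x - g y))" for t x y
    by (simp add: F_def vec_eq_iff matrix_vector_mult_diff_distrib algebra_simps)
  have Fpoly: "polynomial_function (F t)" for t
  proof (rule cpf_map_polynomial_function)
    fix i
    have "complex_polynomial_function (\<lambda>x. \<Sum>l\<in>UNIV. A $ (i, l) * g x $ l)" by (intro cpf_sum cpf_mult cpf_const g)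
    then show "complex_polynomial_function (\<lambda>x. F t x $ i)"
      unfolding F_def M_def by (simp add: index_matrix_mult_nth) (intro cpf_diff cpf_mult cpf_const f)
  qed
  obtain r where r: "\<forall>t. Q (0 + t *s A) = poly r t" using cpf_on_line[OF QA(1)] by blast
  have "poly r 1 \<noteq> 0" using r[rule_format, of 1] QA(2) by simp
  then have "r \<noteq> 0" by auto
  \<comment> \<open>For \<open>t \<noteq> 1\<close> the pencil is \<open>1 - t\<close> times
    \<open>f - s A g\<close> with \<open>s = t / (1 - t)\<close>, so exceptional values come from
    zeros of \<open>Q\<close> on the line through 0 and \<open>A\<close>. The ends are good in their
    own right: at 0 the pencil is \<open>f\<close>, and at 1 the matrix is invertible.\<close>
  define bad where "bad = {t. t \<noteq> 0 \<and> t \<noteq> 1 \<and> poly r (t / (1 - t)) = 0}"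
  have "bad \<subseteq> (\<lambda>s. s / (1 + s)) ` {s. poly r s = 0}"
  proof
    fix t assume t: "t \<in> bad"
    then have "t = t / (1 - t) / (1 + t / (1 - t))" by (auto simp: bad_def field_simps)
    then show "t \<in> (\<lambda>s. s / (1 + s)) ` {s. poly r s = 0}"
      by (rule image_eqI) (use t in \<open>simp add: bad_def\<close>)
  qed
  then have fbad: "finite bad" using poly_roots_finite[OF \<open>r \<noteq> 0\<close>] finite_subset by blast
  obtain K where K: "K > 0" "\<And>y. norm (M *v y) \<le> norm y * K"
    using bounded_linear.pos_bounded[OF matrix_vector_mul_bounded_linear[of M]] by blast
  obtain L where L: "L > 0" "\<And>y. norm (N *v y) \<le> norm y * L"
    using bounded_linear.pos_bounded[OF matrix_vector_mul_bounded_linear[of N]] by blast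
  have good: "\<exists>c>0. \<forall>x\<in>X. \<forall>y\<in>X. c * norm (f x - f y) \<le> norm (F t x - F t y)" if t: "t \<notin> bad" for t
  proof -
    consider "t = 0" | "t = 1" | "t \<noteq> 0" "t \<noteq> 1" by blast
    then show ?thesis
    proof cases
      case 1
      then show ?thesis by (intro exI[of _ 1]) (simp add: F_def)
    next
      case 2
      have "a / L * norm (f x - f y) \<le> norm (F t x - F t y)" if x: "x \<in> X" "y \<in> X" for x y
      proof -
        have "a * norm (f x - f y) \<le> norm (N *v (M *v (g x - g y)))" using a(2)[OF x] by (simp add: NM)
        also have "\<dots> \<le> norm (M *v (g x - g y)) * L" by (rule L(2))
        also have "norm (M *v (g x - g y)) = norm (F t x - F t y)" by (simp add: Fdiff 2)
        finally show ?thesis using L(1) by (simp add: field_simps)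
      qed
      then show ?thesis using a(1) L(1) by (intro exI[of _ "a / L"]) auto
    next
      case 3
      define s where "s = t / (1 - t)"
      have "poly r s \<noteq> 0" using t 3 by (simp add: bad_def s_def)
      then have Qs: "Q (s *s A) \<noteq> 0" using r by (metis add_0)
      have "\<exists>c>0. \<forall>x\<in>X. \<forall>y\<in>X. c * norm (f x - f y) \<le>
          norm ((f x - f y) - index_matrix (s *s A) *v (g x - g y))"
        by (rule generic_matrix_lower_bound[OF QA(1) Qs sec a])
      then obtain c where c: "c > 0" "\<forall>x\<in>X. \<forall>y\<in>X. c * norm (f x - f y) \<le>
          norm ((f x - f y) - index_matrix (s *s A) *v (g x - g y))" by blast
      have "norm (1 - t) * c * norm (f x - f y) \<le> norm (F t x - F t y)" if x: "x \<in> X" "y \<in> X" for x y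
      proof -
        have "F t x - F t y = (1 - t) *s ((f x - f y) - index_matrix (s *s A) *v (g x - g y))"
          unfolding Fdiff index_matrix_scale M_def using 3 by (simp add: vec_eq_iff s_def field_simps)
        then have "norm (F t x - F t y) = norm (1 - t) * norm ((f x - f y) - index_matrix (s *s A) *v (g x - g y))"
          by (simp only: norm_vector_scalar)
        then show ?thesis using c(2) x by (simp add: mult.assoc mult_left_mono)
      qed
      moreover have "norm (1 - t) * c > 0" using c 3 by simp
      ultimately show ?thesis by blast
    qed
  qed
  define R where "R s t \<longleftrightarrow> (\<exists>\<Phi>. bi_lipschitz_semialgebraic_homeomorphism \<Phi> \<and> (\<forall>x\<in>X. F t x = \<Phi> (F s x)))" for s t
  have nearby: "\<exists>\<eta>>0. \<forall>s. dist s t < \<eta> \<longrightarrow> R t s" if t: "t \<notin> bad" for t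
  proof -
    obtain c where c: "c > 0" "\<forall>x\<in>X. \<forall>y\<in>X. c * norm (f x - f y) \<le> norm (F t x - F t y)" using good[OF t] by blast
    \<comment> \<open>\<open>1 + b * K\<close> bounds the change of the pencil per unit of
      \<open>t\<close> relative to secants of \<open>f\<close>; division by \<open>c\<close> makes
      the bound relative to secants of \<open>F t\<close>.\<close>
    define C where "C = (1 + b * K) / c"
    have C: "C > 0" using b K c by (simp add: C_def add_pos_nonneg)
    define \<eta> where "\<eta> = 1 / (2 * C * real DIM(complex ^ 'm))"
    have "R t s" if s: "dist s t < \<eta>" for s
    proof -
      have close: "norm ((F s x - F t x) - (F s y - F t y)) \<le> norm (s - t) * C * norm (F t x - F t y)"
        if x: "x \<in> X" "y \<in> X" for x y
      proof -
        have "(F s x - F t x) - (F s y - F t y) = (F s x - F s y) - (F t x - F t y)" by simp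
        also have "\<dots> = (t - s) *s ((f x - f y) + M *v (g x - g y))"
          unfolding Fdiff by (simp add: vec_eq_iff algebra_simps)
        finally have "norm ((F s x - F t x) - (F s y - F t y)) = norm (s - t) * norm ((f x - f y) + M *v (g x - g y))"
          by (simp only: norm_vector_scalar norm_minus_commute)
        moreover have "norm ((f x - f y) + M *v (g x - g y)) \<le> C * norm (F t x - F t y)"
        proof -
          have "norm ((f x - f y) + M *v (g x - g y)) \<le> norm (f x - f y) + norm (g x - g y) * K"
            using norm_triangle_ineq K(2) by (meson add_left_mono order_trans)
          also have "\<dots> \<le> norm (f x - f y) + b * norm (f x - f y) * K"
            using b(2)[OF x] K(1) by (intro add_left_mono mult_right_mono) auto
          also have "\<dots> = C * (c * norm (f x - f y))" using c by (simp add: C_def field_simps)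
          also have "\<dots> \<le> C * norm (F t x - F t y)" using c(2) x C by (intro mult_left_mono) auto
          finally show ?thesis .
        qed
        ultimately show ?thesis by (simp add: mult.assoc mult_left_mono)
      qed
      have "norm (s - t) * C * real DIM(complex ^ 'm) \<le> \<eta> * C * real DIM(complex ^ 'm)"
        using s C by (intro mult_right_mono) (auto simp: dist_norm)
      also have "\<dots> = 1 / 2" using C by (simp add: \<eta>_def)
      finally show ?thesis
        unfolding R_def
        using small_displacement_homeomorphism[OF algebraic_imp_semialgebraic[OF X(1)] X(2) Fpoly Fpoly close] C
        by simp
    qed
    moreover have "\<eta> > 0" using C by (simp add: \<eta>_def)
    ultimately show ?thesis by blast
  qed
  \<comment> \<open>Ambient equivalence is an equivalence relation with relatively open classes, so
    the connected set of good parameters is a single class.\<close>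
  have "R 0 1"
  proof (rule connected_equivalence_relation[of "UNIV - bad"])
    show "connected (UNIV - bad)"
      by (rule connected_open_delete_finite[OF open_UNIV connected_UNIV _ fbad]) simp
    show "0 \<in> UNIV - bad" "1 \<in> UNIV - bad" by (auto simp: bad_def)
    show "R t s" if "R s t" for s t
      using that bi_lipschitz_semialgebraic_homeomorphism_inverse unfolding R_def by metis
    show "R s u" if RR: "R s t" "R t u" for s t u
    proof -
      obtain \<Phi> \<Phi>' where "bi_lipschitz_semialgebraic_homeomorphism \<Phi>" "\<forall>x\<in>X. F t x = \<Phi> (F s x)"
        "bi_lipschitz_semialgebraic_homeomorphism \<Phi>'" "\<forall>x\<in>X. F u x = \<Phi>' (F t x)"
        using RR unfolding R_def by blast
      then show ?thesis unfolding R_def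
        by (intro exI[of _ "\<lambda>x. \<Phi>' (\<Phi> x)"]) (simp add: bi_lipschitz_semialgebraic_homeomorphism_compose)
    qed
    show "\<exists>T. openin (top_of_set (UNIV - bad)) T \<and> t \<in> T \<and> (\<forall>s\<in>T. R t s)" if t: "t \<in> UNIV - bad" for t
    proof -
      obtain \<eta> where \<eta>: "\<eta> > 0" "\<forall>s. dist s t < \<eta> \<longrightarrow> R t s" using nearby t by blast
      have "openin (top_of_set (UNIV - bad)) ((UNIV - bad) \<inter> ball t \<eta>)" by (rule openin_open_Int) simp
      then show ?thesis using t \<eta>
        by (intro exI[of _ "(UNIV - bad) \<inter> ball t \<eta>"]) (auto simp: dist_commute)
    qed
  qed
  then obtain \<Phi> where \<Phi>: "bi_lipschitz_semialgebraic_homeomorphism \<Phi>" "\<forall>x\<in>X. F 1 x = \<Phi> (F 0 x)"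
    unfolding R_def by blast
  have mm: "B *v (- y) = - (B *v y)" for B :: "complex ^ 'm ^ 'm" and y
    using matrix_vector_mult_diff_distrib[of B 0 y] by simp
  \<comment> \<open>At \<open>t = 1\<close> the pencil is \<open>- M g\<close>; this linear map
    undoes the factor.\<close>
  have lin: "bi_lipschitz_semialgebraic_homeomorphism (\<lambda>y. - (N *v y))"
    by (rule bi_lipschitz_semialgebraic_homeomorphism_linear[of _ "\<lambda>y. - (M *v y)"])
       (auto intro!: bounded_linear_minus simp: NM mm)
  have "g x = - (N *v (\<Phi> (f x)))" if "x \<in> X" for x
  proof -
    have "\<Phi> (f x) = - (M *v g x)" using \<Phi>(2) that by (simp add: F_def)
    then have "N *v (\<Phi> (f x)) = - (N *v (M *v g x))" by (simp add: mm)
    then show ?thesis by (simp add: NM)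
  qed
  then show ?thesis
    using bi_lipschitz_semialgebraic_homeomorphism_compose[OF \<Phi>(1) lin] by (intro exI[of _ "\<lambda>y. - (N *v \<Phi> y)"]) auto
qed

lemma regular_bi_lipschitz_embeddingE:
  assumes "regular_bi_lipschitz_embedding X f"
  obtains p L M where "\<And>i. complex_polynomial_function (\<lambda>x. p x $ i)" "\<And>x. x \<in> X \<Longrightarrow> f x = p x"
    "L \<ge> 0" "\<And>x y. x \<in> X \<Longrightarrow> y \<in> X \<Longrightarrow> norm (f x - f y) \<le> L * norm (x - y)"
    "M \<ge> 0" "\<And>x y. x \<in> X \<Longrightarrow> y \<in> X \<Longrightarrow> norm (x - y) \<le> M * norm (f x - f y)"
proof -
  obtain p where p: "\<forall>i. complex_polynomial_function (\<lambda>x. p x $ i)" "\<forall>x\<in>X. f x = p x"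
    using assms by (auto simp: regular_bi_lipschitz_embedding_def regular_on_def)
  obtain L M where LM: "inj_on f X" "L-lipschitz_on X f" "M-lipschitz_on (f ` X) (inv_into X f)"
    using assms by (auto simp: regular_bi_lipschitz_embedding_def bi_lipschitz_embedding_def)
  have "norm (x - y) \<le> M * norm (f x - f y)" if "x \<in> X" "y \<in> X" for x y
    using lipschitz_onD[OF LM(3), of "f x" "f y"] that LM(1) by (simp add: dist_norm inv_into_f_f)
  moreover have "norm (f x - f y) \<le> L * norm (x - y)" if "x \<in> X" "y \<in> X" for x y
    using lipschitz_onD[OF LM(2) that] by (simp add: dist_norm)
  ultimately show ?thesis
    using that[of p L M] p lipschitz_on_nonneg[OF LM(2)] lipschitz_on_nonneg[OF LM(3)] by blast
qed

theorem theorem4p8: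
  fixes X :: "(complex ^ 'n) set" and k :: nat
  assumes "algebraic_set X"
    and "has_algebraic_dim X k"
    and "CARD('m::finite) = 2 * k + 1"
  shows "(\<exists>f :: complex ^ 'n \<Rightarrow> complex ^ 'm. regular_bi_lipschitz_embedding X f) \<and>
    (\<forall>(f :: complex ^ 'n \<Rightarrow> complex ^ 'm) (g :: complex ^ 'n \<Rightarrow> complex ^ 'm).
      regular_bi_lipschitz_embedding X f \<and> regular_bi_lipschitz_embedding X g \<longrightarrow>
      (\<exists>\<Phi> :: complex ^ 'm \<Rightarrow> complex ^ 'm.
        bi_lipschitz_semialgebraic_homeomorphism \<Phi> \<and> (\<forall>x\<in>X. g x = \<Phi> (f x))))"
proof (intro conjI allI impI)
  show "\<exists>f :: complex ^ 'n \<Rightarrow> complex ^ 'm. regular_bi_lipschitz_embedding X f"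
    by (rule exists_regular_bi_lipschitz_embedding[OF assms(1,2)]) (simp add: assms(3))
next
  fix f g :: "complex ^ 'n \<Rightarrow> complex ^ 'm"
  assume fg: "regular_bi_lipschitz_embedding X f \<and> regular_bi_lipschitz_embedding X g"
  \<comment> \<open>\<open>f\<close> and \<open>g\<close> are known to be polynomial only on
    \<open>X\<close>, so the argument runs with polynomial representatives \<open>p\<close> and
    \<open>q\<close>.\<close>
  obtain p L M where p: "\<And>i. complex_polynomial_function (\<lambda>x. p x $ i)" "\<And>x. x \<in> X \<Longrightarrow> f x = p x"
    "L \<ge> 0" "\<And>x y. x \<in> X \<Longrightarrow> y \<in> X \<Longrightarrow> norm (f x - f y) \<le> L * norm (x - y)"
    "M \<ge> 0" "\<And>x y. x \<in> X \<Longrightarrow> y \<in> X \<Longrightarrow> norm (x - y) \<le> M * norm (f x - f y)"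
    using regular_bi_lipschitz_embeddingE[of X f] fg by blast
  obtain q L' M' where q: "\<And>i. complex_polynomial_function (\<lambda>x. q x $ i)" "\<And>x. x \<in> X \<Longrightarrow> g x = q x"
    "L' \<ge> 0" "\<And>x y. x \<in> X \<Longrightarrow> y \<in> X \<Longrightarrow> norm (g x - g y) \<le> L' * norm (x - y)"
    "M' \<ge> 0" "\<And>x y. x \<in> X \<Longrightarrow> y \<in> X \<Longrightarrow> norm (x - y) \<le> M' * norm (g x - g y)"
    using regular_bi_lipschitz_embeddingE[of X g] fg by blast
  \<comment> \<open>The summand 1 keeps the denominator positive when \<open>L * M'\<close> is 0, as
    may happen for a one-point set.\<close>
  have 1: "1 / (L * M' + 1) * norm (p x - p y) \<le> norm (q x - q y)" if x: "x \<in> X" "y \<in> X" for x y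
  proof -
    have "norm (p x - p y) \<le> L * norm (x - y)" using p(4)[OF x] p(2) x by simp
    moreover have "norm (x - y) \<le> M' * norm (q x - q y)" using q(6)[OF x] q(2) x by simp
    then have "L * norm (x - y) \<le> L * (M' * norm (q x - q y))" by (rule mult_left_mono) (rule p(3))
    ultimately have "norm (p x - p y) \<le> L * (M' * norm (q x - q y))" by (rule order_trans)
    also have "\<dots> \<le> (L * M' + 1) * norm (q x - q y)" by (simp add: algebra_simps)
    finally have "norm (p x - p y) \<le> (L * M' + 1) * norm (q x - q y)" .
    moreover have "L * M' + 1 > 0" using p(3) q(5) by (simp add: add_nonneg_pos)
    ultimately show ?thesis by (simp add: pos_divide_le_eq mult.commute)
  qed
  have 2: "norm (q x - q y) \<le> L' * M * norm (p x - p y)" if x: "x \<in> X" "y \<in> X" for x y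
  proof -
    have "norm (q x - q y) \<le> L' * norm (x - y)" using q(4)[OF x] q(2) x by simp
    moreover have "norm (x - y) \<le> M * norm (p x - p y)" using p(6)[OF x] p(2) x by simp
    then have "L' * norm (x - y) \<le> L' * (M * norm (p x - p y))" by (rule mult_left_mono) (rule q(3))
    ultimately have "norm (q x - q y) \<le> L' * (M * norm (p x - p y))" by (rule order_trans)
    then show ?thesis by (simp add: mult.assoc)
  qed
  have "\<exists>\<Phi>. bi_lipschitz_semialgebraic_homeomorphism \<Phi> \<and> (\<forall>x\<in>X. q x = \<Phi> (p x))"
  proof (rule embeddings_ambient_equivalent[OF assms(1) algebraic_dim_growth(2,1)[OF assms(1,2)] _ p(1) q(1) _ 1 _ 2])
    show "2 * k < CARD('m)" using assms(3) by simp
    show "1 / (L * M' + 1) > 0" using p(3) q(5) by (simp add: add_nonneg_pos)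
    show "L' * M \<ge> 0" using p(5) q(3) by simp
  qed
  then show "\<exists>\<Phi>. bi_lipschitz_semialgebraic_homeomorphism \<Phi> \<and> (\<forall>x\<in>X. g x = \<Phi> (f x))"
    using p(2) q(2) by auto
qed

end
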